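(* Let $\mathbb{A}=(a_{ij})_{i,j\in I}$ be a symmetrizable Borcherds–Cartan matrix with countable index set $I$, let $\mathbf{m}=(m_i\mid i\in I)$ be a charge, let $q\in k\setminus 0$ be transcendental over $\mathbb{Q}$, and let $\mathcal{B}$ and $R$ be as defined in the context. (1) $R$ is simple as a left $\mathcal{B}$-module. (2) Given a left $\mathcal{B}$-module $M$, set $M_0=\{m\in M\mid e_{ik}m=0\text{ for all }i\in I,\ 1\le k\le m_i\}$. Then $$\kappa_M:R\otimes M_0\to M,\quad \kappa_M(r\otimes m)=rm$$ is a $\mathcal{B}$-linear injection, where $\mathcal{B}$ acts on $R\otimes M_0$ through the factor $R$. (3) In particular, $R_0=k$.
   Context: $k$ is a field of characteristic zero. $I$ is a countable (possibly infinite) index set; $\mathbb{A}=(a_{ij})_{i,j\in I}$ is an integer matrix with $a_{ii}=2$ or $a_{ii}\le 0$; $a_{ij}\le 0$ for $i\ne j$; $a_{ij}=0$ iff $a_{ji}=0$; and there are positive integers $s_i$ with $s_ia_{ij}=s_ja_{ji}$. The charge $\mathbf{m}=(m_i\mid i\in I)$ consists of positive integers, with $m_i=1$ whenever $a_{ii}=2$. Put $q_i=q^{s_i}$, $q_{ij}=q^{-s_ia_{ij}}\,(=q^{-s_ja_{ji}})$, and let $\left[{n\atop r}\right]_{q_i}$ be the symmetric $q_i$-binomial coefficients (built from $[n]_{q_i}=(q_i^n-q_i^{-n})/(q_i-q_i^{-1})$). The generalized $q$-boson algebra $\mathcal{B}$ associated to the quantized enveloping algebra $U_q$ of $(\mathbb{A},\mathbf{m})$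 is the $k$-algebra generated by $e_{ik},f'_{ik}$ ($i\in I$, $1\le k\le m_i$) with relations: $\sum_{r=0}^{1-a_{ij}}(-1)^r\left[{1-a_{ij}\atop r}\right]_{q_i}e_{ik}^{1-a_{ij}-r}e_{jl}e_{ik}^{r}=0$ if $a_{ii}=2$, $i\ne j$; the same relation with $f'$ in place of $e$; $e_{ik}e_{jl}=e_{jl}e_{ik}$ and $f'_{ik}f'_{jl}=f'_{jl}f'_{ik}$ if $a_{ij}=0$; and $e_{ik}f'_{jl}=q_{ij}f'_{jl}e_{ik}+\delta_{ij}\delta_{kl}$, for all $i,j\in I$, $1\le k\le m_i$, $1\le l\le m_j$. $R$ is the subalgebra of $\mathcal{B}$ generated by all $f'_{ik}$, and $S=U_q^+$ the subalgebra generated by all $e_{ik}$; multiplication gives a linear isomorphism $R\otimes S\simeq\mathcal{B}$. (In $U_q$, $f'_{ik}=-(q_i-q_i^{-1})f_{ik}K_i$.) $R$ is a left $\mathcal{B}$-module: $f'_{ik}$ acts by left multiplication and $$e_{ik}\triangleright f'_{j_1l_1}\cdots f'_{j_tl_t}=\sum_{p=1}^t\delta_{ij_p}\delta_{kl_p}q_{ij_1}\cdots q_{ij_{p-1}}f'_{j_1l_1}\cdots\widehat{f'_{j_pl_p}}\cdots f'_{j_tl_t},$$ where the hat means omission (so $e_{ik}\triangleright 1=0$). *)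

theory Defs
  imports
    "HOL-Computational_Algebra.Polynomial"
    "HOL-Library.Poly_Mapping"
    "HOL-Library.Countable_Set"
    "HOL-Algebra.QuotRing"
    "HOL-Algebra.Generated_Rings"
    "HOL-Algebra.Generated_Groups"
    "HOL-Algebra.Module"
begin

section \<open>Left modules over a not necessarily commutative ring\<close>

text \<open>The library locale \<^locale>\<open>module\<close> requires a commutative base ring; the record type and
  \<^locale>\<open>submodule\<close> do not. The fields \<open>mult\<close> and \<open>one\<close> of the module record are
  irrelevant.\<close>

locale left_module = ring R + M?: abelian_group M
  for R :: "('a, 'b) ring_scheme" (structure) and M :: "('a, 'c, 'd) module_scheme" (structure) +
  assumes left_smult_closed:
      "\<lbrakk>a \<in> carrier R; x \<in> carrier M\<rbrakk> \<Longrightarrow> a \<odot>\<^bsub>M\<^esub> x \<in> carrier M"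
    and left_smult_l_distr:
      "\<lbrakk>a \<in> carrier R; b \<in> carrier R; x \<in> carrier M\<rbrakk>
        \<Longrightarrow> (a \<oplus> b) \<odot>\<^bsub>M\<^esub> x = a \<odot>\<^bsub>M\<^esub> x \<oplus>\<^bsub>M\<^esub> b \<odot>\<^bsub>M\<^esub> x"
    and left_smult_r_distr:
      "\<lbrakk>a \<in> carrier R; x \<in> carrier M; y \<in> carrier M\<rbrakk>
        \<Longrightarrow> a \<odot>\<^bsub>M\<^esub> (x \<oplus>\<^bsub>M\<^esub> y) = a \<odot>\<^bsub>M\<^esub> x \<oplus>\<^bsub>M\<^esub> a \<odot>\<^bsub>M\<^esub> y"
    and left_smult_assoc:
      "\<lbrakk>a \<in> carrier R; b \<in> carrier R; x \<in> carrier M\<rbrakk>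
        \<Longrightarrow> (a \<otimes> b) \<odot>\<^bsub>M\<^esub> x = a \<odot>\<^bsub>M\<^esub> (b \<odot>\<^bsub>M\<^esub> x)"
    and left_smult_one: "x \<in> carrier M \<Longrightarrow> \<one> \<odot>\<^bsub>M\<^esub> x = x"

definition simple_left_module ::
    "('a, 'b) ring_scheme \<Rightarrow> ('a, 'c, 'd) module_scheme \<Rightarrow> bool" where
  "simple_left_module R M \<longleftrightarrow>
     left_module R M \<and> carrier M \<noteq> {\<zero>\<^bsub>M\<^esub>} \<and>
     (\<forall>H. submodule H R M \<longrightarrow> H = {\<zero>\<^bsub>M\<^esub>} \<or> H = carrier M)"

definition left_module_hom ::
    "('a, 'b) ring_scheme \<Rightarrow> ('a, 'c, 'd) module_scheme \<Rightarrow> ('a, 'e, 'f) module_scheme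
      \<Rightarrow> ('c \<Rightarrow> 'e) set" where
  "left_module_hom R M N =
     {h. left_module R M \<and> left_module R N \<and> h \<in> carrier M \<rightarrow> carrier N \<and>
         (\<forall>x\<in>carrier M. \<forall>y\<in>carrier M. h (x \<oplus>\<^bsub>M\<^esub> y) = h x \<oplus>\<^bsub>N\<^esub> h y) \<and>
         (\<forall>b\<in>carrier R. \<forall>x\<in>carrier M. h (b \<odot>\<^bsub>M\<^esub> x) = b \<odot>\<^bsub>N\<^esub> h x)}"


section \<open>Tensor products of vector spaces\<close>

text \<open>\<open>V \<otimes> W\<close> is the free vector space on \<open>V \<times> W\<close> modulo bilinearity. Every relation
  occurs with an arbitrary scalar \<open>d\<close>, so that the additive subgroup generated by the relations
  is a subspace.\<close>

definition tensor_free ::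
    "('k::field, 'v) module \<Rightarrow> ('k, 'w) module \<Rightarrow> (('v \<times> 'w) \<Rightarrow>\<^sub>0 'k) monoid" where
  "tensor_free V W =
     \<lparr>carrier = {z. Poly_Mapping.keys z \<subseteq> carrier V \<times> carrier W}, mult = (+), one = 0\<rparr>"

definition tensor_rels ::
    "('k::field, 'v) module \<Rightarrow> ('k, 'w) module \<Rightarrow> (('v \<times> 'w) \<Rightarrow>\<^sub>0 'k) set" where
  "tensor_rels V W =
     {Poly_Mapping.single (v \<oplus>\<^bsub>V\<^esub> v', w) d - Poly_Mapping.single (v, w) d
        - Poly_Mapping.single (v', w) d
      | v v' w d. v \<in> carrier V \<and> v' \<in> carrier V \<and> w \<in> carrier W} \<union>
     {Poly_Mapping.single (v, w \<oplus>\<^bsub>W\<^esub> w') d - Poly_Mapping.single (v, w) d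
        - Poly_Mapping.single (v, w') d
      | v w w' d. v \<in> carrier V \<and> w \<in> carrier W \<and> w' \<in> carrier W} \<union>
     {Poly_Mapping.single (c \<odot>\<^bsub>V\<^esub> v, w) d - Poly_Mapping.single (v, w) (c * d)
      | c v w d. v \<in> carrier V \<and> w \<in> carrier W} \<union>
     {Poly_Mapping.single (v, c \<odot>\<^bsub>W\<^esub> w) d - Poly_Mapping.single (v, w) (c * d)
      | c v w d. v \<in> carrier V \<and> w \<in> carrier W}"

definition tensor_null ::
    "('k::field, 'v) module \<Rightarrow> ('k, 'w) module \<Rightarrow> (('v \<times> 'w) \<Rightarrow>\<^sub>0 'k) set" where
  "tensor_null V W = generate (tensor_free V W) (tensor_rels V W)"

definition tensor ::
    "('k::field, 'v) module \<Rightarrow> ('k, 'w) module \<Rightarrow> (('v \<times> 'w) \<Rightarrow>\<^sub>0 'k) set monoid" where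
  "tensor V W = tensor_free V W Mod tensor_null V W"

definition pure_tensor ::
    "('k::field, 'v) module \<Rightarrow> ('k, 'w) module \<Rightarrow> 'v \<Rightarrow> 'w \<Rightarrow> (('v \<times> 'w) \<Rightarrow>\<^sub>0 'k) set" where
  "pure_tensor V W v w = tensor_null V W #>\<^bsub>tensor_free V W\<^esub> Poly_Mapping.single (v, w) 1"

text \<open>\<open>V \<otimes> W\<close> with the action \<open>b (v \<otimes> w) = act b v \<otimes> w\<close>. As usual for maps on quotients,
  \<^const>\<open>the_elem\<close> picks the common value on all representatives.\<close>

definition tensor_left_module ::
    "('k::field, 'v) module \<Rightarrow> ('k, 'w) module \<Rightarrow> ('b \<Rightarrow> 'v \<Rightarrow> 'v)
      \<Rightarrow> ('b, (('v \<times> 'w) \<Rightarrow>\<^sub>0 'k) set) module" where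
  "tensor_left_module V W act =
     \<lparr>carrier = carrier (tensor V W), mult = undefined, one = undefined,
      zero = one (tensor V W), add = mult (tensor V W),
      smult = (\<lambda>b X. the_elem
        ((\<lambda>z. tensor_null V W #>\<^bsub>tensor_free V W\<^esub>
            (\<Sum>(v, w)\<in>Poly_Mapping.keys z.
               Poly_Mapping.single (act b v, w) (Poly_Mapping.lookup z (v, w)))) ` X))\<rparr>"


section \<open>Free associative algebras\<close>

datatype 'g free_mon = Mon (letters: "'g list")

instantiation free_mon :: (type) monoid_add
begin

definition zero_free_mon :: "'a free_mon" where "0 = Mon []"

definition plus_free_mon :: "'a free_mon \<Rightarrow> 'a free_mon \<Rightarrow> 'a free_mon" where
  "u + v = Mon (letters u @ letters v)"

instance
  by standard (simp_all add: zero_free_mon_def plus_free_mon_def)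

end

text \<open>Since monomials are written additively, multiplication of \<^type>\<open>poly_mapping\<close>
  extends concatenation of words bilinearly.\<close>

definition free_algebra :: "'g set \<Rightarrow> ('g free_mon \<Rightarrow>\<^sub>0 'k::field) ring" where
  "free_algebra X =
     \<lparr>carrier = {p. \<forall>w\<in>Poly_Mapping.keys p. set (letters w) \<subseteq> X},
      mult = (*), one = 1, zero = 0, add = (+)\<rparr>"

definition free_gen :: "'g \<Rightarrow> ('g free_mon \<Rightarrow>\<^sub>0 'k::field)" where
  "free_gen x = Poly_Mapping.single (Mon [x]) 1"

definition free_scal :: "'k \<Rightarrow> ('g free_mon \<Rightarrow>\<^sub>0 'k::field)" where
  "free_scal c = Poly_Mapping.single 0 c"


section \<open>Symmetric Gaussian binomial coefficients\<close>

definition q_int :: "'k::field \<Rightarrow> nat \<Rightarrow> 'k" where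
  "q_int q n = (q ^ n - inverse q ^ n) / (q - inverse q)"

definition q_fact :: "'k::field \<Rightarrow> nat \<Rightarrow> 'k" where
  "q_fact q n = (\<Prod>t=1..n. q_int q t)"

definition q_binom :: "'k::field \<Rightarrow> nat \<Rightarrow> nat \<Rightarrow> 'k" where
  "q_binom q n r = q_fact q n / (q_fact q r * q_fact q (n - r))"


section \<open>The generalized q-boson algebra\<close>

text \<open>A symmetrizable Borcherds--Cartan matrix \<open>a\<close>, symmetrized by \<open>s\<close>, with a charge \<open>m\<close>.\<close>

locale charged_borcherds_cartan =
  fixes I :: "'i set" and a :: "'i \<Rightarrow> 'i \<Rightarrow> int" and s :: "'i \<Rightarrow> nat" and m :: "'i \<Rightarrow> nat"
  assumes countable_index: "countable I"
    and diag: "i \<in> I \<Longrightarrow> a i i = 2 \<or> a i i \<le> 0"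
    and off_diag: "\<lbrakk>i \<in> I; j \<in> I; i \<noteq> j\<rbrakk> \<Longrightarrow> a i j \<le> 0"
    and zero_iff: "\<lbrakk>i \<in> I; j \<in> I\<rbrakk> \<Longrightarrow> a i j = 0 \<longleftrightarrow> a j i = 0"
    and s_pos: "i \<in> I \<Longrightarrow> 0 < s i"
    and symmetrizable: "\<lbrakk>i \<in> I; j \<in> I\<rbrakk> \<Longrightarrow> int (s i) * a i j = int (s j) * a j i"
    and m_pos: "i \<in> I \<Longrightarrow> 0 < m i"
    and m_real: "\<lbrakk>i \<in> I; a i i = 2\<rbrakk> \<Longrightarrow> m i = 1"

datatype 'i boson_gen = GenE 'i nat | GenF 'i nat

type_synonym ('i, 'k) free_boson = "'i boson_gen free_mon \<Rightarrow>\<^sub>0 'k"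

type_synonym ('i, 'k) boson = "('i, 'k) free_boson set"

context
  fixes I :: "'i set" and a :: "'i \<Rightarrow> 'i \<Rightarrow> int" and s :: "'i \<Rightarrow> nat" and m :: "'i \<Rightarrow> nat"
    and q :: "'k::field_char_0"
begin

definition boson_index :: "('i \<times> nat) set" where
  "boson_index = (SIGMA i:I. {1..m i})"

definition q_pair :: "'i \<Rightarrow> 'i \<Rightarrow> 'k" where
  "q_pair i j = q powi (- (int (s i) * a i j))"

definition free_boson :: "('i, 'k) free_boson ring" where
  "free_boson = free_algebra
     ((\<lambda>(i, k). GenE i k) ` boson_index \<union> (\<lambda>(i, k). GenF i k) ` boson_index)"

definition serre ::
    "'i \<Rightarrow> 'i \<Rightarrow> ('i, 'k) free_boson \<Rightarrow> ('i, 'k) free_boson \<Rightarrow> ('i, 'k) free_boson" where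
  "serre i j x y =
     (let n = nat (1 - a i j) in
      \<Sum>r=0..n. free_scal ((-1) ^ r * q_binom (q ^ s i) n r) * x ^ (n - r) * y * x ^ r)"

definition boson_rels :: "('i, 'k) free_boson set" where
  "boson_rels =
     {serre i j (free_gen (GenE i k)) (free_gen (GenE j l))
      | i k j l. (i, k) \<in> boson_index \<and> (j, l) \<in> boson_index \<and> a i i = 2 \<and> i \<noteq> j} \<union>
     {serre i j (free_gen (GenF i k)) (free_gen (GenF j l))
      | i k j l. (i, k) \<in> boson_index \<and> (j, l) \<in> boson_index \<and> a i i = 2 \<and> i \<noteq> j} \<union>
     {free_gen (GenE i k) * free_gen (GenE j l) - free_gen (GenE j l) * free_gen (GenE i k)
      | i k j l. (i, k) \<in> boson_index \<and> (j, l) \<in> boson_index \<and> a i j = 0} \<union>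
     {free_gen (GenF i k) * free_gen (GenF j l) - free_gen (GenF j l) * free_gen (GenF i k)
      | i k j l. (i, k) \<in> boson_index \<and> (j, l) \<in> boson_index \<and> a i j = 0} \<union>
     {free_gen (GenE i k) * free_gen (GenF j l)
        - free_scal (q_pair i j) * free_gen (GenF j l) * free_gen (GenE i k)
        - (if i = j \<and> k = l then 1 else 0)
      | i k j l. (i, k) \<in> boson_index \<and> (j, l) \<in> boson_index}"

definition boson_ideal :: "('i, 'k) free_boson set" where
  "boson_ideal = Idl\<^bsub>free_boson\<^esub> boson_rels"

definition boson_alg :: "('i, 'k) boson ring" where
  "boson_alg = free_boson Quot boson_ideal"

definition boson_e :: "'i \<Rightarrow> nat \<Rightarrow> ('i, 'k) boson" where
  "boson_e i k = boson_ideal +>\<^bsub>free_boson\<^esub> free_gen (GenE i k)"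

definition boson_f :: "'i \<Rightarrow> nat \<Rightarrow> ('i, 'k) boson" where
  "boson_f i k = boson_ideal +>\<^bsub>free_boson\<^esub> free_gen (GenF i k)"

definition boson_scal :: "'k \<Rightarrow> ('i, 'k) boson" where
  "boson_scal c = boson_ideal +>\<^bsub>free_boson\<^esub> free_scal c"

text \<open>The \<open>k\<close>-subalgebra \<open>R\<close> generated by the \<open>f'\<close>.\<close>

definition boson_R :: "('i, 'k) boson set" where
  "boson_R = generate_ring boson_alg
     (range boson_scal \<union> (\<lambda>(i, k). boson_f i k) ` boson_index)"

definition boson_f_mon :: "('i \<times> nat) list \<Rightarrow> ('i, 'k) boson" where
  "boson_f_mon w =
     foldr (\<lambda>(j, l) x. boson_f j l \<otimes>\<^bsub>boson_alg\<^esub> x) w \<one>\<^bsub>boson_alg\<^esub>"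

text \<open>The value of \<open>e\<^sub>i\<^sub>k\<close> on the monomial of the word \<open>w\<close>: the sum, over the positions \<open>p\<close> of
  the letter \<open>(i, k)\<close>, of \<open>w\<close> with that letter omitted, weighted by the \<open>q\<^sub>i\<^sub>j\<close> of the
  letters to its left.\<close>

definition boson_e_on_mon :: "'i \<Rightarrow> nat \<Rightarrow> ('i \<times> nat) list \<Rightarrow> ('i, 'k) boson" where
  "boson_e_on_mon i k w =
     finsum boson_alg
       (\<lambda>p. if w ! p = (i, k)
            then boson_scal (\<Prod>t<p. q_pair i (fst (w ! t)))
                   \<otimes>\<^bsub>boson_alg\<^esub> boson_f_mon (take p w @ drop (Suc p) w)
            else \<zero>\<^bsub>boson_alg\<^esub>)
       {..<length w}"

definition boson_R_module ::
    "(('i, 'k) boson \<Rightarrow> ('i, 'k) boson \<Rightarrow> ('i, 'k) boson)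
      \<Rightarrow> (('i, 'k) boson, ('i, 'k) boson) module" where
  "boson_R_module act =
     \<lparr>carrier = boson_R, mult = mult boson_alg, one = one boson_alg,
      zero = zero boson_alg, add = add boson_alg, smult = act\<rparr>"

text \<open>\<open>act\<close> is the left module structure on \<open>R\<close>: it extends the given scalar multiplication
  of \<open>R\<close>, each \<open>f'\<close> acts by left multiplication, and each \<open>e\<close> by the formula
  \<open>boson_e_on_mon\<close> on monomials. These conditions determine \<open>act b r\<close> for \<open>b \<in> \<B>\<close> and \<open>r \<in> R\<close>.\<close>

definition is_boson_R_action ::
    "(('i, 'k) boson \<Rightarrow> ('i, 'k) boson \<Rightarrow> ('i, 'k) boson) \<Rightarrow> bool" where
  "is_boson_R_action act \<longleftrightarrow>
     left_module boson_alg (boson_R_module act) \<and>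
     (\<forall>c. \<forall>r\<in>boson_R. act (boson_scal c) r = boson_scal c \<otimes>\<^bsub>boson_alg\<^esub> r) \<and>
     (\<forall>(i, k)\<in>boson_index. \<forall>r\<in>boson_R. act (boson_f i k) r = boson_f i k \<otimes>\<^bsub>boson_alg\<^esub> r) \<and>
     (\<forall>(i, k)\<in>boson_index. \<forall>w\<in>lists boson_index.
        act (boson_e i k) (boson_f_mon w) = boson_e_on_mon i k w)"

text \<open>\<open>M\<^sub>0\<close> for a left module \<open>M\<close> over the q-boson algebra.\<close>

definition boson_invariants :: "(('i, 'k) boson, 'v) module \<Rightarrow> 'v set" where
  "boson_invariants M =
     {x \<in> carrier M. \<forall>(i, k)\<in>boson_index. boson_e i k \<odot>\<^bsub>M\<^esub> x = \<zero>\<^bsub>M\<^esub>}"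

text \<open>A subset \<open>X\<close> of \<open>M\<close> as a vector space over \<open>k\<close>, by restriction of scalars along
  \<open>k \<rightarrow> \<B>\<close>.\<close>

definition boson_k_space :: "(('i, 'k) boson, 'v) module \<Rightarrow> 'v set \<Rightarrow> ('k, 'v) module" where
  "boson_k_space M X =
     \<lparr>carrier = X, mult = mult M, one = one M, zero = zero M, add = add M,
      smult = (\<lambda>c x. boson_scal c \<odot>\<^bsub>M\<^esub> x)\<rparr>"

text \<open>\<open>R \<otimes> M\<^sub>0\<close>, where \<open>R\<close> carries the action \<open>act\<close>, and the map \<open>\<kappa>\<^sub>M\<close>.\<close>

definition boson_R_tensor ::
    "(('i, 'k) boson \<Rightarrow> ('i, 'k) boson \<Rightarrow> ('i, 'k) boson) \<Rightarrow> (('i, 'k) boson, 'v) module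
      \<Rightarrow> (('i, 'k) boson, ((('i, 'k) boson \<times> 'v) \<Rightarrow>\<^sub>0 'k) set) module" where
  "boson_R_tensor act M =
     tensor_left_module (boson_k_space (boson_R_module act) boson_R)
       (boson_k_space M (boson_invariants M)) act"

definition boson_R_pure ::
    "(('i, 'k) boson \<Rightarrow> ('i, 'k) boson \<Rightarrow> ('i, 'k) boson) \<Rightarrow> (('i, 'k) boson, 'v) module
      \<Rightarrow> ('i, 'k) boson \<Rightarrow> 'v \<Rightarrow> ((('i, 'k) boson \<times> 'v) \<Rightarrow>\<^sub>0 'k) set" where
  "boson_R_pure act M =
     pure_tensor (boson_k_space (boson_R_module act) boson_R)
       (boson_k_space M (boson_invariants M))"

definition boson_kappa ::
    "(('i, 'k) boson, 'v) module \<Rightarrow> ((('i, 'k) boson \<times> 'v) \<Rightarrow>\<^sub>0 'k) set \<Rightarrow> 'v" where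
  "boson_kappa M X = the_elem
     ((\<lambda>z. finsum M
        (\<lambda>(r, x). boson_scal (Poly_Mapping.lookup z (r, x)) \<odot>\<^bsub>M\<^esub> (r \<odot>\<^bsub>M\<^esub> x))
        (Poly_Mapping.keys z)) ` X)"

end

end

theory Submission
  imports Defs
begin

text \<open>On the free algebra in the letters \<open>f'\<close> the operators \<open>e\<^sub>a\<close> are skew derivations, and iterating
  them defines a symmetric bilinear form. All three assertions follow once the radical of this form is
  the two-sided ideal generated by the Serre relations: an element outside the radical is sent to a
  nonzero scalar, modulo the radical, by a longest word in the \<open>e\<^sub>a\<close> not killing it.

  To see that the radical is generated by the Serre relations, let \<open>P\<close> be an element of the radical of
  weight \<open>\<beta>\<close> of minimal height which is not in the Serre ideal. In smaller heights the form is
  nondegenerate modulo the Serre ideal, so a truncated quantum Casimir operator exists. It acts on weight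
  \<open>\<beta>\<close> by \<open>q\<close> to the power \<open>(\<beta>, \<beta>) - 2 (\<rho>, \<beta>)\<close>, but it fixes \<open>P\<close>, which is killed by all derivations
  modulo the Serre ideal. Hence \<open>(\<beta>, \<beta>) = 2 (\<rho>, \<beta>)\<close>. For a real letter \<open>a\<close> the quantum \<open>sl\<^sub>2\<close> of \<open>a\<close>
  acts integrably on the quotient by the left ideal generated by \<open>a\<close>, and \<open>P\<close> is a highest weight
  vector there, so \<open>(\<alpha>\<^sub>a, \<beta>) \<le> 0\<close>. Together with the signs of a Borcherds--Cartan matrix this leaves only
  weights supported on pairwise orthogonal imaginary letters; these letters commute, and on monomials
  in commuting letters the form is a positive integer.\<close>

section \<open>Linear algebra on free associative algebras\<close>

text \<open>All three assertions rest on one fact: an element of R killed by every e_a pairs to zero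
  with all nonempty words, so it differs from a scalar by an element of the radical, and that must
  vanish in R. In any module an invariant vector behaves under the e_a like 1 in R, so words in the
  e_a also read off the coefficients of a tensor.

  The obstacle is that nondegeneracy is known only below the height of \<beta>. The Casimir sum is
  therefore restricted to proper parts of \<beta>, with generalized inverses of Gram matrices and
  congruences modulo the Serre ideal in place of dual bases. It acts on the Verma module of highest
  weight 0 because there a product of e_a of full weight \<beta> annihilates weight \<beta>: the
  factor applied last meets f_a times the highest weight vector, on which K_a - K_a^(-1) is zero. So
  the omitted term contributes nothing.

  Transcendence of q enters as q^n \<noteq> 1 for n \<noteq> 0, turning an equality of eigenvalues
  into one of exponents. Characteristic zero makes a positive integer value of the form
  nonzero.\<close>

definition scl :: "'k::field \<Rightarrow> ('g free_mon \<Rightarrow>\<^sub>0 'k) \<Rightarrow> ('g free_mon \<Rightarrow>\<^sub>0 'k)" where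
  "scl c p = free_scal c * p"

definition word :: "'g list \<Rightarrow> ('g free_mon \<Rightarrow>\<^sub>0 'k::field)" where
  "word w = Poly_Mapping.single (Mon w) 1"

lemma scl_map: "scl c p = Poly_Mapping.map ((*) c) p"
  by (simp add: scl_def free_scal_def mult_map_scale_conv_mult)

lemma lookup_scl [simp]: "Poly_Mapping.lookup (scl c p) m = c * Poly_Mapping.lookup p m"
  by (simp add: scl_map map.rep_eq when_def)

lemma lookup_word: "Poly_Mapping.lookup (word w) m = (if m = Mon w then 1 else 0)"
  by (auto simp: word_def lookup_single when_def)

lemma lookup_sum: "Poly_Mapping.lookup (sum f A) m = (\<Sum>x\<in>A. Poly_Mapping.lookup (f x) m)"
  by (induction A rule: infinite_finite_induct) (auto simp: lookup_add)

lemma word_Nil: "word [] = 1"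
  by (simp add: word_def flip: zero_free_mon_def)

lemma word_append: "word (u @ v) = word u * word v"
  by (simp add: word_def mult_single plus_free_mon_def)

lemma free_gen_word: "free_gen x = word [x]"
  by (simp add: free_gen_def word_def)

lemma word_Cons: "word (a # w) = free_gen a * word w"
  using word_append[of "[a]" w] by (simp add: free_gen_word)

lemma word_replicate: "word (replicate n a) = free_gen a ^ n"
  by (induction n) (auto simp: word_Nil word_Cons)

lemma free_scal_0 [simp]: "free_scal 0 = 0" and free_scal_1 [simp]: "free_scal 1 = 1"
  and free_scal_add: "free_scal (c + d) = free_scal c + free_scal d"
  and free_scal_mult: "free_scal (c * d) = free_scal c * free_scal d"
  by (auto simp: free_scal_def single_add mult_single simp flip: single_uminus)

interpretation FA: vector_space "scl :: 'k::field \<Rightarrow> ('g free_mon \<Rightarrow>\<^sub>0 'k) \<Rightarrow> _"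
  by standard (auto simp: scl_def free_scal_add free_scal_mult algebra_simps)

abbreviation flin :: "(('g free_mon \<Rightarrow>\<^sub>0 'k::field) \<Rightarrow> ('h free_mon \<Rightarrow>\<^sub>0 'k)) \<Rightarrow> bool" where
  "flin \<equiv> Vector_Spaces.linear scl scl"

interpretation FP: vector_space_pair
  "scl :: 'k::field \<Rightarrow> ('g free_mon \<Rightarrow>\<^sub>0 'k) \<Rightarrow> _" "scl :: 'k \<Rightarrow> ('h free_mon \<Rightarrow>\<^sub>0 'k) \<Rightarrow> _"
  by standard

lemma word_expansion:
  "p = (\<Sum>m\<in>Poly_Mapping.keys p. scl (Poly_Mapping.lookup p m) (word (letters m)))"
proof (rule poly_mapping_eqI)
  fix m
  show "Poly_Mapping.lookup p m = Poly_Mapping.lookup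
    (\<Sum>m\<in>Poly_Mapping.keys p. scl (Poly_Mapping.lookup p m) (word (letters m))) m"
    by (auto simp: lookup_sum lookup_word if_distrib sum.delta in_keys_iff cong: if_cong)
qed

lemma in_span_words:
  assumes "\<And>m. m \<in> Poly_Mapping.keys p \<Longrightarrow> letters m \<in> W"
  shows "p \<in> FA.span (word ` W)"
  by (subst word_expansion) (intro FA.span_sum FA.span_scale FA.span_base imageI assms)

lemma span_words: "FA.span (range word) = UNIV"
  using in_span_words[of _ UNIV] by auto

lemma scl_mult_left: "scl c p * r = scl c (p * r)"
  by (simp add: scl_def mult.assoc)

lemma mult_free_scal: "p * free_scal c = free_scal c * p"
proof -
  have "p \<in> FA.span (range word)" by (simp add: span_words)
  then show ?thesis
  proof (induction rule: FA.span_induct_alt)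
    case (step d x y)
    have "x * free_scal c = free_scal c * x"
      using step.hyps by (auto simp: word_def free_scal_def mult_single)
    moreover have "free_scal d * (free_scal c * x) = free_scal c * (free_scal d * x)"
      unfolding mult.assoc[symmetric] by (metis free_scal_mult mult.commute)
    ultimately have "scl d x * free_scal c = free_scal c * scl d x"
      by (simp only: scl_def mult.assoc)
    then show ?case
      using step.IH by (simp add: distrib_left distrib_right)
  qed simp
qed

lemma scl_mult_right: "p * scl c r = scl c (p * r)"
proof -
  have "p * scl c r = (p * free_scal c) * r" by (simp only: scl_def mult.assoc)
  also have "\<dots> = scl c (p * r)" by (simp only: mult_free_scal scl_def mult.assoc)
  finally show ?thesis .
qed

lemmas scl_mult [simp] = scl_mult_left scl_mult_right

lemma flin_iff: "flin f \<longleftrightarrow> (\<forall>x y. f (x + y) = f x + f y) \<and> (\<forall>c x. f (scl c x) = scl c (f x))"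
  by (auto simp: Vector_Spaces.linear_iff FA.vector_space_axioms)

lemma flinI: "\<lbrakk>\<And>x y. f (x + y) = f x + f y; \<And>c x. f (scl c x) = scl c (f x)\<rbrakk> \<Longrightarrow> flin f"
  by (simp add: flin_iff)

lemma flin_add: "flin f \<Longrightarrow> f (x + y) = f x + f y"
  and flin_scl: "flin f \<Longrightarrow> f (scl c x) = scl c (f x)"
  by (auto simp: flin_iff)

lemmas flin_diff = FP.linear_diff and flin_sum = FP.linear_sum and flin_0 = FP.linear_0
  and flin_uminus = FP.linear_neg

lemma flin_ext:
  assumes "flin f" "flin g" "\<And>w. f (word w) = g (word w)"
  shows "f p = g p"
proof -
  have "p \<in> FA.span (range word)" by (simp add: span_words)
  then show ?thesis
    by (rule FP.linear_eq_on[OF assms(1,2)]) (use assms(3) in auto)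
qed

lemma flin_eq_on_span:
  assumes "flin f" "flin g" "\<And>w. w \<in> W \<Longrightarrow> f (word w) = g (word w)" "p \<in> FA.span (word ` W)"
  shows "f p = g p"
  by (rule FP.linear_eq_on[OF assms(1,2,4)]) (auto simp: assms(3))

lemma flin_compose: "\<lbrakk>flin f; flin g\<rbrakk> \<Longrightarrow> flin (\<lambda>x. f (g x))"
  by (simp add: flin_iff)

lemma flin_in_subspace:
  assumes "flin f" "FA.subspace S" "\<And>x. x \<in> B \<Longrightarrow> f x \<in> S" "x \<in> FA.span B"
  shows "f x \<in> S"
  using assms(4)
proof (induction rule: FA.span_induct_alt)
  case base then show ?case using assms by (simp add: flin_0 FA.subspace_0)
next
  case (step c x y) then show ?case using assms by (simp add: flin_iff FA.subspace_add FA.subspace_scale)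
qed

definition linext :: "('g list \<Rightarrow> ('h free_mon \<Rightarrow>\<^sub>0 'k)) \<Rightarrow> ('g free_mon \<Rightarrow>\<^sub>0 'k::field)
    \<Rightarrow> ('h free_mon \<Rightarrow>\<^sub>0 'k)" where
  "linext T p = (\<Sum>m\<in>Poly_Mapping.keys p. scl (Poly_Mapping.lookup p m) (T (letters m)))"

lemma linext_superset:
  assumes "finite A" "Poly_Mapping.keys p \<subseteq> A"
  shows "linext T p = (\<Sum>m\<in>A. scl (Poly_Mapping.lookup p m) (T (letters m)))"
  unfolding linext_def
  by (rule sum.mono_neutral_left) (use assms in \<open>auto simp: in_keys_iff\<close>)

lemma flin_linext:
  fixes T :: "'g list \<Rightarrow> ('h free_mon \<Rightarrow>\<^sub>0 'k::field)"
  shows "flin (linext T)"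
proof (rule flinI)
  fix p r :: "'g free_mon \<Rightarrow>\<^sub>0 'k"
  let ?A = "Poly_Mapping.keys p \<union> Poly_Mapping.keys r"
  have "Poly_Mapping.keys (p + r) \<subseteq> ?A" by (rule Poly_Mapping.keys_add)
  then show "linext T (p + r) = linext T p + linext T r"
    by (simp add: linext_superset[of ?A] lookup_add FA.scale_left_distrib sum.distrib)
next
  fix c and p :: "'g free_mon \<Rightarrow>\<^sub>0 'k"
  have "Poly_Mapping.keys (scl c p) \<subseteq> Poly_Mapping.keys p" by (auto simp: in_keys_iff)
  then show "linext T (scl c p) = scl c (linext T p)"
    by (simp add: linext_superset[of "Poly_Mapping.keys p"] FA.scale_sum_right)
qed

lemma linext_word [simp]:
  fixes T :: "'g list \<Rightarrow> ('h free_mon \<Rightarrow>\<^sub>0 'k::field)"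
  shows "linext T (word w) = T w"
proof -
  have "Poly_Mapping.keys (word w :: 'g free_mon \<Rightarrow>\<^sub>0 'k) \<subseteq> {Mon w}"
    by (auto simp: in_keys_iff lookup_word split: if_splits)
  then show ?thesis by (simp add: linext_superset[of "{Mon w}"] lookup_word)
qed

lemma linext_1 [simp]: "linext T 1 = T []"
  by (simp flip: word_Nil)

lemma flin_mult1: "flin f \<Longrightarrow> flin (\<lambda>x. f x * r)" and flin_mult2: "flin f \<Longrightarrow> flin (\<lambda>x. r * f x)"
  and flin_plus: "\<lbrakk>flin f; flin g\<rbrakk> \<Longrightarrow> flin (\<lambda>x. f x + g x)"
  and flin_minus: "\<lbrakk>flin f; flin g\<rbrakk> \<Longrightarrow> flin (\<lambda>x. f x - g x)"
  and flin_scale: "flin f \<Longrightarrow> flin (\<lambda>x. scl c (f x))"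
  and flin_id: "flin (\<lambda>x. x)" and flin_zero: "flin (\<lambda>x. 0)"
  and flin_if: "\<lbrakk>flin f; flin g\<rbrakk> \<Longrightarrow> flin (\<lambda>x. if P then f x else g x)"
  by (auto simp: flin_iff algebra_simps FA.scale_right_distrib FA.scale_right_diff_distrib
      FA.scale_left_commute)

lemmas flin_intros = flin_mult1 flin_mult2 flin_plus flin_minus flin_scale flin_id flin_zero flin_if
  flin_linext flin_compose[OF flin_linext]

section \<open>Skew derivations of the free algebra\<close>

text \<open>Reading \<open>c a b\<close> as (\<alpha>_a, \<alpha>_b) and a multiset of letters as an
  element of the positive root cone, this is the pairing (\<alpha>_a, \<mu>).\<close>

definition cw :: "('g \<Rightarrow> 'g \<Rightarrow> int) \<Rightarrow> 'g \<Rightarrow> 'g multiset \<Rightarrow> int" where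
  "cw c a \<mu> = (\<Sum>b\<in>#\<mu>. c a b)"

lemma cw_simps [simp]: "cw c a {#} = 0" "cw c a (add_mset b \<mu>) = c a b + cw c a \<mu>"
  "cw c a (\<mu> + \<nu>) = cw c a \<mu> + cw c a \<nu>"
  by (auto simp: cw_def)

lemma cw_minus [simp]: "cw (\<lambda>a b. - c a b) a \<mu> = - cw c a \<mu>"
  by (induction \<mu>) auto

text \<open>A torus element: an algebra automorphism acting on the weight space \<mu> by
  q^(-(\<alpha>_a, \<mu>)). Negating \<open>c\<close> gives its inverse.\<close>

definition tws :: "'k::field \<Rightarrow> ('g \<Rightarrow> 'g \<Rightarrow> int) \<Rightarrow> 'g \<Rightarrow> ('g free_mon \<Rightarrow>\<^sub>0 'k)
    \<Rightarrow> ('g free_mon \<Rightarrow>\<^sub>0 'k)" where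
  "tws q c a = linext (\<lambda>w. scl (q powi (- cw c a (mset w))) (word w))"

text \<open>The removed letter is charged for the letters to its left. When \<open>c\<close> is the
  symmetrized matrix, q^(-c a b) is the constant q_ij, so this is the action of e_a on R lifted to
  the free algebra.\<close>

primrec ldw :: "'k::field \<Rightarrow> ('g \<Rightarrow> 'g \<Rightarrow> int) \<Rightarrow> 'g \<Rightarrow> 'g list \<Rightarrow> ('g free_mon \<Rightarrow>\<^sub>0 'k)" where
  "ldw q c a [] = 0"
| "ldw q c a (b # w) =
     (if a = b then word w else 0) + scl (q powi (- c a b)) (free_gen b * ldw q c a w)"

definition ldr :: "'k::field \<Rightarrow> ('g \<Rightarrow> 'g \<Rightarrow> int) \<Rightarrow> 'g \<Rightarrow> ('g free_mon \<Rightarrow>\<^sub>0 'k)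
    \<Rightarrow> ('g free_mon \<Rightarrow>\<^sub>0 'k)" where
  "ldr q c a = linext (ldw q c a)"

text \<open>Mirror image of \<open>ldw\<close>: the removed letter is charged for the letters to its
  right.\<close>

primrec rdw :: "'k::field \<Rightarrow> ('g \<Rightarrow> 'g \<Rightarrow> int) \<Rightarrow> 'g \<Rightarrow> 'g list \<Rightarrow> ('g free_mon \<Rightarrow>\<^sub>0 'k)" where
  "rdw q c a [] = 0"
| "rdw q c a (b # w) = free_gen b * rdw q c a w + (if a = b then tws q c a (word w) else 0)"

definition rdr :: "'k::field \<Rightarrow> ('g \<Rightarrow> 'g \<Rightarrow> int) \<Rightarrow> 'g \<Rightarrow> ('g free_mon \<Rightarrow>\<^sub>0 'k)
    \<Rightarrow> ('g free_mon \<Rightarrow>\<^sub>0 'k)" where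
  "rdr q c a = linext (rdw q c a)"

definition revp :: "('g free_mon \<Rightarrow>\<^sub>0 'k::field) \<Rightarrow> ('g free_mon \<Rightarrow>\<^sub>0 'k)" where
  "revp = linext (\<lambda>w. word (rev w))"

definition hom_part :: "'g multiset \<Rightarrow> ('g free_mon \<Rightarrow>\<^sub>0 'k::field) set" where
  "hom_part \<beta> = FA.span (word ` {w. mset w = \<beta>})"

lemma flin_ops [simp]: "flin (tws q c a)" "flin (ldr q c a)" "flin (rdr q c a)" "flin revp"
  by (auto simp: tws_def ldr_def rdr_def revp_def flin_linext)

lemmas flin_ops_compose [simp] = flin_compose[OF flin_ops(1)] flin_compose[OF flin_ops(2)]
  flin_compose[OF flin_ops(3)] flin_compose[OF flin_ops(4)]

lemmas op_linear [simp] =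
  flin_add[OF flin_ops(1)] flin_add[OF flin_ops(2)] flin_add[OF flin_ops(3)] flin_add[OF flin_ops(4)]
  flin_scl[OF flin_ops(1)] flin_scl[OF flin_ops(2)] flin_scl[OF flin_ops(3)] flin_scl[OF flin_ops(4)]
  flin_0[OF flin_ops(1)] flin_0[OF flin_ops(2)] flin_0[OF flin_ops(3)] flin_0[OF flin_ops(4)]
  flin_diff[OF flin_ops(1)] flin_diff[OF flin_ops(2)] flin_diff[OF flin_ops(3)] flin_diff[OF flin_ops(4)]

lemma flin_ext2:
  assumes "\<And>y. flin (\<lambda>x. f x y)" "\<And>y. flin (\<lambda>x. g x y)" "\<And>x. flin (f x)" "\<And>x. flin (g x)"
    and "\<And>u v. f (word u) (word v) = g (word u) (word v)"
  shows "f x y = g x y"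
proof -
  have "f (word u) y = g (word u) y" for u
    by (rule flin_ext[OF assms(3,4,5)])
  then show ?thesis by (rule flin_ext[OF assms(1)[of y] assms(2)[of y]])
qed

lemma ops_1 [simp]: "tws q c a 1 = 1" "ldr q c a 1 = 0" "rdr q c a 1 = 0" "revp 1 = 1"
  by (auto simp: tws_def ldr_def rdr_def revp_def word_Nil)

lemma ops_gen [simp]: "tws q c a (free_gen b) = scl (q powi (- c a b)) (free_gen b)"
  "ldr q c a (free_gen b) = (if a = b then 1 else 0)"
  "rdr q c a (free_gen b) = (if a = b then 1 else 0)"
  "revp (free_gen b) = free_gen b"
  by (auto simp: tws_def ldr_def rdr_def revp_def word_Nil free_gen_word)

lemma tws_word: "tws q c a (word w) = scl (q powi (- cw c a (mset w))) (word w)"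
  by (simp add: tws_def)

lemma revp_word [simp]: "revp (word w) = word (rev w)"
  by (simp add: revp_def)

lemma revp_mult: "revp (x * y) = revp y * revp x"
  by (rule flin_ext2[where f="\<lambda>x y. revp (x * y)"])
    (simp_all add: flin_intros flip: word_append)

lemma revp_revp [simp]: "revp (revp x) = x"
  by (rule flin_ext[where f="\<lambda>x. revp (revp x)"]) (simp_all add: flin_intros)

lemma ldr_gen_mult: "ldr q c a (free_gen b * x) =
    (if a = b then x else 0) + scl (q powi (- c a b)) (free_gen b * ldr q c a x)"
  by (rule flin_ext[where f="\<lambda>x. ldr q c a (free_gen b * x)"])
    (auto simp: flin_intros ldr_def simp flip: word_Cons)

lemma rdr_gen_mult: "rdr q c a (free_gen b * x) =
    free_gen b * rdr q c a x + (if a = b then tws q c a x else 0)"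
  by (rule flin_ext[where f="\<lambda>x. rdr q c a (free_gen b * x)"])
    (auto simp: flin_intros rdr_def simp flip: word_Cons)

lemma flin_span_word_ball:
  assumes "flin f" "FA.subspace S" "\<And>w. mset w = \<beta> \<Longrightarrow> f (word w) \<in> S" "x \<in> hom_part \<beta>"
  shows "f x \<in> S"
  by (rule flin_in_subspace[OF assms(1,2) _ assms(4)[unfolded hom_part_def]]) (use assms(3) in auto)

lemma subspace_hom_part: "FA.subspace (hom_part \<beta>)"
  by (simp add: hom_part_def)

lemma word_in_hom_part: "mset w = \<beta> \<Longrightarrow> word w \<in> hom_part \<beta>"
  by (auto simp: hom_part_def intro: FA.span_base)

text \<open>Counterpart of \<open>flin_eq_on_span\<close> for maps with values in the field;
  identities of the form are reduced to words by it.\<close>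

lemma functional_ext:
  fixes f g :: "('g free_mon \<Rightarrow>\<^sub>0 'k::field) \<Rightarrow> 'k"
  assumes "\<And>x y. f (x + y) = f x + f y" "\<And>c x. f (scl c x) = c * f x"
    and "\<And>x y. g (x + y) = g x + g y" "\<And>c x. g (scl c x) = c * g x"
    and "\<And>w. w \<in> W \<Longrightarrow> f (word w) = g (word w)" "p \<in> FA.span (word ` W)"
  shows "f p = g p"
proof -
  have 0: "f 0 = 0" "g 0 = 0" using assms(2)[of 0 0] assms(4)[of 0 0] by simp_all
  show ?thesis
    using assms(6) by (induction rule: FA.span_induct_alt) (auto simp: assms(1-5) 0)
qed

lemma hom_part_mult:
  assumes "x \<in> hom_part \<alpha>" "y \<in> hom_part \<beta>"
  shows "x * y \<in> hom_part (\<alpha> + \<beta>)"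
proof -
  have "word w * y \<in> hom_part (\<alpha> + \<beta>)" if "mset w = \<alpha>" for w
    by (rule flin_span_word_ball[OF _ _ _ assms(2)])
      (use that in \<open>auto simp: flin_intros subspace_hom_part word_in_hom_part simp flip: word_append\<close>)
  then show ?thesis
    by (intro flin_span_word_ball[where f="\<lambda>x. x * y", OF _ _ _ assms(1)])
      (auto simp: flin_intros subspace_hom_part)
qed

lemma gen_mult_hom_part: "y \<in> hom_part \<beta> \<Longrightarrow> free_gen a * y \<in> hom_part (add_mset a \<beta>)"
  using hom_part_mult[of "free_gen a" "{#a#}" y \<beta>] by (simp add: free_gen_word word_in_hom_part)

lemma revp_hom_part: "x \<in> hom_part \<beta> \<Longrightarrow> revp x \<in> hom_part \<beta>"
  by (rule flin_span_word_ball[where f=revp]) (auto simp: subspace_hom_part word_in_hom_part)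

lemma tws_hom_part: "x \<in> hom_part \<beta> \<Longrightarrow> tws q c a x = scl (q powi (- cw c a \<beta>)) x"
  by (rule flin_eq_on_span[where W="{w. mset w = \<beta>}"]) (auto simp: hom_part_def tws_word flin_intros)

locale qwords =
  fixes q :: "'k::field" and c :: "'g \<Rightarrow> 'g \<Rightarrow> int"
  assumes q0: "q \<noteq> 0" and c_sym: "c a b = c b a"
begin

abbreviation "lder \<equiv> ldr q c"
abbreviation "rder \<equiv> rdr q c"
abbreviation "rbar \<equiv> rdr q (\<lambda>a b. - c a b)"
abbreviation "tw \<equiv> tws q c"
abbreviation "twb \<equiv> tws q (\<lambda>a b. - c a b)"

lemma q_add: "q powi (m + n) = q powi m * q powi n"
  using q0 by (simp add: power_int_add)

lemma q_diff: "q powi (m - n) = q powi m * q powi (- n)"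
  using q_add[of m "- n"] by simp

lemma q_cancel [simp]: "q powi m * q powi (- m) = 1" "q powi (- m) * q powi m = 1"
  using q_add[of m "-m"] q_add[of "-m" m] by auto

lemma tw_mult: "tw a (x * y) = tw a x * tw a y"
  by (rule flin_ext2[where f="\<lambda>x y. tw a (x * y)"])
    (simp_all add: flin_intros tws_word q_add q_diff mult.commute flip: word_append)

lemma tw_power: "tw a (free_gen b ^ n) = scl (q powi (- (int n * c a b))) (free_gen b ^ n)"
  by (induction n) (simp_all add: tw_mult algebra_simps flip: q_add)

lemma tw_twb [simp]: "tw a (twb a x) = x" "twb a (tw a x) = x"
proof -
  show "tw a (twb a x) = x"
    by (rule flin_ext[where f="\<lambda>x. tw a (twb a x)"]) (simp_all add: flin_intros tws_word)
  show "twb a (tw a x) = x"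
    by (rule flin_ext[where f="\<lambda>x. twb a (tw a x)"]) (simp_all add: flin_intros tws_word)
qed

lemma lder_mult: "lder a (x * y) = lder a x * y + tw a x * lder a y"
proof (rule flin_ext[where f="\<lambda>x. lder a (x * y)"])
  show "lder a (word w * y) = lder a (word w) * y + tw a (word w) * lder a y" for w
    by (induction w)
      (auto simp: word_Nil word_Cons mult.assoc ldr_gen_mult tw_mult algebra_simps FA.scale_right_distrib)
qed (auto simp: flin_intros)

lemma rder_mult: "rder a (x * y) = x * rder a y + rder a x * tw a y"
proof (rule flin_ext[where f="\<lambda>x. rder a (x * y)"])
  show "rder a (word w * y) = word w * rder a y + rder a (word w) * tw a y" for w
    by (induction w)
      (auto simp: word_Nil word_Cons mult.assoc rdr_gen_mult tw_mult algebra_simps FA.scale_right_distrib)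
qed (auto simp: flin_intros)

lemma lder_tw: "lder a (tw b x) = scl (q powi (- c b a)) (tw b (lder a x))"
proof (rule flin_ext[where f="\<lambda>x. lder a (tw b x)"])
  show "lder a (tw b (word w)) = scl (q powi (- c b a)) (tw b (lder a (word w)))" for w
    by (induction w)
      (auto simp: word_Nil word_Cons tw_mult ldr_gen_mult FA.scale_right_distrib mult.commute mult.left_commute)
qed (auto simp: flin_intros)

text \<open>The order matters only when the letter removed by \<open>lder a\<close> stands to the
  right of the one removed by \<open>rder b\<close>. Then one order contributes q^(-c b a) and the
  other q^(-c a b), which agree by symmetry of \<open>c\<close>.\<close>

lemma lder_rder: "lder a (rder b x) = rder b (lder a x)"
proof (rule flin_ext[where f="\<lambda>x. lder a (rder b x)"])
  show "lder a (rder b (word w)) = rder b (lder a (word w))" for w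
    by (induction w)
      (auto simp: word_Nil word_Cons rdr_gen_mult ldr_gen_mult lder_tw FA.scale_right_distrib c_sym algebra_simps)
qed (auto simp: flin_intros)

text \<open>The twist charges for all remaining letters. \<open>rbar\<close> has already contributed
  the opposite power for those on the right, so the charge for those on the left is left
  over.\<close>

lemma lder_rbar: "lder a x = tw a (rbar a x)"
proof (rule flin_ext[where g="\<lambda>x. tw a (rbar a x)"])
  show "lder a (word w) = tw a (rbar a (word w))" for w
    by (induction w) (auto simp: word_Nil word_Cons rdr_gen_mult ldr_gen_mult tw_mult algebra_simps)
qed (auto simp: flin_intros)

lemma rbar_lder: "rbar a x = twb a (lder a x)"
  by (simp add: lder_rbar)

lemma revp_tw: "revp (tw a x) = tw a (revp x)"
  by (rule flin_ext[where f="\<lambda>x. revp (tw a x)"]) (simp_all add: flin_intros tws_word)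

lemma revp_rder: "revp (rder a x) = lder a (revp x)"
proof (rule flin_ext[where f="\<lambda>x. revp (rder a x)"])
  show "revp (rder a (word w)) = lder a (revp (word w))" for w
    by (induction w)
      (simp_all add: word_Nil word_Cons rdr_gen_mult revp_mult revp_tw lder_mult word_append del: revp_word)
qed (auto simp: flin_intros)

lemma revp_lder: "revp (lder a x) = rder a (revp x)"
  by (metis revp_revp revp_rder)

lemma lder_word_notin: "a \<notin> set w \<Longrightarrow> lder a (word w) = 0"
  by (induction w) (auto simp: word_Nil word_Cons ldr_gen_mult)

lemma lder_word_in: "a \<in> set w \<Longrightarrow> lder a (word w) \<in> hom_part (mset w - {#a#})"
proof (induction w)
  case (Cons b w)
  have "free_gen b * lder a (word w) \<in> hom_part (mset (b # w) - {#a#})"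
  proof (cases "a \<in> set w")
    case True
    then show ?thesis
      using gen_mult_hom_part[OF Cons.IH[OF True], of b]
      by (cases "a = b") (auto simp: insert_DiffM)
  qed (simp add: lder_word_notin FA.subspace_0[OF subspace_hom_part])
  then show ?case
    by (auto simp: word_Cons ldr_gen_mult intro!: FA.subspace_add FA.subspace_scale subspace_hom_part word_in_hom_part FA.subspace_0)
qed auto

lemma lder_hom_part_notin: "a \<notin># \<beta> \<Longrightarrow> x \<in> hom_part \<beta> \<Longrightarrow> lder a x = 0"
  by (rule flin_eq_on_span[where W="{w. mset w = \<beta>}" and g="\<lambda>x. 0"])
    (auto simp: hom_part_def lder_word_notin flin_intros)

lemma lder_hom_part: "x \<in> hom_part \<beta> \<Longrightarrow> lder a x \<in> hom_part (\<beta> - {#a#})"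
proof (rule flin_span_word_ball[where f="lder a"])
  show "lder a (word w) \<in> hom_part (\<beta> - {#a#})" if "mset w = \<beta>" for w
    using that lder_word_in[of a w] lder_word_notin[of a w] FA.subspace_0[OF subspace_hom_part]
    by (cases "a \<in> set w") auto
qed (auto simp: subspace_hom_part)

lemma rder_hom_part_notin: "a \<notin># \<beta> \<Longrightarrow> x \<in> hom_part \<beta> \<Longrightarrow> rder a x = 0"
  by (metis lder_hom_part_notin op_linear(12) revp_hom_part revp_rder revp_revp)

lemma rder_hom_part: "x \<in> hom_part \<beta> \<Longrightarrow> rder a x \<in> hom_part (\<beta> - {#a#})"
  by (metis lder_hom_part revp_hom_part revp_rder revp_revp)

subsection \<open>The bilinear form and its radical\<close>

text \<open>The bilinear form with the word \<open>u\<close> in its first slot; \<open>bform\<close>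
  extends it linearly in that slot. The first letter of \<open>u\<close> acts first.\<close>

definition frm :: "'g list \<Rightarrow> ('g free_mon \<Rightarrow>\<^sub>0 'k) \<Rightarrow> 'k" where
  "frm u x = Poly_Mapping.lookup (fold lder u x) 0"

definition rad :: "('g free_mon \<Rightarrow>\<^sub>0 'k) set" where
  "rad = {x. \<forall>u. frm u x = 0}"

lemma frm_Nil: "frm [] x = Poly_Mapping.lookup x 0"
  and frm_Cons: "frm (a # u) x = frm u (lder a x)"
  by (auto simp: frm_def)

lemma frm_add: "frm u (x + y) = frm u x + frm u y"
  and frm_scl: "frm u (scl d x) = d * frm u x"
  by (induction u arbitrary: x y) (auto simp: frm_Nil frm_Cons lookup_add)

lemma frm_0 [simp]: "frm u 0 = 0"
  using frm_scl[of u 0 0] by simp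

lemma frm_diff: "frm u (x - y) = frm u x - frm u y"
  using frm_add[of u "x - y" y] by simp

lemma frm_sum: "frm u (sum f A) = (\<Sum>x\<in>A. frm u (f x))"
  by (induction A rule: infinite_finite_induct) (auto simp: frm_add)

lemma frm_ext:
  assumes "\<And>x y. f (x + y) = f x + f y" "\<And>c x. f (scl c x) = scl c (f x)"
    and "\<And>x y. g (x + y) = g x + g y" "\<And>c x. g (scl c x) = scl c (g x)"
    and "\<And>w. frm u (f (word w)) = frm v (g (word w))"
  shows "frm u (f x) = frm v (g x)"
  by (rule functional_ext[where W=UNIV and f="\<lambda>x. frm u (f x)" and g="\<lambda>x. frm v (g x)"])
    (simp_all add: assms frm_add frm_scl span_words)

lemma frm_Nil_word: "frm [] (word w) = (if w = [] then 1 else 0)"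
  by (simp add: frm_Nil lookup_word zero_free_mon_def)

lemma frm_Nil_gen_mult: "frm [] (free_gen b * x) = 0"
  using frm_ext[where f="\<lambda>x. free_gen b * x" and g="\<lambda>x. 0" and u="[]" and v="[]"]
  by (simp add: algebra_simps frm_Nil_word flip: word_Cons)

lemma frm_Nil_revp: "frm [] (revp x) = frm [] x"
  by (rule frm_ext) (auto simp: frm_Nil_word)

lemma frm_Nil_tw: "frm [] (tw a x) = frm [] x"
  by (rule frm_ext) (auto simp: tws_word frm_scl frm_Nil_word)

lemma frm_Nil_lder: "frm [] (lder a x) = frm [] (rder a x)"
proof (rule frm_ext[where f="lder a" and g="rder a"])
  show "frm [] (lder a (word w)) = frm [] (rder a (word w))" for w
    by (cases w)
      (auto simp: word_Nil word_Cons ldr_gen_mult rdr_gen_mult frm_add frm_scl frm_Nil_gen_mult frm_Nil_tw)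
qed auto

text \<open>After the last derivation only the constant term counts, and there \<open>lder a\<close>
  and \<open>rder a\<close> agree; moreover \<open>rder a\<close> commutes with the earlier left
  derivations. Hence the form can be evaluated from either end of the word.\<close>

lemma frm_snoc: "frm (u @ [a]) x = frm u (rder a x)"
  by (induction u arbitrary: x) (simp_all add: frm_Cons frm_Nil_lder lder_rder)

lemma frm_revp: "frm (rev u) (revp x) = frm u x"
  by (induction u arbitrary: x) (simp_all add: frm_Cons frm_snoc frm_Nil_revp flip: revp_lder)

lemma frm_tw: "frm u (tw a x) = q powi (- cw c a (mset u)) * frm u x"
  by (induction u arbitrary: x) (auto simp: frm_Nil_tw frm_Cons lder_tw frm_scl q_diff)

lemma subspace_rad: "FA.subspace rad"
  by (auto simp: FA.subspace_def rad_def frm_add frm_scl)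

lemma rad_lder: "x \<in> rad \<Longrightarrow> lder a x \<in> rad"
  by (auto simp: rad_def simp flip: frm_Cons)

lemma rad_rder: "x \<in> rad \<Longrightarrow> rder a x \<in> rad"
  by (auto simp: rad_def simp flip: frm_snoc)

lemma rad_tw: "x \<in> rad \<Longrightarrow> tw a x \<in> rad"
  by (auto simp: rad_def frm_tw)

lemma rad_revp: "x \<in> rad \<Longrightarrow> revp x \<in> rad"
  using frm_revp[of "rev _" x] by (simp add: rad_def)

lemma rad_iff_lder: "x \<in> rad \<longleftrightarrow> Poly_Mapping.lookup x 0 = 0 \<and> (\<forall>a. lder a x \<in> rad)"
proof
  assume *: "Poly_Mapping.lookup x 0 = 0 \<and> (\<forall>a. lder a x \<in> rad)"
  have "frm u x = 0" for u
    using * by (cases u) (auto simp: frm_Nil frm_Cons rad_def)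
  then show "x \<in> rad" by (simp add: rad_def)
next
  assume "x \<in> rad"
  then show "Poly_Mapping.lookup x 0 = 0 \<and> (\<forall>a. lder a x \<in> rad)"
    using rad_lder[of x] frm_Nil[of x] by (simp add: rad_def)
qed

text \<open>Induction on the test word: a derivation of b x produces x itself and b times a
  derivative of x, and the radical is stable under derivations.\<close>

lemma rad_gen_mult: assumes "x \<in> rad" shows "free_gen b * x \<in> rad"
proof -
  have "frm u (free_gen b * x) = 0" if "x \<in> rad" for u x
    using that
  proof (induction u arbitrary: x)
    case (Cons a u)
    then show ?case
      using rad_lder[OF Cons.prems] by (auto simp: frm_Cons ldr_gen_mult frm_add frm_scl) (simp_all add: rad_def)
  qed (simp add: frm_Nil_gen_mult)
  then show ?thesis using assms by (simp add: rad_def)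
qed

lemma rad_mult_left: assumes "x \<in> rad" shows "y * x \<in> rad"
proof (rule flin_in_subspace[where f="\<lambda>y. y * x" and B="range word"])
  show "y * x \<in> rad" if "y \<in> range word" for y
  proof -
    have "word w * x \<in> rad" for w
      by (induction w) (auto simp: word_Nil word_Cons mult.assoc assms rad_gen_mult)
    then show ?thesis using that by auto
  qed
qed (auto simp: flin_intros subspace_rad span_words)

lemma rad_mult_right: assumes "x \<in> rad" shows "x * y \<in> rad"
  using rad_revp[OF rad_mult_left[OF rad_revp[OF assms], of "revp y"]] by (simp add: revp_mult)

lemma frm_Nil_outside:
  assumes "\<beta> \<noteq> {#}" "x \<in> hom_part \<beta>"
  shows "frm [] x = 0"
proof -
  have "frm [] x = (\<lambda>x. 0) x"
    by (rule functional_ext[where W="{w. mset w = \<beta>}"])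
      (use assms in \<open>auto simp: hom_part_def frm_add frm_scl frm_Nil_word\<close>)
  then show ?thesis by simp
qed

lemma frm_outside: "\<lbrakk>mset u \<noteq> \<beta>; x \<in> hom_part \<beta>\<rbrakk> \<Longrightarrow> frm u x = 0"
proof (induction u arbitrary: x \<beta>)
  case Nil
  then show ?case by (intro frm_Nil_outside) auto
next
  case (Cons a u)
  show ?case
  proof (cases "a \<in># \<beta>")
    case True
    then have "mset u \<noteq> \<beta> - {#a#}" using Cons.prems(1) by auto
    from Cons.IH[OF this lder_hom_part[OF Cons.prems(2)]] show ?thesis by (simp add: frm_Cons)
  next
    case False
    from lder_hom_part_notin[OF this Cons.prems(2)] show ?thesis by (simp add: frm_Cons)
  qed
qed

definition bform :: "('g free_mon \<Rightarrow>\<^sub>0 'k) \<Rightarrow> ('g free_mon \<Rightarrow>\<^sub>0 'k) \<Rightarrow> 'k" where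
  "bform y x = (\<Sum>m\<in>Poly_Mapping.keys y. Poly_Mapping.lookup y m * frm (letters m) x)"

lemma bform_superset:
  assumes "finite A" "Poly_Mapping.keys y \<subseteq> A"
  shows "bform y x = (\<Sum>m\<in>A. Poly_Mapping.lookup y m * frm (letters m) x)"
  unfolding bform_def
  by (rule sum.mono_neutral_left) (use assms in \<open>auto simp: in_keys_iff\<close>)

lemma bform_add1: "bform (y + z) x = bform y x + bform z x"
proof -
  let ?A = "Poly_Mapping.keys y \<union> Poly_Mapping.keys z"
  have "Poly_Mapping.keys (y + z) \<subseteq> ?A" by (rule Poly_Mapping.keys_add)
  then show ?thesis
    by (simp add: bform_superset[of ?A] lookup_add algebra_simps sum.distrib)
qed

lemma bform_scl1: "bform (scl d y) x = d * bform y x"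
proof -
  have "Poly_Mapping.keys (scl d y) \<subseteq> Poly_Mapping.keys y" by (auto simp: in_keys_iff)
  then show ?thesis
    by (simp add: bform_superset[of "Poly_Mapping.keys y"] sum_distrib_left mult.assoc)
qed

lemma bform_0 [simp]: "bform 0 x = 0"
  by (simp add: bform_def)

lemma bform_word [simp]: "bform (word u) x = frm u x"
proof -
  have "Poly_Mapping.keys (word u :: 'g free_mon \<Rightarrow>\<^sub>0 'k) \<subseteq> {Mon u}"
    by (auto simp: in_keys_iff lookup_word split: if_splits)
  then show ?thesis by (simp add: bform_superset[of "{Mon u}"] lookup_word)
qed

lemma bform_gen_mult: "bform (free_gen a * y) x = bform y (lder a x)"
  by (rule functional_ext[where f="\<lambda>y. bform (free_gen a * y) x" and W=UNIV])
    (auto simp: bform_add1 bform_scl1 distrib_left span_words frm_Cons simp flip: word_Cons)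

text \<open>Multiplication by a letter in one slot is adjoint to its left derivation in the other.
  This is what makes the form symmetric.\<close>

lemma frm_gen_mult: "frm u (free_gen b * x) = bform (lder b (word u)) x"
  by (induction u arbitrary: x)
    (auto simp: word_Nil frm_Nil_gen_mult frm_Cons ldr_gen_mult frm_add frm_scl word_Cons
      bform_add1 bform_scl1 bform_gen_mult c_sym)

lemma frm_word_sym: "frm u (word v) = frm v (word u)"
proof (induction u arbitrary: v)
  case Nil
  show ?case by (cases v) (simp_all add: frm_Nil_word frm_Cons word_Nil)
next
  case (Cons a u)
  have "frm u x = bform x (word u)" for x
    by (rule functional_ext[where W=UNIV])
      (auto simp: bform_add1 bform_scl1 frm_add frm_scl Cons.IH span_words)
  then show ?case by (simp add: frm_Cons word_Cons frm_gen_mult)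
qed

end

section \<open>Polynomials in derivations, and the Verma module of highest weight zero\<close>

context qwords
begin

text \<open>Substitution of the operators \<open>D a\<close> for the letters of \<open>y\<close>.
  With \<open>foldr\<close> a product of words becomes the composite in the same order, so this is a
  representation of the free algebra.\<close>

definition opx :: "('g \<Rightarrow> ('g free_mon \<Rightarrow>\<^sub>0 'k) \<Rightarrow> ('g free_mon \<Rightarrow>\<^sub>0 'k))
    \<Rightarrow> ('g free_mon \<Rightarrow>\<^sub>0 'k) \<Rightarrow> ('g free_mon \<Rightarrow>\<^sub>0 'k) \<Rightarrow> ('g free_mon \<Rightarrow>\<^sub>0 'k)" where
  "opx D y x = linext (\<lambda>v. foldr D v x) y"

lemma flin_opx1: "flin (\<lambda>y. opx D y x)"
  by (simp add: opx_def flin_intros)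

lemma opx_add1: "opx D (y + z) x = opx D y x + opx D z x"
  and opx_scl1: "opx D (scl d y) x = scl d (opx D y x)"
  and opx_0 [simp]: "opx D 0 x = 0"
  by (simp_all add: flin_add[OF flin_opx1] flin_diff[OF flin_opx1] flin_scl[OF flin_opx1] flin_0[OF flin_opx1])

lemma opx_word [simp]: "opx D (word v) x = foldr D v x"
  by (simp add: opx_def)

lemma opx_1 [simp]: "opx D 1 x = x"
  by (simp add: opx_def)

lemma flin_foldr: "(\<And>a. flin (D a)) \<Longrightarrow> flin (foldr D v)"
  by (induction v) (auto simp: flin_id id_def comp_def intro: flin_compose)

lemma opx_gen_mult: "flin (D a) \<Longrightarrow> opx D (free_gen a * y) x = D a (opx D y x)"
  by (rule flin_ext[where f="\<lambda>y. opx D (free_gen a * y) x"])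
    (auto simp: flin_intros flin_opx1 flin_compose[OF flin_opx1] intro: flin_compose[of "D a"] simp flip: word_Cons)

lemma flin_opx2: "(\<And>a. flin (D a)) \<Longrightarrow> flin (opx D y)"
  by (rule flinI) (simp_all add: opx_def linext_def flin_add[OF flin_foldr] flin_scl[OF flin_foldr]
      FA.scale_right_distrib sum.distrib FA.scale_sum_right mult.commute)

text \<open>\<open>E\<^sub>a\<close> is the action of \<open>e\<^sub>a\<close> on the Verma module of highest weight \<open>0\<close> over the quantized
  enveloping algebra, identified with the free algebra.\<close>

definition Eop :: "'g \<Rightarrow> ('g free_mon \<Rightarrow>\<^sub>0 'k) \<Rightarrow> ('g free_mon \<Rightarrow>\<^sub>0 'k)" where
  "Eop a x = rder a x - rbar a x"

lemma flin_Eop [simp]: "flin (Eop a)"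
  unfolding Eop_def[abs_def] by (simp add: flin_minus)

lemma Eop_1 [simp]: "Eop a 1 = 0"
  by (simp add: Eop_def)

lemma Eop_gen_mult: "Eop a (free_gen b * x) =
    free_gen b * Eop a x + (if a = b then tw a x - twb a x else 0)"
  by (auto simp: Eop_def rdr_gen_mult algebra_simps)

lemma tws_comm: "tws q d a (tws q d' b x) = tws q d' b (tws q d a x)"
  by (rule flin_ext[where f="\<lambda>x. tws q d a (tws q d' b x)"])
    (simp_all add: flin_intros tws_word mult.commute)

lemma rder_tw: "rder a (tw b x) = scl (q powi (- c b a)) (tw b (rder a x))"
  by (metis lder_tw op_linear(8) revp_lder revp_revp revp_tw)

lemma rbar_tw: "rbar a (tw b x) = scl (q powi (- c b a)) (tw b (rbar a x))"
  by (simp add: rbar_lder lder_tw tws_comm)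

lemma Eop_tw: "Eop a (tw b x) = scl (q powi (- c b a)) (tw b (Eop a x))"
  by (simp add: Eop_def rder_tw rbar_tw FA.scale_right_diff_distrib)

lemma tw_foldr_Eop: "tw j (foldr Eop v x) = scl (q powi cw c j (mset v)) (foldr Eop v (tw j x))"
proof (induction v)
  case (Cons a v)
  have "tw j (Eop a y) = scl (q powi c j a) (Eop a (tw j y))" for y
    by (simp add: Eop_tw)
  then show ?case
    by (simp add: Cons.IH flin_scl q_add mult.commute)
qed simp

lemma twb_foldr_Eop: "twb j (foldr Eop v x) = scl (q powi (- cw c j (mset v))) (foldr Eop v (twb j x))"
proof -
  have "foldr Eop v x = foldr Eop v (tw j (twb j x))" by simp
  also have "\<dots> = scl (q powi (- cw c j (mset v))) (tw j (foldr Eop v (twb j x)))"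
    by (simp add: tw_foldr_Eop)
  finally have *: "foldr Eop v x = scl (q powi (- cw c j (mset v))) (tw j (foldr Eop v (twb j x)))" .
  show ?thesis by (subst *) simp
qed

lemma opx_lder_gen_mult:
  "opx lder y (free_gen j * x) = free_gen j * opx lder (tw j y) x + opx lder (rder j y) x"
proof (rule flin_ext[where f="\<lambda>y. opx lder y (free_gen j * x)"])
  show "opx lder (word v) (free_gen j * x) =
      free_gen j * opx lder (tw j (word v)) x + opx lder (rder j (word v)) x" for v
  proof (induction v)
    case (Cons a v)
    have "opx lder (word (a # v)) (free_gen j * x) = lder a (opx lder (word v) (free_gen j * x))"
      by simp
    also have "\<dots> = lder a (free_gen j * opx lder (tw j (word v)) x) + lder a (opx lder (rder j (word v)) x)"
      by (simp only: Cons.IH op_linear)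
    also have "\<dots> = free_gen j * opx lder (tw j (word (a # v))) x + opx lder (rder j (word (a # v))) x"
      by (auto simp: word_Cons ldr_gen_mult rdr_gen_mult tw_mult opx_scl1 opx_add1 opx_gen_mult c_sym)
    finally show ?case .
  qed (simp add: word_Nil)
qed (simp_all add: flin_intros flin_opx1 flin_compose[OF flin_opx1])

text \<open>Commuting the operator past a letter replaces \<open>y\<close> by \<open>tw j y\<close> and \<open>rder j y\<close>, which stay in the
  radical, so everything reduces to the action on \<open>1\<close>.\<close>

lemma rad_opx_lder: assumes "y \<in> rad" shows "opx lder y x = 0"
proof (rule flin_ext[where f="\<lambda>x. opx lder y x" and g="\<lambda>x. 0"])
  show "opx lder y (word w) = 0" for w
    using assms
  proof (induction w arbitrary: y)
    case Nil
    have "opx lder y 1 = scl (frm [] y) 1"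
    proof (rule flin_ext[where f="\<lambda>y. opx lder y 1"])
      show "opx lder (word v) 1 = scl (frm [] (word v)) 1" for v
        by (induction v) (auto simp: frm_Nil_word)
    qed (auto simp: flin_opx1 flin_iff frm_add frm_scl FA.scale_left_distrib)
    then show ?case using Nil by (simp add: rad_def word_Nil)
  next
    case (Cons b w)
    then show ?case by (simp add: word_Cons opx_lder_gen_mult rad_rder rad_tw)
  qed
qed (auto simp: flin_zero flin_opx2)

text \<open>The commutator of an element y of the positive half with f_j in the quantized enveloping
  algebra: each of the two skew derivatives of y occurs with one of the two torus elements of
  j.\<close>

lemma opx_Eop_gen_mult:
  "opx Eop y (free_gen j * x) =
     free_gen j * opx Eop y x + opx Eop (rbar j y) (tw j x) - opx Eop (rder j y) (twb j x)"
proof (rule flin_ext[where f="\<lambda>y. opx Eop y (free_gen j * x)"])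
  show "opx Eop (word v) (free_gen j * x) = free_gen j * opx Eop (word v) x
      + opx Eop (rbar j (word v)) (tw j x) - opx Eop (rder j (word v)) (twb j x)" for v
  proof (induction v)
    case (Cons a v)
    have "opx Eop (word (a # v)) (free_gen j * x) = Eop a (opx Eop (word v) (free_gen j * x))"
      by simp
    also have "\<dots> = Eop a (free_gen j * opx Eop (word v) x)
        + Eop a (opx Eop (rbar j (word v)) (tw j x)) - Eop a (opx Eop (rder j (word v)) (twb j x))"
      by (simp only: Cons.IH flin_add flin_diff flin_Eop)
    also have "\<dots> = free_gen j * opx Eop (word (a # v)) x
      + opx Eop (rbar j (word (a # v))) (tw j x) - opx Eop (rder j (word (a # v))) (twb j x)"
      by (auto simp: word_Cons Eop_gen_mult rdr_gen_mult opx_add1 opx_gen_mult tws_word opx_scl1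
          tw_foldr_Eop twb_foldr_Eop algebra_simps)
    finally show ?case .
  qed (simp add: word_Nil)
qed (simp_all add: flin_intros flin_opx1 flin_compose[OF flin_opx1])

lemma rad_rbar: "x \<in> rad \<Longrightarrow> rbar a x \<in> rad"
proof -
  assume "x \<in> rad"
  then have "tw a (rbar a x) \<in> rad" by (metis lder_rbar rad_lder)
  then show ?thesis by (auto simp: rad_def frm_tw q0)
qed

lemma rad_Eop: "x \<in> rad \<Longrightarrow> Eop a x \<in> rad"
  unfolding Eop_def by (intro FA.subspace_diff subspace_rad rad_rder rad_rbar)

text \<open>By \<open>opx_Eop_gen_mult\<close> the value on j w is expressed through radical
  elements acting on multiples of w, so everything reduces to the vector 1, where only the constant
  term of y survives.\<close>

lemma rad_opx_Eop: assumes "y \<in> rad" shows "opx Eop y x = 0"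
proof (rule flin_ext[where f="\<lambda>x. opx Eop y x" and g="\<lambda>x. 0"])
  have "opx Eop y (word w) = 0" if "y \<in> rad" for w y
    using that
  proof (induction "length w" arbitrary: w y)
    case 0
    have "opx Eop y 1 = scl (frm [] y) 1"
    proof (rule flin_ext[where f="\<lambda>y. opx Eop y 1"])
      show "opx Eop (word v) 1 = scl (frm [] (word v)) 1" for v
        by (induction v) (auto simp: frm_Nil_word flin_0)
    qed (auto simp: flin_opx1 flin_iff frm_add frm_scl FA.scale_left_distrib)
    then show ?case using 0 by (simp add: rad_def word_Nil)
  next
    case (Suc n)
    then obtain b w' where "w = b # w'" "n = length w'" by (metis Suc_length_conv)
    then show ?case
      using Suc.hyps(1)[of w'] Suc.prems
      by (simp add: word_Cons opx_Eop_gen_mult rad_rder rad_rbar tws_word flin_scl flin_opx2)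
  qed
  then show "opx Eop y (word w) = 0" for w using assms by blast
qed (auto simp: flin_zero flin_opx2)

lemma Eop_hom_part: "x \<in> hom_part \<beta> \<Longrightarrow> Eop a x \<in> hom_part (\<beta> - {#a#})"
  using rder_hom_part[of x \<beta> a] lder_hom_part[of x \<beta> a]
    tws_hom_part[of "lder a x" "\<beta> - {#a#}" q "\<lambda>a b. - c a b" a]
  by (simp add: Eop_def rbar_lder FA.subspace_diff FA.subspace_scale subspace_hom_part)

lemma Eop_hom_part_notin: "a \<notin># \<beta> \<Longrightarrow> x \<in> hom_part \<beta> \<Longrightarrow> Eop a x = 0"
  by (simp add: Eop_def rbar_lder lder_hom_part_notin rder_hom_part_notin)

lemma foldr_Eop_hom_part: "x \<in> hom_part \<mu> \<Longrightarrow> foldr Eop v x \<in> hom_part (\<mu> - mset v)"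
proof (induction v)
  case (Cons a v)
  from Eop_hom_part[OF Cons.IH[OF Cons.prems], of a] show ?case by simp
qed simp

lemma foldr_Eop_notin: "x \<in> hom_part \<mu> \<Longrightarrow> \<not> mset v \<subseteq># \<mu> \<Longrightarrow> foldr Eop v x = 0"
proof (induction v)
  case (Cons a v)
  show ?case
  proof (cases "mset v \<subseteq># \<mu>")
    case True
    then have "a \<notin># \<mu> - mset v"
      using Cons.prems(2) subset_mset.le_diff_conv2[of "mset v" \<mu> "{#a#}"] by auto
    then show ?thesis
      using Eop_hom_part_notin foldr_Eop_hom_part[OF Cons.prems(1), of v] by simp
  qed (use Cons in \<open>simp add: flin_0\<close>)
qed simp

text \<open>The operator applied last meets a multiple of a single letter, on which
  \<open>rder\<close> and \<open>rbar\<close> agree. This is where highest weight 0 is used.\<close>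

lemma foldr_Eop_full:
  assumes "x \<in> hom_part (mset v)" "v \<noteq> []"
  shows "foldr Eop v x = 0"
proof (cases v)
  case (Cons a v')
  have "foldr Eop v' x \<in> hom_part {#a#}"
    using foldr_Eop_hom_part[OF assms(1), of v'] Cons by simp
  then have "Eop a (foldr Eop v' x) = (\<lambda>x. 0) (foldr Eop v' x)"
    unfolding hom_part_def
    by (rule flin_eq_on_span[where W="{w. mset w = {#a#}}", rotated 3])
      (auto simp: flin_zero flin_minus Eop_def simp flip: free_gen_word)
  then show ?thesis using Cons by simp
qed (use assms in auto)

end

lemma finite_words: "finite {w. mset w = \<nu>}"
  by (rule finite_subset[OF _ finite_lists_length_eq[of "set_mset \<nu>" "size \<nu>"]]) auto

lemma finite_subsets_mset: "finite {\<nu>. \<nu> \<subset># \<beta>}"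
proof (rule finite_subset)
  show "{\<nu>. \<nu> \<subset># \<beta>} \<subseteq> mset ` {xs. set xs \<subseteq> set_mset \<beta> \<and> length xs \<le> size \<beta>}"
  proof
    fix \<nu> assume *: "\<nu> \<in> {\<nu>. \<nu> \<subset># \<beta>}"
    obtain w where w: "mset w = \<nu>" using ex_mset by blast
    have "set w \<subseteq> set_mset \<beta>" "length w \<le> size \<beta>"
      using * w by (metis mem_Collect_eq set_mset_mono set_mset_mset subset_mset.less_imp_le)
        (metis * w mem_Collect_eq size_mset size_mset_mono subset_mset.less_imp_le)
    then show "\<nu> \<in> mset ` {xs. set xs \<subseteq> set_mset \<beta> \<and> length xs \<le> size \<beta>}" using w by auto
  qed
  show "finite (mset ` {xs. set xs \<subseteq> set_mset \<beta> \<and> length xs \<le> size \<beta>})"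
    by (intro finite_imageI finite_lists_length_le) simp
qed

section \<open>Gram matrices and their generalized inverses\<close>

context qwords
begin

lemma rad_homI:
  assumes "x \<in> hom_part \<nu>" "\<And>w. mset w = \<nu> \<Longrightarrow> frm w x = 0"
  shows "x \<in> rad"
  using frm_outside[OF _ assms(1)] assms(2) unfolding rad_def by blast

abbreviation W :: "'g multiset \<Rightarrow> 'g list set" where
  "W \<nu> \<equiv> {w. mset w = \<nu>}"

text \<open>\<open>G\<close> and its transpose both reproduce elements of weight \<nu> from their
  values against words, up to the radical; it is the coefficient matrix of a canonical
  element.\<close>

definition is_ginv :: "'g multiset \<Rightarrow> ('g list \<Rightarrow> 'g list \<Rightarrow> 'k) \<Rightarrow> bool" where
  "is_ginv \<nu> G \<longleftrightarrow>
    (\<forall>z\<in>hom_part \<nu>. (\<Sum>u\<in>W \<nu>. \<Sum>v\<in>W \<nu>. scl (G u v * frm v z) (word u)) - z \<in> rad \<and>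
      (\<Sum>u\<in>W \<nu>. \<Sum>v\<in>W \<nu>. scl (G u v * frm u z) (word v)) - z \<in> rad)"

text \<open>The Gram matrix S may be singular on words, so only SGS = S can be asked for.
  \<open>G\<close> is the coefficient matrix of a linear right inverse, on the image, of the map
  sending z to its values against the words. Agreement against all words of weight \<nu> is
  congruence modulo the radical.\<close>

lemma gram_inverse: "\<exists>G. is_ginv \<nu> G"
proof -
  let ?W = "{w. mset w = \<nu>}"
  define f where "f x = (\<Sum>v\<in>?W. scl (frm v x) (word v))" for x
  have f: "flin f"
    unfolding f_def
    by (rule flinI) (simp_all add: frm_add frm_scl FA.scale_left_distrib sum.distrib FA.scale_sum_right)
  obtain g where g: "range g \<subseteq> hom_part \<nu>" "flin g" "\<forall>v\<in>f ` hom_part \<nu>. f (g v) = v"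
    using FP.linear_exists_right_inverse_on[OF f subspace_hom_part] by blast
  define G where "G u v = Poly_Mapping.lookup (g (word v)) (Mon u)" for u v
  have lookup_f: "Poly_Mapping.lookup (f x) (Mon w) = frm w x" if "mset w = \<nu>" for w x
    using that finite_words[of \<nu>]
    by (simp add: f_def lookup_sum lookup_word if_distrib sum.delta cong: if_cong)
  have hom_exp: "x = (\<Sum>u\<in>?W. scl (Poly_Mapping.lookup x (Mon u)) (word u))" if "x \<in> hom_part \<nu>" for x
  proof (rule flin_eq_on_span[where W="?W" and f="\<lambda>x. x"])
    show "flin (\<lambda>x. \<Sum>u\<in>?W. scl (Poly_Mapping.lookup x (Mon u)) (word u))"
      by (rule flinI) (simp_all add: lookup_add FA.scale_left_distrib sum.distrib FA.scale_sum_right)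
    show "word w = (\<Sum>u\<in>?W. scl (Poly_Mapping.lookup (word w) (Mon u)) (word u))" if "w \<in> ?W" for w
      using that finite_words[of \<nu>]
      by (simp add: lookup_word if_distrib[of "\<lambda>t. scl t _"] sum.delta cong: if_cong)
  qed (use that in \<open>auto simp: flin_id hom_part_def\<close>)
  have gf: "g (f z) = (\<Sum>u\<in>?W. \<Sum>v\<in>?W. scl (G u v * frm v z) (word u))" for z
  proof -
    have "g (word v) = (\<Sum>u\<in>?W. scl (G u v) (word u))" for v
      unfolding G_def by (rule hom_exp) (use g(1) in auto)
    then have "g (f z) = (\<Sum>v\<in>?W. \<Sum>u\<in>?W. scl (G u v * frm v z) (word u))"
      by (simp add: f_def flin_sum[OF g(2)] flin_scl[OF g(2)] FA.scale_sum_right mult.commute)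
    then show ?thesis by (subst sum.swap)
  qed
  have gf_frm: "frm w (g (f z)) = frm w z" if "mset w = \<nu>" "z \<in> hom_part \<nu>" for w z
    using g(3) that lookup_f[of w "g (f z)"] lookup_f[of w z] by auto
  have A: "(\<Sum>u\<in>?W. \<Sum>v\<in>?W. scl (G u v * frm v z) (word u)) - z \<in> rad"
    if z: "z \<in> hom_part \<nu>" for z
  proof (rule rad_homI)
    show "(\<Sum>u\<in>?W. \<Sum>v\<in>?W. scl (G u v * frm v z) (word u)) - z \<in> hom_part \<nu>"
      unfolding gf[symmetric] by (rule FA.subspace_diff[OF subspace_hom_part _ z]) (use g(1) in auto)
  qed (use gf_frm z in \<open>simp add: frm_diff flip: gf\<close>)
  \<comment> \<open>This is SGS = S in coordinates. Since S is symmetric, the transpose of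
    \<open>G\<close> satisfies it as well, which gives the second half of
    \<open>is_ginv\<close>.\<close>
  have SGS: "(\<Sum>u\<in>?W. \<Sum>v\<in>?W. G u v * frm v (word z) * frm w (word u)) = frm w (word z)"
    if "mset w = \<nu>" "mset z = \<nu>" for w z
    using gf_frm[OF that(1) word_in_hom_part[OF that(2)]] by (simp add: gf frm_sum frm_scl)
  have B: "(\<Sum>u\<in>?W. \<Sum>v\<in>?W. scl (G u v * frm u z) (word v)) - z \<in> rad"
    if z: "z \<in> hom_part \<nu>" for z
  proof (rule flin_span_word_ball[where f="\<lambda>z. (\<Sum>u\<in>?W. \<Sum>v\<in>?W. scl (G u v * frm u z) (word v)) - z",
        OF _ subspace_rad _ z])
    show "flin (\<lambda>z. (\<Sum>u\<in>?W. \<Sum>v\<in>?W. scl (G u v * frm u z) (word v)) - z)"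
      by (rule flinI) (simp_all add: frm_add frm_scl algebra_simps FA.scale_left_distrib sum.distrib
        FA.scale_sum_right FA.scale_right_diff_distrib)
    show "(\<Sum>u\<in>?W. \<Sum>v\<in>?W. scl (G u v * frm u (word z)) (word v)) - word z \<in> rad"
      if "mset z = \<nu>" for z
    proof (rule rad_homI)
      show "(\<Sum>u\<in>?W. \<Sum>v\<in>?W. scl (G u v * frm u (word z)) (word v)) - word z \<in> hom_part \<nu>"
        by (intro FA.subspace_diff FA.subspace_sum FA.subspace_scale subspace_hom_part word_in_hom_part)
          (use that in auto)
      show "frm w ((\<Sum>u\<in>?W. \<Sum>v\<in>?W. scl (G u v * frm u (word z)) (word v)) - word z) = 0"
        if "mset w = \<nu>" for w
        using SGS[OF \<open>mset z = \<nu>\<close> that]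
        by (simp add: frm_diff frm_sum frm_scl frm_word_sym[of z] frm_word_sym[of _ "w"] mult.assoc
            mult.commute mult.left_commute)
    qed
  qed
  from A B show ?thesis unfolding is_ginv_def by blast
qed

end

section \<open>The ideal generated by elements that all derivations kill\<close>

locale qgens = qwords q c for q :: "'k::field" and c :: "'g \<Rightarrow> 'g \<Rightarrow> int" +
  fixes gens :: "('g free_mon \<Rightarrow>\<^sub>0 'k) set"
  assumes gens_lder: "g \<in> gens \<Longrightarrow> lder a g = 0"
    and gens_rder: "g \<in> gens \<Longrightarrow> rder a g = 0"
    and gens_0: "g \<in> gens \<Longrightarrow> frm [] g = 0"
    and gens_tw: "g \<in> gens \<Longrightarrow> \<exists>t. tw a g = scl t g"
begin

interpretation neg: qwords q "\<lambda>a b. - c a b"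
  by unfold_locales (auto simp: q0 c_sym)

text \<open>Because the generators are killed by the derivations on both sides and are eigenvectors
  of the twists, the Leibniz rules make this two-sided ideal stable under \<open>lder\<close>,
  \<open>rder\<close>, \<open>twb\<close> and hence \<open>Eop\<close>.\<close>

definition SS :: "('g free_mon \<Rightarrow>\<^sub>0 'k) set" where
  "SS = FA.span {word u * g * word v | u g v. g \<in> gens}"

lemma subspace_SS: "FA.subspace SS"
  by (simp add: SS_def)

lemma SS_I: "g \<in> gens \<Longrightarrow> word u * g * word v \<in> SS"
  unfolding SS_def by (rule FA.span_base) auto

lemma gens_SS: "g \<in> gens \<Longrightarrow> g \<in> SS"
  using SS_I[of g "[]" "[]"] by (simp add: word_Nil)

lemma SS_flin:
  assumes "flin f" "\<And>u g v. g \<in> gens \<Longrightarrow> f (word u * g * word v) \<in> S" "FA.subspace S" "x \<in> SS"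
  shows "f x \<in> S"
  by (rule flin_in_subspace[OF assms(1,3) _ assms(4)[unfolded SS_def]]) (use assms(2) in blast)

lemma SS_word_mult_left: "x \<in> SS \<Longrightarrow> word w * x \<in> SS"
  by (rule SS_flin[where f="\<lambda>x. word w * x"])
    (auto simp: flin_intros subspace_SS SS_I simp flip: word_append mult.assoc)

lemma SS_word_mult_right: "x \<in> SS \<Longrightarrow> x * word w \<in> SS"
  by (rule SS_flin[where f="\<lambda>x. x * word w"])
    (use SS_I[of _ _ "_ @ w"] in \<open>auto simp: flin_intros subspace_SS word_append mult.assoc\<close>)

lemma SS_mult_left: assumes "x \<in> SS" shows "y * x \<in> SS"
  by (rule flin_in_subspace[where f="\<lambda>y. y * x" and B="range word"])
    (use assms in \<open>auto simp: flin_intros subspace_SS span_words SS_word_mult_left\<close>)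

lemma SS_mult_right: assumes "x \<in> SS" shows "x * y \<in> SS"
  by (rule flin_in_subspace[where f="\<lambda>y. x * y" and B="range word"])
    (use assms in \<open>auto simp: flin_intros subspace_SS span_words SS_word_mult_right\<close>)

lemmas SS_0 [simp] = FA.subspace_0[OF subspace_SS]
  and SS_add = FA.subspace_add[OF subspace_SS]
  and SS_diff = FA.subspace_diff[OF subspace_SS]
  and SS_scl = FA.subspace_scale[OF subspace_SS]
  and SS_sum = FA.subspace_sum[OF subspace_SS]

lemma SS_mult_both: "x \<in> SS \<Longrightarrow> y * x * z \<in> SS"
  by (intro SS_mult_right SS_mult_left)

lemma gens_tw_SS: "g \<in> gens \<Longrightarrow> tw a g \<in> SS"
  using gens_tw[of g a] gens_SS[of g] by (auto intro: SS_scl)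

lemma gens_twb_SS: assumes "g \<in> gens" shows "twb a g \<in> SS"
proof -
  obtain t where t: "tw a g = scl t g" using gens_tw assms by blast
  then have g: "g = scl t (twb a g)" by (metis op_linear(5) tw_twb(2))
  show ?thesis
  \<comment> \<open>Eigenvalue zero forces g = 0, because \<open>twb\<close> inverts the
    twist.\<close>
  proof (cases "t = 0")
    case True
    then have "g = 0" using g by (metis FA.scale_zero_left)
    then show ?thesis by simp
  next
    case False
    then have "twb a g = scl (1 / t) (scl t (twb a g))" by simp
    then have "twb a g = scl (1 / t) g" by (simp only: flip: g)
    then show ?thesis using gens_SS[OF assms] by (simp add: SS_scl)
  qed
qed

lemma SS_twb: "x \<in> SS \<Longrightarrow> twb a x \<in> SS"
  by (rule SS_flin[where f="twb a"])
    (simp_all add: subspace_SS neg.tw_mult SS_mult_both gens_twb_SS)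

lemma SS_lder: "x \<in> SS \<Longrightarrow> lder a x \<in> SS"
  by (rule SS_flin[where f="lder a"])
    (simp_all add: subspace_SS lder_mult tw_mult gens_lder distrib_right SS_add SS_mult_both gens_tw_SS gens_SS)

lemma SS_rder: "x \<in> SS \<Longrightarrow> rder a x \<in> SS"
  by (rule SS_flin[where f="rder a"])
    (simp_all add: subspace_SS rder_mult tw_mult gens_rder distrib_right SS_add SS_mult_both gens_tw_SS gens_SS)

lemma SS_rbar: "x \<in> SS \<Longrightarrow> rbar a x \<in> SS"
  by (simp add: rbar_lder SS_lder SS_twb)

lemma SS_Eop: "x \<in> SS \<Longrightarrow> Eop a x \<in> SS"
  by (simp add: Eop_def SS_diff SS_rder SS_rbar)

lemma gens_rad: "g \<in> gens \<Longrightarrow> g \<in> rad"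
  by (rule rad_iff_lder[THEN iffD2])
    (simp add: gens_lder FA.subspace_0[OF subspace_rad] gens_0 flip: frm_Nil)

lemma SS_rad: "x \<in> SS \<Longrightarrow> x \<in> rad"
  by (rule SS_flin[where f="\<lambda>x. x"])
    (auto simp: flin_id subspace_rad intro: rad_mult_right rad_mult_left gens_rad)

lemma SS_scl_iff: "t \<noteq> 0 \<Longrightarrow> scl t x \<in> SS \<longleftrightarrow> x \<in> SS"
  using SS_scl[of "scl t x" "1 / t"] SS_scl[of x t] by auto

end

section \<open>A Casimir operator\<close>

definition ccw :: "('g \<Rightarrow> 'g \<Rightarrow> int) \<Rightarrow> 'g multiset \<Rightarrow> 'g multiset \<Rightarrow> int" where
  "ccw c \<mu> \<nu> = (\<Sum>a\<in>#\<mu>. cw c a \<nu>)"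

lemma ccw_simps [simp]:
  "ccw c {#} \<nu> = 0" "ccw c (add_mset a \<mu>) \<nu> = cw c a \<nu> + ccw c \<mu> \<nu>" "ccw c \<mu> {#} = 0"
  by (auto simp: ccw_def)

lemma ccw_add_right: "(\<And>a b. c a b = c b a) \<Longrightarrow> ccw c \<mu> (add_mset a \<nu>) = cw c a \<mu> + ccw c \<mu> \<nu>"
  by (induction \<mu>) auto

text \<open>This is 2(\<rho>, \<mu>), with \<rho> normalized by 2(\<rho>, \<alpha>_a) = (\<alpha>_a,
  \<alpha>_a).\<close>

definition diag :: "('g \<Rightarrow> 'g \<Rightarrow> int) \<Rightarrow> 'g multiset \<Rightarrow> int" where
  "diag c \<mu> = (\<Sum>a\<in>#\<mu>. c a a)"

lemma diag_simps [simp]: "diag c {#} = 0" "diag c (add_mset a \<mu>) = c a a + diag c \<mu>"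
  by (auto simp: diag_def)

text \<open>The exponent of \<open>q\<close> weighting the summand of weight \<open>\<nu>\<close> of the Casimir operator on vectors of
  weight \<open>\<mu>\<close>. It is forced by \<open>cas_exp_add\<close>, which makes the terms with \<open>f\<^sub>j\<close> in the middle cancel; the
  rounding in \<open>div 2\<close> is harmless because adding a letter changes the numerator by an even number.\<close>

definition cas_exp :: "('g \<Rightarrow> 'g \<Rightarrow> int) \<Rightarrow> 'g multiset \<Rightarrow> 'g multiset \<Rightarrow> int" where
  "cas_exp c \<nu> \<mu> = ccw c \<mu> \<nu> - (ccw c \<nu> \<nu> + diag c \<nu>) div 2"

lemma cas_exp_empty [simp]: "cas_exp c {#} \<mu> = 0"
  by (simp add: cas_exp_def)

lemma cas_exp_add:
  assumes "\<And>a b. c a b = c b a"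
  shows "cas_exp c \<nu> (add_mset j \<mu>) = cas_exp c \<nu> \<mu> + cw c j \<nu>"
    and "cas_exp c (add_mset j \<nu>) (add_mset j \<mu>) = cas_exp c \<nu> \<mu> + cw c j \<mu>"
proof -
  show "cas_exp c \<nu> (add_mset j \<mu>) = cas_exp c \<nu> \<mu> + cw c j \<nu>"
    by (simp add: cas_exp_def)
  have "ccw c (add_mset j \<nu>) (add_mset j \<nu>) + diag c (add_mset j \<nu>) =
      (ccw c \<nu> \<nu> + diag c \<nu>) + (cw c j \<nu> + c j j) * 2"
    by (simp add: ccw_add_right[OF assms])
  then have "(ccw c (add_mset j \<nu>) (add_mset j \<nu>) + diag c (add_mset j \<nu>)) div 2 =
      (ccw c \<nu> \<nu> + diag c \<nu>) div 2 + (cw c j \<nu> + c j j)"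
    by simp
  then show "cas_exp c (add_mset j \<nu>) (add_mset j \<mu>) = cas_exp c \<nu> \<mu> + cw c j \<mu>"
    by (simp only: cas_exp_def ccw_simps(2) ccw_add_right[OF assms] cw_simps)
qed

text \<open>\<open>below\<close> is the induction hypothesis of the minimal counterexample. Height
  at least two makes every single letter of \<beta> a proper part of \<beta>, so that the truncated
  sum contains the terms of degree one.\<close>

locale casimir = qgens q c gens
  for q :: "'k::field" and c :: "'g \<Rightarrow> 'g \<Rightarrow> int" and gens +
  fixes \<beta> :: "'g multiset"
  assumes below: "\<And>\<nu> x. \<lbrakk>size \<nu> < size \<beta>; x \<in> hom_part \<nu>; x \<in> rad\<rbrakk> \<Longrightarrow> x \<in> SS"
    and size_ge_2: "2 \<le> size \<beta>"
begin

definition G where "G \<nu> = (SOME G. is_ginv \<nu> G)"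

lemma ginv: "is_ginv \<nu> (G \<nu>)"
  unfolding G_def by (rule someI_ex[OF gram_inverse])

lemma sum_swap4:
  "(\<Sum>a\<in>A. \<Sum>b\<in>B. \<Sum>c\<in>C. \<Sum>d\<in>D. f a b c d :: 'z :: comm_monoid_add) =
    (\<Sum>c\<in>C. \<Sum>d\<in>D. \<Sum>a\<in>A. \<Sum>b\<in>B. f a b c d)"
proof -
  have "(\<Sum>a\<in>A. \<Sum>b\<in>B. \<Sum>c\<in>C. \<Sum>d\<in>D. f a b c d) = (\<Sum>a\<in>A. \<Sum>c\<in>C. \<Sum>b\<in>B. \<Sum>d\<in>D. f a b c d)"
    by (rule sum.cong[OF refl]) (rule sum.swap)
  also have "\<dots> = (\<Sum>c\<in>C. \<Sum>a\<in>A. \<Sum>b\<in>B. \<Sum>d\<in>D. f a b c d)"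
    by (rule sum.swap)
  also have "\<dots> = (\<Sum>c\<in>C. \<Sum>a\<in>A. \<Sum>d\<in>D. \<Sum>b\<in>B. f a b c d)"
    by (intro sum.cong[OF refl] sum.swap)
  also have "\<dots> = (\<Sum>c\<in>C. \<Sum>d\<in>D. \<Sum>a\<in>A. \<Sum>b\<in>B. f a b c d)"
    by (rule sum.cong[OF refl]) (rule sum.swap)
  finally show ?thesis .
qed

text \<open>\<open>G \<nu>\<close> plays the role of the canonical element \<open>\<Sum> b \<otimes> b\<^sup>*\<close> of the form on the weight space \<open>\<nu>\<close>;
  a derivation on its right factor moves to a multiplication on its left factor.\<close>

lemma transfer:
  assumes D: "\<And>v. v \<in> W (add_mset j \<nu>) \<Longrightarrow> D (word v) \<in> hom_part \<nu>"
    and M: "\<And>u. u \<in> W \<nu> \<Longrightarrow> M (word u) \<in> hom_part (add_mset j \<nu>)"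
    and adj: "\<And>u v. \<lbrakk>u \<in> W \<nu>; v \<in> W (add_mset j \<nu>)\<rbrakk> \<Longrightarrow> frm u (D (word v)) = frm v (M (word u))"
    and B1: "\<And>y. flin (\<lambda>x. B x y)" and B2: "\<And>x. flin (B x)"
    and R1: "\<And>x y. \<lbrakk>x \<in> hom_part (add_mset j \<nu>); x \<in> rad\<rbrakk> \<Longrightarrow> B x y \<in> SS"
    and R2: "\<And>x y. y \<in> rad \<Longrightarrow> B x y \<in> SS"
  shows "(\<Sum>u\<in>W (add_mset j \<nu>). \<Sum>v\<in>W (add_mset j \<nu>). scl (G (add_mset j \<nu>) u v) (B (word u) (D (word v))))
      - (\<Sum>u\<in>W \<nu>. \<Sum>v\<in>W \<nu>. scl (G \<nu> u v) (B (M (word u)) (word v))) \<in> SS"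
proof -
  let ?V = "W (add_mset j \<nu>)" and ?G = "G (add_mset j \<nu>)"
  \<comment> \<open>Both sums are compared with \<open>X\<close>, which contains the Gram inverses
    of both weights: \<open>1\<close> expands \<open>D (word v)\<close> in weight \<nu>, and
    \<open>2\<close> expands \<open>M (word u')\<close> in weight \<nu> plus j. Adjointness makes
    the two expansions meet.\<close>
  define X where "X = (\<Sum>u\<in>?V. \<Sum>v\<in>?V. \<Sum>u'\<in>W \<nu>. \<Sum>v'\<in>W \<nu>.
      scl (?G u v * (G \<nu> u' v' * frm u' (D (word v)))) (B (word u) (word v')))"
  have 1: "B (word u) (D (word v)) - (\<Sum>u'\<in>W \<nu>. \<Sum>v'\<in>W \<nu>.
      scl (G \<nu> u' v' * frm u' (D (word v))) (B (word u) (word v'))) \<in> SS" if "v \<in> ?V" for u v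
  proof -
    let ?s = "\<Sum>u'\<in>W \<nu>. \<Sum>v'\<in>W \<nu>. scl (G \<nu> u' v' * frm u' (D (word v))) (word v')"
    have "?s - D (word v) \<in> rad"
      using ginv[of \<nu>] D[OF that] by (simp add: is_ginv_def)
    from R2[OF this, of "word u"] have "B (word u) ?s - B (word u) (D (word v)) \<in> SS"
      by (simp add: flin_diff[OF B2])
    then have "- (B (word u) ?s - B (word u) (D (word v))) \<in> SS"
      using FA.subspace_neg[OF subspace_SS] by blast
    then show ?thesis by (simp add: flin_sum[OF B2] flin_scl[OF B2])
  qed
  have 2: "B (M (word u')) (word v') - (\<Sum>u\<in>?V. \<Sum>v\<in>?V.
      scl (?G u v * frm u' (D (word v))) (B (word u) (word v'))) \<in> SS" if "u' \<in> W \<nu>" for u' v'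
  proof -
    let ?s = "\<Sum>u\<in>?V. \<Sum>v\<in>?V. scl (?G u v * frm v (M (word u'))) (word u)"
    have "?s - M (word u') \<in> rad"
      using ginv[of "add_mset j \<nu>"] M[OF that] by (simp add: is_ginv_def)
    moreover have "?s - M (word u') \<in> hom_part (add_mset j \<nu>)"
      by (intro FA.subspace_diff FA.subspace_sum FA.subspace_scale subspace_hom_part
          word_in_hom_part M that) auto
    ultimately have "B (?s - M (word u')) (word v') \<in> SS" by (rule R1[rotated])
    then have "B ?s (word v') - B (M (word u')) (word v') \<in> SS"
      by (simp add: flin_diff[OF B1])
    then have "- (B ?s (word v') - B (M (word u')) (word v')) \<in> SS"
      using FA.subspace_neg[OF subspace_SS] by blast
    moreover have "B ?s (word v') =
       (\<Sum>u\<in>?V. \<Sum>v\<in>?V. scl (?G u v * frm u' (D (word v))) (B (word u) (word v')))"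
      using adj[OF that] by (simp add: flin_sum[OF B1] flin_scl[OF B1])
    ultimately show ?thesis by simp
  qed
  have "(\<Sum>u\<in>?V. \<Sum>v\<in>?V. scl (?G u v) (B (word u) (D (word v)))) - X =
    (\<Sum>u\<in>?V. \<Sum>v\<in>?V. scl (?G u v) (B (word u) (D (word v)) - (\<Sum>u'\<in>W \<nu>. \<Sum>v'\<in>W \<nu>.
      scl (G \<nu> u' v' * frm u' (D (word v))) (B (word u) (word v')))))"
    by (simp add: X_def FA.scale_right_diff_distrib sum_subtractf FA.scale_sum_right)
  also have "\<dots> \<in> SS" by (intro SS_sum SS_scl 1) auto
  finally have first: "(\<Sum>u\<in>?V. \<Sum>v\<in>?V. scl (?G u v) (B (word u) (D (word v)))) - X \<in> SS" .
  have X': "X = (\<Sum>u'\<in>W \<nu>. \<Sum>v'\<in>W \<nu>. \<Sum>u\<in>?V. \<Sum>v\<in>?V.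
      scl (?G u v * (G \<nu> u' v' * frm u' (D (word v)))) (B (word u) (word v')))"
    unfolding X_def by (rule sum_swap4)
  have "(\<Sum>u\<in>W \<nu>. \<Sum>v\<in>W \<nu>. scl (G \<nu> u v) (B (M (word u)) (word v))) - X =
    (\<Sum>u'\<in>W \<nu>. \<Sum>v'\<in>W \<nu>. scl (G \<nu> u' v') (B (M (word u')) (word v') - (\<Sum>u\<in>?V. \<Sum>v\<in>?V.
      scl (?G u v * frm u' (D (word v))) (B (word u) (word v')))))"
    by (simp add: X' FA.scale_right_diff_distrib sum_subtractf FA.scale_sum_right mult.left_commute)
  also have "\<dots> \<in> SS" by (intro SS_sum SS_scl 2) auto
  finally have "(\<Sum>u\<in>W \<nu>. \<Sum>v\<in>W \<nu>. scl (G \<nu> u v) (B (M (word u)) (word v))) - X \<in> SS" .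
  from SS_diff[OF first this] show ?thesis by simp
qed

end

section \<open>The truncated Casimir operator and its eigenvalue\<close>

context casimir
begin

text \<open>The summand of weight \<nu> of the Casimir operator, with a slot \<open>y\<close>
  between its lowering and raising factors. The slot holds 1 in the operator itself and f_j while a
  letter is moved through. The reversal decides where a letter multiplied onto \<open>u\<close> ends
  up: from the left it enters the slot, from the right it comes out in front.\<close>

definition T where
  "T \<nu> y x = (\<Sum>u\<in>W \<nu>. \<Sum>v\<in>W \<nu>. scl (G \<nu> u v) (revp (word u) * y * foldr Eop v x))"

lemma revp_hom_rad_SS: "\<lbrakk>x \<in> hom_part \<nu>; x \<in> rad; size \<nu> < size \<beta>\<rbrakk> \<Longrightarrow> revp x \<in> SS"
  by (rule below[OF _ revp_hom_part rad_revp])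

lemma foldr_Eop_gen_mult:
  assumes "mset v = add_mset j \<nu>" "x \<in> hom_part \<mu>"
  shows "foldr Eop v (free_gen j * x) = free_gen j * foldr Eop v x
    + scl (q powi (cw c j \<nu> - cw c j \<mu>)) (opx Eop (lder j (word v)) x)
    - scl (q powi cw c j \<mu>) (opx Eop (rder j (word v)) x)"
proof -
  have "lder j (word v) \<in> hom_part \<nu>"
    using lder_hom_part[OF word_in_hom_part[OF assms(1)], of j] by simp
  then have "rbar j (word v) = scl (q powi cw c j \<nu>) (lder j (word v))"
    by (simp add: rbar_lder tws_hom_part)
  then show ?thesis
    using opx_Eop_gen_mult[of "word v" j x]
    by (simp add: tws_hom_part[OF assms(2)] opx_scl1 flin_scl[OF flin_opx2] q_diff)
qed

text \<open>The adjoint pair is \<open>lder j\<close> and left multiplication by j; after reversal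
  the letter stands in the slot.\<close>

lemma T_transfer_l:
  assumes "size (add_mset j \<nu>) < size \<beta>"
  shows "(\<Sum>u\<in>W (add_mset j \<nu>). \<Sum>v\<in>W (add_mset j \<nu>).
      scl (G (add_mset j \<nu>) u v) (revp (word u) * opx Eop (lder j (word v)) x))
    - T \<nu> (free_gen j) x \<in> SS"
proof -
  have "(\<Sum>u\<in>W (add_mset j \<nu>). \<Sum>v\<in>W (add_mset j \<nu>).
      scl (G (add_mset j \<nu>) u v) (revp (word u) * opx Eop (lder j (word v)) x))
    - (\<Sum>u\<in>W \<nu>. \<Sum>v\<in>W \<nu>. scl (G \<nu> u v) (revp (free_gen j * word u) * opx Eop (word v) x)) \<in> SS"
  proof (rule transfer[where D="lder j" and M="\<lambda>u. free_gen j * u" and B="\<lambda>y z. revp y * opx Eop z x"])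
    fix v assume "v \<in> W (add_mset j \<nu>)"
    then show "lder j (word v) \<in> hom_part \<nu>"
      using lder_hom_part[OF word_in_hom_part[of v], of _ j] by simp
  next
    fix u v assume "u \<in> W \<nu>" "v \<in> W (add_mset j \<nu>)"
    show "frm u (lder j (word v)) = frm v (free_gen j * word u)"
      using frm_word_sym[of "j # u" v] by (simp add: frm_Cons word_Cons)
  next
    fix y z assume "y \<in> hom_part (add_mset j \<nu>)" "y \<in> rad"
    then show "revp y * opx Eop z x \<in> SS"
      using assms by (intro SS_mult_right revp_hom_rad_SS)
  qed (auto simp: gen_mult_hom_part word_in_hom_part rad_opx_Eop flin_mult1 flin_mult2 flin_opx1)
  then show ?thesis
    by (simp add: T_def revp_mult)
qed

text \<open>The adjoint pair is \<open>rder j\<close> and right multiplication by j; after reversal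
  the letter stands in front and factors out.\<close>

lemma T_transfer_r:
  assumes "size (add_mset j \<nu>) < size \<beta>"
  shows "(\<Sum>u\<in>W (add_mset j \<nu>). \<Sum>v\<in>W (add_mset j \<nu>).
      scl (G (add_mset j \<nu>) u v) (revp (word u) * opx Eop (rder j (word v)) x))
    - free_gen j * T \<nu> 1 x \<in> SS"
proof -
  have "(\<Sum>u\<in>W (add_mset j \<nu>). \<Sum>v\<in>W (add_mset j \<nu>).
      scl (G (add_mset j \<nu>) u v) (revp (word u) * opx Eop (rder j (word v)) x))
    - (\<Sum>u\<in>W \<nu>. \<Sum>v\<in>W \<nu>. scl (G \<nu> u v) (revp (word u * free_gen j) * opx Eop (word v) x)) \<in> SS"
  proof (rule transfer[where D="rder j" and M="\<lambda>u. u * free_gen j" and B="\<lambda>y z. revp y * opx Eop z x"])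
    fix v assume "v \<in> W (add_mset j \<nu>)"
    then show "rder j (word v) \<in> hom_part \<nu>"
      using rder_hom_part[OF word_in_hom_part[of v], of _ j] by simp
  next
    fix u v assume "u \<in> W \<nu>" "v \<in> W (add_mset j \<nu>)"
    show "frm u (rder j (word v)) = frm v (word u * free_gen j)"
      using frm_word_sym[of "u @ [j]" v] by (simp add: frm_snoc word_append free_gen_word)
  next
    fix u assume "u \<in> W \<nu>"
    then have "word (u @ [j]) \<in> hom_part (add_mset j \<nu>)"
      by (intro word_in_hom_part) auto
    then show "word u * free_gen j \<in> hom_part (add_mset j \<nu>)"
      by (simp add: word_append free_gen_word)
  next
    fix y z assume "y \<in> hom_part (add_mset j \<nu>)" "y \<in> rad"
    then show "revp y * opx Eop z x \<in> SS"
      using assms by (intro SS_mult_right revp_hom_rad_SS)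
  qed (auto simp: rad_opx_Eop flin_mult1 flin_mult2 flin_opx1)
  then show ?thesis
    by (simp add: T_def revp_mult sum_distrib_left mult.assoc)
qed

text \<open>Moving f_j to the left through the raising word leaves f_j in the slot and two
  correction terms with a derivative of the word. The two transfer lemmas turn these corrections
  into summands of weight \<nu>, one letter shorter.\<close>

lemma T_gen_mult:
  assumes "size (add_mset j \<nu>) < size \<beta>" "x \<in> hom_part \<mu>"
  shows "T (add_mset j \<nu>) 1 (free_gen j * x) - (T (add_mset j \<nu>) (free_gen j) x
    + scl (q powi (cw c j \<nu> - cw c j \<mu>)) (T \<nu> (free_gen j) x)
    - scl (q powi cw c j \<mu>) (free_gen j * T \<nu> 1 x)) \<in> SS"
proof -
  let ?V = "W (add_mset j \<nu>)" and ?G = "G (add_mset j \<nu>)"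
  let ?s = "q powi (cw c j \<nu> - cw c j \<mu>)" and ?t = "q powi cw c j \<mu>"
  define L where "L = (\<Sum>u\<in>?V. \<Sum>v\<in>?V. scl (?G u v) (revp (word u) * opx Eop (lder j (word v)) x))"
  define R where "R = (\<Sum>u\<in>?V. \<Sum>v\<in>?V. scl (?G u v) (revp (word u) * opx Eop (rder j (word v)) x))"
  have "T (add_mset j \<nu>) 1 (free_gen j * x) =
      (\<Sum>u\<in>?V. \<Sum>v\<in>?V. scl (?G u v) (revp (word u) * (free_gen j * foldr Eop v x
        + scl ?s (opx Eop (lder j (word v)) x) - scl ?t (opx Eop (rder j (word v)) x))))"
    unfolding T_def by (intro sum.cong refl) (simp add: foldr_Eop_gen_mult[OF _ assms(2)])
  also have "\<dots> = T (add_mset j \<nu>) (free_gen j) x + scl ?s L - scl ?t R"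
    by (simp add: T_def L_def R_def distrib_left right_diff_distrib FA.scale_right_distrib
        FA.scale_right_diff_distrib sum.distrib sum_subtractf FA.scale_sum_right mult.assoc
        FA.scale_left_commute mult.commute del: revp_word)
  finally have "T (add_mset j \<nu>) 1 (free_gen j * x) - (T (add_mset j \<nu>) (free_gen j) x
      + scl ?s (T \<nu> (free_gen j) x) - scl ?t (free_gen j * T \<nu> 1 x)) =
    scl ?s (L - T \<nu> (free_gen j) x) - scl ?t (R - free_gen j * T \<nu> 1 x)"
    by (simp add: FA.scale_right_diff_distrib algebra_simps)
  then show ?thesis
    using T_transfer_l[OF assms(1), of x] T_transfer_r[OF assms(1), of x]
    unfolding L_def R_def by (metis (no_types, lifting) SS_diff SS_scl)
qed

lemma T_gen_mult_notin:
  assumes "j \<notin># \<nu>"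
  shows "T \<nu> 1 (free_gen j * x) = T \<nu> (free_gen j) x"
proof -
  have "foldr Eop v (free_gen j * x) = free_gen j * foldr Eop v x" if "mset v = \<nu>" for v
    using opx_Eop_gen_mult[of "word v" j x] rder_hom_part_notin[OF assms word_in_hom_part[OF that]]
      lder_hom_part_notin[OF assms word_in_hom_part[OF that]]
    by (simp add: rbar_lder)
  then show ?thesis by (simp add: T_def mult.assoc)
qed

text \<open>The raising word would leave the root cone. The boundary case \<nu> = \<mu> also
  vanishes, by \<open>foldr_Eop_full\<close>.\<close>

lemma T_zero:
  assumes "x \<in> hom_part \<mu>" "\<nu> \<noteq> {#}" "\<not> \<nu> \<subset># \<mu>"
  shows "T \<nu> y x = 0"
proof -
  have "foldr Eop v x = 0" if "mset v = \<nu>" for v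
  proof (cases "\<nu> = \<mu>")
    case True
    then show ?thesis using foldr_Eop_full[of x v] assms that by auto
  next
    case False
    then show ?thesis using foldr_Eop_notin[OF assms(1), of v] assms that by (auto simp: subset_mset.less_le)
  qed
  then show ?thesis by (simp add: T_def)
qed

text \<open>The quantum Casimir operator restricted to proper parts of \<beta>, the only weights for
  which radical elements are known to lie in \<open>SS\<close>. The parameter \<open>\<mu>\<close>
  is the weight of \<open>x\<close>.\<close>

definition Om where
  "Om \<mu> x = (\<Sum>\<nu>\<in>{\<nu>. \<nu> \<subset># \<beta>}. scl ((-1) ^ size \<nu> * q powi cas_exp c \<nu> \<mu>) (T \<nu> 1 x))"

lemma add_mset_subset:
  assumes "add_mset j \<mu> \<subseteq># \<beta>" "\<nu> = {#} \<or> \<nu> \<subset># \<mu>"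
  shows "add_mset j \<nu> \<subset># \<beta>"
  using assms(2)
proof
  assume "\<nu> = {#}"
  then show ?thesis using assms(1) size_ge_2
    by (cases "{#j#} = \<beta>") (auto simp: subset_mset.less_le dest: mset_subset_eqD)
next
  assume "\<nu> \<subset># \<mu>"
  then have "add_mset j \<nu> \<subset># add_mset j \<mu>" by simp
  then show ?thesis using assms(1) by (rule subset_mset.less_le_trans)
qed

text \<open>The correction terms of weight \<nu> plus j are regrouped with the summand of weight
  \<nu>. One of them cancels the term with f_j in the slot, the other is f_j times the summand of
  the operator on x, and the exponent \<open>cas_exp\<close> is made for this.\<close>

lemma Om_gen_mult:
  assumes "x \<in> hom_part \<mu>" "add_mset j \<mu> \<subseteq># \<beta>"
  shows "Om (add_mset j \<mu>) (free_gen j * x) - scl (q powi (2 * cw c j \<mu>)) (free_gen j * Om \<mu> x) \<in> SS"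
proof -
  let ?N = "{\<nu>. \<nu> \<subset># \<beta>}" and ?N' = "{\<nu>. add_mset j \<nu> \<subset># \<beta>}"
  define k where "k \<nu> \<mu> = (-1) ^ size \<nu> * q powi cas_exp c \<nu> \<mu>" for \<nu> \<mu>
  define R where "R \<nu> = scl (k (add_mset j \<nu>) (add_mset j \<mu>)) (scl (q powi (cw c j \<nu> - cw c j \<mu>)) (T \<nu> (free_gen j) x)
    - scl (q powi cw c j \<mu>) (free_gen j * T \<nu> 1 x))" for \<nu>
  define D where "D \<nu> = scl (k \<nu> (add_mset j \<mu>)) (T \<nu> 1 (free_gen j * x)) - scl (k \<nu> (add_mset j \<mu>)) (T \<nu> (free_gen j) x)
    - (if j \<in># \<nu> then R (\<nu> - {#j#}) else 0)" for \<nu>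
  have N'N: "?N' \<subseteq> ?N"
    by (auto intro: subset_mset.le_less_trans[rotated])
  \<comment> \<open>Weights to which j cannot be added inside \<beta> would disturb the regrouping,
    but their summands vanish on weight \<mu>.\<close>
  have zero: "T \<nu> y x = 0" if "\<nu> \<in> ?N - ?N'" for \<nu> y
  proof (rule T_zero[OF assms(1)])
    show "\<nu> \<noteq> {#}" "\<not> \<nu> \<subset># \<mu>"
      using that add_mset_subset[OF assms(2), of \<nu>] by auto
  qed
  have D: "D \<nu> \<in> SS" if "\<nu> \<in> ?N" for \<nu>
  proof (cases "j \<in># \<nu>")
    case True
    then obtain \<nu>' where \<nu>': "\<nu> = add_mset j \<nu>'" by (metis insert_DiffM)
    have "size \<nu> < size \<beta>" using that by (simp add: mset_subset_size)
    from SS_scl[OF T_gen_mult[OF this[unfolded \<nu>'] assms(1)], of "k (add_mset j \<nu>') (add_mset j \<mu>)"]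
    show ?thesis
      unfolding D_def R_def \<nu>' by (simp add: FA.scale_right_diff_distrib FA.scale_right_distrib algebra_simps)
  next
    case False
    then show ?thesis by (simp add: D_def T_gen_mult_notin)
  qed
  have "(\<Sum>\<nu>\<in>?N. if j \<in># \<nu> then R (\<nu> - {#j#}) else 0) = (\<Sum>\<nu>\<in>?N'. R \<nu>)"
  proof -
    have "(\<Sum>\<nu>\<in>?N. if j \<in># \<nu> then R (\<nu> - {#j#}) else 0) = (\<Sum>\<nu>\<in>{\<nu>\<in>?N. j \<in># \<nu>}. R (\<nu> - {#j#}))"
      by (rule sum.inter_filter[symmetric]) (rule finite_subsets_mset)
    also have "\<dots> = (\<Sum>\<nu>\<in>?N'. R \<nu>)"
      by (rule sum.reindex_bij_witness[of _ "add_mset j" "\<lambda>\<nu>. \<nu> - {#j#}"]) auto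
    finally show ?thesis .
  qed
  then have "(\<Sum>\<nu>\<in>?N. D \<nu>) = Om (add_mset j \<mu>) (free_gen j * x)
      - (\<Sum>\<nu>\<in>?N. scl (k \<nu> (add_mset j \<mu>)) (T \<nu> (free_gen j) x)) - (\<Sum>\<nu>\<in>?N'. R \<nu>)"
    by (simp add: D_def Om_def sum_subtractf k_def)
  also have "(\<Sum>\<nu>\<in>?N. scl (k \<nu> (add_mset j \<mu>)) (T \<nu> (free_gen j) x)) =
      (\<Sum>\<nu>\<in>?N'. scl (k \<nu> (add_mset j \<mu>)) (T \<nu> (free_gen j) x))"
    by (rule sum.mono_neutral_right[OF finite_subsets_mset N'N]) (simp add: zero)
  also have "(\<Sum>\<nu>\<in>?N'. R \<nu>) = (\<Sum>\<nu>\<in>?N'. scl (q powi (2 * cw c j \<mu>)) (free_gen j * scl (k \<nu> \<mu>) (T \<nu> 1 x))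
      - scl (k \<nu> (add_mset j \<mu>)) (T \<nu> (free_gen j) x))"
  proof (rule sum.cong[OF refl])
    fix \<nu>
    \<comment> \<open>The extra letter changes the sign, so this is the coefficient that cancels the
      slot term of weight \<nu>.\<close>
    have "k (add_mset j \<nu>) (add_mset j \<mu>) * q powi (cw c j \<nu> - cw c j \<mu>) = - k \<nu> (add_mset j \<mu>)"
    proof -
      have "cas_exp c (add_mset j \<nu>) (add_mset j \<mu>) + (cw c j \<nu> - cw c j \<mu>) = cas_exp c \<nu> (add_mset j \<mu>)"
        unfolding cas_exp_add(2)[OF c_sym] unfolding cas_exp_add(1)[OF c_sym] by simp
      then show ?thesis by (simp add: k_def flip: q_add)
    qed
    moreover have "k (add_mset j \<nu>) (add_mset j \<mu>) * q powi cw c j \<mu> = - (q powi (2 * cw c j \<mu>) * k \<nu> \<mu>)"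
    proof -
      have "cas_exp c (add_mset j \<nu>) (add_mset j \<mu>) + cw c j \<mu> = 2 * cw c j \<mu> + cas_exp c \<nu> \<mu>"
        unfolding cas_exp_add(2)[OF c_sym] by simp
      then show ?thesis by (simp add: k_def mult.left_commute flip: q_add)
    qed
    ultimately show "R \<nu> = scl (q powi (2 * cw c j \<mu>)) (free_gen j * scl (k \<nu> \<mu>) (T \<nu> 1 x))
      - scl (k \<nu> (add_mset j \<mu>)) (T \<nu> (free_gen j) x)"
      by (simp add: R_def FA.scale_right_diff_distrib)
  qed
  also have "\<dots> = scl (q powi (2 * cw c j \<mu>)) (free_gen j * (\<Sum>\<nu>\<in>?N'. scl (k \<nu> \<mu>) (T \<nu> 1 x)))
      - (\<Sum>\<nu>\<in>?N'. scl (k \<nu> (add_mset j \<mu>)) (T \<nu> (free_gen j) x))"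
    by (simp add: sum_subtractf FA.scale_sum_right sum_distrib_left)
  also have "(\<Sum>\<nu>\<in>?N'. scl (k \<nu> \<mu>) (T \<nu> 1 x)) = Om \<mu> x"
    unfolding Om_def k_def
    by (rule sum.mono_neutral_left[OF finite_subsets_mset N'N]) (simp add: zero)
  finally have "(\<Sum>\<nu>\<in>?N. D \<nu>) =
      Om (add_mset j \<mu>) (free_gen j * x) - scl (q powi (2 * cw c j \<mu>)) (free_gen j * Om \<mu> x)"
    by simp
  moreover have "(\<Sum>\<nu>\<in>?N. D \<nu>) \<in> SS" by (intro SS_sum D)
  ultimately show ?thesis by simp
qed

lemma T_empty: "T {#} 1 x = x"
proof -
  have "(\<Sum>u\<in>W {#}. \<Sum>v\<in>W {#}. scl (G {#} u v * frm v 1) (word u)) - 1 \<in> rad"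
    using ginv[of "{#}"] word_in_hom_part[of "[]"] unfolding is_ginv_def by (auto simp: word_Nil)
  then have "frm [] ((\<Sum>u\<in>W {#}. \<Sum>v\<in>W {#}. scl (G {#} u v * frm v 1) (word u)) - 1) = 0"
    by (simp add: rad_def)
  then have "G {#} [] [] = 1"
    by (simp add: frm_diff frm_scl frm_Nil_word flip: word_Nil)
  then show ?thesis by (simp add: T_def word_Nil)
qed

lemma empty_subset: "{#} \<subset># \<beta>"
  using size_ge_2 by (auto simp: subset_mset.less_le)

text \<open>Passing from \<mu> to \<mu> + \<alpha>_j raises (\<mu>, \<mu>) - 2(\<rho>, \<mu>) by
  2(\<alpha>_j, \<mu>), which is exactly the exponent produced by
  \<open>Om_gen_mult\<close>.\<close>

lemma Om_word: "mset w \<subseteq># \<beta> \<Longrightarrow>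
    Om (mset w) (word w) - scl (q powi (ccw c (mset w) (mset w) - diag c (mset w))) (word w) \<in> SS"
proof (induction w)
  case Nil
  have "Om {#} (word []) = (\<Sum>\<nu>\<in>{{#}}. scl ((-1) ^ size \<nu> * q powi cas_exp c \<nu> {#}) (T \<nu> 1 (word [])))"
    unfolding Om_def
    by (rule sum.mono_neutral_right[OF finite_subsets_mset])
      (use empty_subset in \<open>auto intro!: T_zero[of _ "{#}"] word_in_hom_part\<close>)
  then show ?case by (simp add: T_empty)
next
  case (Cons j w)
  let ?\<mu> = "mset w"
  let ?z = "ccw c ?\<mu> ?\<mu> - diag c ?\<mu>"
  have "?\<mu> \<subseteq># \<beta>" using Cons.prems by (auto dest: mset_subset_eq_insertD)
  from SS_mult_left[OF Cons.IH[OF this], of "free_gen j"]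
  have "free_gen j * Om ?\<mu> (word w) - scl (q powi ?z) (word (j # w)) \<in> SS"
    by (simp add: right_diff_distrib word_Cons)
  from SS_scl[OF this, of "q powi (2 * cw c j ?\<mu>)"]
  have "scl (q powi (2 * cw c j ?\<mu>)) (free_gen j * Om ?\<mu> (word w))
      - scl (q powi (2 * cw c j ?\<mu> + ?z)) (word (j # w)) \<in> SS"
    by (simp add: FA.scale_right_diff_distrib q_add)
  from SS_add[OF Om_gen_mult[OF word_in_hom_part[OF refl], of j w] this] Cons.prems
  have "Om (mset (j # w)) (word (j # w)) - scl (q powi (2 * cw c j ?\<mu> + ?z)) (word (j # w)) \<in> SS"
    by (simp add: word_Cons)
  moreover have "2 * cw c j ?\<mu> + ?z = ccw c (mset (j # w)) (mset (j # w)) - diag c (mset (j # w))"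
    by (simp add: ccw_add_right[OF c_sym])
  ultimately show ?case by simp
qed

lemma flin_Om: "flin (Om \<mu>)"
proof -
  have "flin (foldr Eop v)" for v by (rule flin_foldr) simp
  then have "flin (T \<nu> 1)" for \<nu>
    unfolding T_def by (intro flinI) (simp_all add: flin_add flin_scl distrib_left FA.scale_right_distrib
      sum.distrib FA.scale_sum_right FA.scale_left_commute mult.commute)
  then show ?thesis
    unfolding Om_def by (intro flinI) (simp_all add: flin_add flin_scl FA.scale_right_distrib
      sum.distrib FA.scale_sum_right FA.scale_left_commute mult.commute)
qed

lemma Om_hom_part:
  assumes "x \<in> hom_part \<beta>"
  shows "Om \<beta> x - scl (q powi (ccw c \<beta> \<beta> - diag c \<beta>)) x \<in> SS"
  by (rule flin_span_word_ball[where f="\<lambda>x. Om \<beta> x - scl (q powi (ccw c \<beta> \<beta> - diag c \<beta>)) x", OF _ _ _ assms])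
    (use Om_word in \<open>auto simp: flin_minus flin_scale flin_id flin_Om subspace_SS\<close>)

text \<open>A nonempty raising word sends x to a radical element of smaller height, which lies in
  \<open>SS\<close> by \<open>below\<close>. Only the summand of weight zero survives, and it is the
  identity.\<close>

lemma Om_rad:
  assumes "x \<in> hom_part \<beta>" "x \<in> rad"
  shows "Om \<beta> x - x \<in> SS"
proof -
  have rad_foldr: "foldr Eop v x \<in> rad" for v
    by (induction v) (auto simp: assms(2) rad_Eop)
  have T: "T \<nu> 1 x \<in> SS" if "\<nu> \<subset># \<beta>" "\<nu> \<noteq> {#}" for \<nu>
  proof -
    have "foldr Eop v x \<in> SS" if v: "mset v = \<nu>" for v
    proof (rule below[OF _ foldr_Eop_hom_part[OF assms(1), of v] rad_foldr])
      show "size (\<beta> - mset v) < size \<beta>"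
        using \<open>\<nu> \<subset># \<beta>\<close> \<open>\<nu> \<noteq> {#}\<close> v size_ge_2
        by (simp add: size_Diff_submset subset_mset.less_imp_le nonempty_has_size)
    qed
    then show ?thesis unfolding T_def by (intro SS_sum SS_scl SS_mult_left) auto
  qed
  have "Om \<beta> x = scl 1 (T {#} 1 x) +
      (\<Sum>\<nu>\<in>{\<nu>. \<nu> \<subset># \<beta>} - {{#}}. scl ((-1) ^ size \<nu> * q powi cas_exp c \<nu> \<beta>) (T \<nu> 1 x))"
    unfolding Om_def using empty_subset by (subst sum.remove[OF finite_subsets_mset, of "{#}"]) auto
  also have "\<dots> = x + (\<Sum>\<nu>\<in>{\<nu>. \<nu> \<subset># \<beta>} - {{#}}. scl ((-1) ^ size \<nu> * q powi cas_exp c \<nu> \<beta>) (T \<nu> 1 x))"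
    by (simp add: T_empty)
  finally have "Om \<beta> x - x =
      (\<Sum>\<nu>\<in>{\<nu>. \<nu> \<subset># \<beta>} - {{#}}. scl ((-1) ^ size \<nu> * q powi cas_exp c \<nu> \<beta>) (T \<nu> 1 x))"
    by simp
  also have "\<dots> \<in> SS" by (intro SS_sum SS_scl T) auto
  finally show ?thesis .
qed

theorem casimir_constraint:
  assumes "x \<in> hom_part \<beta>" "x \<in> rad" "x \<notin> SS"
  shows "q powi (ccw c \<beta> \<beta> - diag c \<beta>) = 1"
proof (rule ccontr)
  let ?t = "q powi (ccw c \<beta> \<beta> - diag c \<beta>)"
  assume "?t \<noteq> 1"
  have "scl (?t - 1) x \<in> SS"
    using SS_diff[OF Om_rad[OF assms(1,2)] Om_hom_part[OF assms(1)]] by (simp add: FA.scale_left_diff_distrib)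
  with \<open>?t \<noteq> 1\<close> assms(3) show False using SS_scl_iff[of "?t - 1" x] by simp
qed

end

section \<open>The radical is generated by the Serre relations\<close>

text \<open>\<open>serre_reduce\<close> is the Serre relation solved for a^n b: every term on the
  other side carries at least one a on its right. This is the form from which integrability is
  derived. \<open>imaginary\<close> includes the pairing of a letter with itself.\<close>

locale qserre = qgens q c gens
  for q :: "'k::field_char_0" and c :: "'g \<Rightarrow> 'g \<Rightarrow> int" and gens +
  assumes not_root: "n \<noteq> 0 \<Longrightarrow> q powi n \<noteq> 1"
    and imaginary: "c a a \<le> 0 \<Longrightarrow> c a b \<le> 0"
    and commute: "c a b = 0 \<Longrightarrow> free_gen a * free_gen b - free_gen b * free_gen a \<in> SS"
    and serre_reduce: "\<lbrakk>0 < c a a; a \<noteq> b\<rbrakk> \<Longrightarrow> \<exists>n f. free_gen a ^ n * free_gen b -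
      (\<Sum>r=1..n. scl (f r) (free_gen a ^ (n - r) * free_gen b * free_gen a ^ r)) \<in> SS"
begin

interpretation neg: qwords q "\<lambda>a b. - c a b"
  by unfold_locales (auto simp: q0 c_sym)

section \<open>Integrability and dominance for real letters\<close>

lemma q_inj: "q powi m = q powi n \<Longrightarrow> m = n"
  using not_root[of "m - n"] q_diff[of m n] by auto

text \<open>The left ideal generated by a^n, modulo \<open>SS\<close>. The case n = 1 defines the
  module of interest; general n keeps count of the powers of a that have been moved to the
  right.\<close>

definition right_mults :: "'g \<Rightarrow> nat \<Rightarrow> ('g free_mon \<Rightarrow>\<^sub>0 'k) set" where
  "right_mults a n = {x. \<exists>y. x - y * free_gen a ^ n \<in> SS}"

lemma right_multsI: "x - y * free_gen a ^ n \<in> SS \<Longrightarrow> x \<in> right_mults a n"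
  by (auto simp: right_mults_def)

lemma SS_right_mults: "x \<in> SS \<Longrightarrow> x \<in> right_mults a n"
  by (rule right_multsI[where y=0]) simp

lemma subspace_right_mults: "FA.subspace (right_mults a n)"
  unfolding FA.subspace_def
proof (intro conjI ballI allI)
  show "0 \<in> right_mults a n" by (simp add: SS_right_mults)
next
  fix x z assume "x \<in> right_mults a n" "z \<in> right_mults a n"
  then obtain y y' where "x - y * free_gen a ^ n \<in> SS" "z - y' * free_gen a ^ n \<in> SS"
    by (auto simp: right_mults_def)
  from SS_add[OF this] show "x + z \<in> right_mults a n"
    by (intro right_multsI[where y="y + y'"]) (simp add: algebra_simps)
next
  fix x t assume "x \<in> right_mults a n"
  then obtain y where "x - y * free_gen a ^ n \<in> SS"
    by (auto simp: right_mults_def)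
  from SS_scl[OF this, of t] show "scl t x \<in> right_mults a n"
    by (intro right_multsI[where y="scl t y"]) (simp add: FA.scale_right_diff_distrib)
qed

lemma right_mults_mult_left: assumes "x \<in> right_mults a n" shows "z * x \<in> right_mults a n"
proof -
  obtain y where "x - y * free_gen a ^ n \<in> SS" using assms by (auto simp: right_mults_def)
  from SS_mult_left[OF this, of z] show ?thesis
    by (intro right_multsI[where y="z * y"]) (simp add: right_diff_distrib mult.assoc)
qed

lemma right_mults_mult_power:
  assumes "x \<in> right_mults a m" shows "x * free_gen a ^ n \<in> right_mults a (m + n)"
proof -
  obtain y where "x - y * free_gen a ^ m \<in> SS" using assms by (auto simp: right_mults_def)
  from SS_mult_right[OF this, of "free_gen a ^ n"] show ?thesis
    by (intro right_multsI[where y=y]) (simp add: left_diff_distrib mult.assoc power_add)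
qed

lemma right_mults_mono: assumes "x \<in> right_mults a n" "m \<le> n" shows "x \<in> right_mults a m"
proof -
  obtain y where "x - y * free_gen a ^ n \<in> SS" using assms by (auto simp: right_mults_def)
  then show ?thesis using assms(2)
    by (intro right_multsI[where y="y * free_gen a ^ (n - m)"]) (simp add: mult.assoc flip: power_add)
qed

lemma mult_in_right_mults: "y * free_gen a ^ n \<in> right_mults a n"
  by (rule right_multsI[where y=y]) simp

lemma right_mults_transfer: "\<lbrakk>x - z \<in> SS; z \<in> right_mults a n\<rbrakk> \<Longrightarrow> x \<in> right_mults a n"
  using FA.subspace_add[OF subspace_right_mults SS_right_mults, of "x - z" z] by simp

lemma rder_power: "rder a (free_gen a ^ Suc n) =
    scl (\<Sum>t\<le>n. q powi (- (int t * c a a))) (free_gen a ^ n)"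
proof (induction n)
  case (Suc n)
  have "rder a (free_gen a ^ Suc (Suc n)) = free_gen a * rder a (free_gen a ^ Suc n) + tw a (free_gen a ^ Suc n)"
    by (simp add: rdr_gen_mult)
  also have "\<dots> = scl ((\<Sum>t\<le>n. q powi (- (int t * c a a))) + q powi (- (int (Suc n) * c a a))) (free_gen a ^ Suc n)"
    unfolding Suc.IH tw_power by (simp add: FA.scale_left_distrib)
  finally show ?case by simp
qed simp

lemma geometric_nonzero:
  assumes "c a a \<noteq> 0"
  shows "(\<Sum>t\<le>n. q powi (- (int t * c a a))) \<noteq> 0"
proof -
  have "(\<Sum>t\<le>n. q powi (- (int t * c a a))) * (q powi (- c a a) - 1) = q powi (- (int (Suc n) * c a a)) - 1"
  proof (induction n)
    case (Suc n)
    have "q powi (- (int (Suc n) * c a a)) * q powi (- c a a) = q powi (- (int (Suc (Suc n)) * c a a))"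
      unfolding q_add[symmetric] by (rule arg_cong[where f="(powi) q"]) (simp add: algebra_simps)
    moreover have "(\<Sum>t\<le>Suc n. q powi (- (int t * c a a))) * (q powi (- c a a) - 1) =
        (\<Sum>t\<le>n. q powi (- (int t * c a a))) * (q powi (- c a a) - 1) +
        (q powi (- (int (Suc n) * c a a)) * q powi (- c a a) - q powi (- (int (Suc n) * c a a)))"
      by (simp add: distrib_right right_diff_distrib del: of_nat_Suc)
    ultimately show ?case using Suc.IH by (simp only:) simp
  qed simp
  moreover have "q powi (- (int (Suc n) * c a a)) \<noteq> 1"
    using assms by (intro not_root) (simp add: algebra_simps del: of_nat_Suc)
  ultimately show ?thesis by auto
qed

lemma rder_funpow_hom_part: "x \<in> hom_part \<nu> \<Longrightarrow> (rder a ^^ Suc (size \<nu>)) x = 0"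
proof (induction "size \<nu>" arbitrary: \<nu> x)
  case 0
  then show ?case using rder_hom_part_notin[of a "{#}" x] by simp
next
  case (Suc n)
  show ?case
  proof (cases "a \<in># \<nu>")
    case True
    then have "n = size (\<nu> - {#a#})" using Suc.hyps(2) by (simp add: size_Diff_singleton)
    have "(rder a ^^ Suc (size \<nu>)) x = (rder a ^^ size \<nu>) (rder a x)"
      by (simp only: funpow_Suc_right comp_apply)
    also have "\<dots> = (rder a ^^ Suc (size (\<nu> - {#a#}))) (rder a x)"
      using Suc.hyps(2) \<open>n = _\<close> by simp
    also have "\<dots> = 0" by (rule Suc.hyps(1)[OF \<open>n = _\<close> rder_hom_part[OF Suc.prems]])
    finally show ?thesis .
  next
    case False
    have "(rder a ^^ k) 0 = 0" for k by (induction k) auto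
    then show ?thesis
      using rder_hom_part_notin[OF False Suc.prems] by (simp add: funpow_swap1)
  qed
qed

lemma flin_funpow:
  fixes f :: "('g free_mon \<Rightarrow>\<^sub>0 'k) \<Rightarrow> ('g free_mon \<Rightarrow>\<^sub>0 'k)"
  shows "flin f \<Longrightarrow> flin (f ^^ n)"
  by (induction n) (auto simp: flin_iff)

lemma rder_locally_nilpotent: "\<exists>d. (rder a ^^ d) x = 0"
proof -
  have "x \<in> FA.span (range word)" by (simp add: span_words)
  then show ?thesis
  proof (induction rule: FA.span_induct_alt)
    case base
    show ?case by (rule exI[of _ 0]) simp
  next
    case (step t x y)
    obtain d where d: "(rder a ^^ d) y = 0" using step.IH by blast
    obtain w where w: "x = word w" using step.hyps by blast
    have lin: "flin (rder a ^^ k)" for k by (rule flin_funpow) simp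
    let ?e = "Suc (size (mset w))"
    have x: "(rder a ^^ ?e) x = 0"
      unfolding w by (rule rder_funpow_hom_part) (rule word_in_hom_part[OF refl])
    have "(rder a ^^ (d + ?e)) x = 0" "(rder a ^^ (?e + d)) y = 0"
      by (simp_all only: funpow_add comp_apply x d flin_0[OF lin])
    then have "(rder a ^^ (d + ?e)) (scl t x + y) = 0"
      by (simp only: flin_add[OF lin] flin_scl[OF lin] add.commute) simp
    then show ?case by blast
  qed
qed

text \<open>Solving \<open>rder a (y * a^(n+1))\<close> for y a^n and multiplying by a shows that y
  a^(n+1) is congruent to a multiple of \<open>rder a y\<close> times a^(n+2). That element
  satisfies the same hypotheses with lower nilpotency degree \<open>d\<close>, and for d = 0 it is
  zero.\<close>

lemma right_mult_in_SS:
  assumes "0 < c a a" "rder a (y * free_gen a ^ Suc n) \<in> SS" "(rder a ^^ d) y = 0"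
  shows "y * free_gen a ^ Suc n \<in> SS"
  using assms(2,3)
proof (induction d arbitrary: y n)
  case (Suc d)
  define s where "s = (\<Sum>t\<le>n. q powi (- (int t * c a a)))"
  define t where "t = q powi (- (int (Suc n) * c a a)) / s"
  have s: "s \<noteq> 0" unfolding s_def by (rule geometric_nonzero) (use assms(1) in simp)
  have "rder a (y * free_gen a ^ Suc n) = scl s (y * free_gen a ^ n) +
      scl (q powi (- (int (Suc n) * c a a))) (rder a y * free_gen a ^ Suc n)"
    by (simp only: rder_mult rder_power tw_power scl_mult s_def)
  also have "\<dots> = scl s (y * free_gen a ^ n + scl t (rder a y * free_gen a ^ Suc n))"
    using s by (simp add: t_def FA.scale_right_distrib)
  finally have "y * free_gen a ^ n + scl t (rder a y * free_gen a ^ Suc n) \<in> SS"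
    using Suc.prems(1) s by (simp add: SS_scl_iff)
  from SS_mult_right[OF this, of "free_gen a"]
  have *: "y * free_gen a ^ Suc n + scl t (rder a y) * free_gen a ^ Suc (Suc n) \<in> SS"
    by (simp add: distrib_right mult.assoc power_commutes)
  have "rder a (scl t (rder a y) * free_gen a ^ Suc (Suc n)) \<in> SS"
    using SS_diff[OF SS_rder[OF *, of a] Suc.prems(1)] by simp
  moreover have "(rder a ^^ d) (scl t (rder a y)) = 0"
    using Suc.prems(2) by (simp add: flin_scl[OF flin_funpow] funpow_swap1)
  ultimately have "scl t (rder a y) * free_gen a ^ Suc (Suc n) \<in> SS"
    by (rule Suc.IH)
  from SS_diff[OF * this] show ?case by simp
qed simp

lemma right_mults_rder:
  assumes "0 < c a a" "x \<in> right_mults a 1" "rder a x \<in> SS"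
  shows "x \<in> SS"
proof -
  obtain y where y: "x - y * free_gen a \<in> SS" using assms(2) by (auto simp: right_mults_def)
  obtain d where d: "(rder a ^^ d) y = 0" using rder_locally_nilpotent by blast
  have "rder a (y * free_gen a) \<in> SS"
    using SS_diff[OF assms(3) SS_rder[OF y, of a]] by simp
  then have "y * free_gen a \<in> SS"
    using right_mult_in_SS[OF assms(1), of y 0 d] d by simp
  from SS_add[OF y this] show ?thesis by simp
qed

text \<open>In the Serre relation multiplied by a^N, the term with a^r on the right is treated by
  the claim for N - r when r < N, and already has enough letters on the right otherwise.\<close>

lemma power_mult_gen:
  assumes "0 < c a a"
  shows "\<exists>d. \<forall>N. free_gen a ^ (N + d) * free_gen b \<in> right_mults a N"
proof (cases "a = b")
  case True
  have "free_gen a ^ N * free_gen b \<in> right_mults a N" for N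
    using right_mults_mono[OF mult_in_right_mults[of 1 a "Suc N"], of N] True
    by (simp add: power_commutes)
  then show ?thesis by (intro exI[of _ 0]) simp
next
  case False
  obtain n f where nf: "free_gen a ^ n * free_gen b -
      (\<Sum>r=1..n. scl (f r) (free_gen a ^ (n - r) * free_gen b * free_gen a ^ r)) \<in> SS"
    using serre_reduce[OF assms False] by blast
  have "free_gen a ^ (N + n) * free_gen b \<in> right_mults a N" for N
  proof (induction N rule: less_induct)
    case (less N)
    show ?case
    proof (rule right_mults_transfer)
      show "free_gen a ^ (N + n) * free_gen b -
        (\<Sum>r=1..n. scl (f r) (free_gen a ^ (N + (n - r)) * free_gen b * free_gen a ^ r)) \<in> SS"
        using SS_mult_left[OF nf, of "free_gen a ^ N"]
        by (simp only: right_diff_distrib sum_distrib_left mult.assoc power_add scl_mult_right)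
      show "(\<Sum>r=1..n. scl (f r) (free_gen a ^ (N + (n - r)) * free_gen b * free_gen a ^ r)) \<in> right_mults a N"
      proof (intro FA.subspace_sum FA.subspace_scale subspace_right_mults)
        fix r assume r: "r \<in> {1..n}"
        show "free_gen a ^ (N + (n - r)) * free_gen b * free_gen a ^ r \<in> right_mults a N"
        proof (cases "r < N")
          case True
          have "free_gen a ^ ((N - r) + n) * free_gen b \<in> right_mults a (N - r)"
            by (rule less) (use r True in auto)
          from right_mults_mult_power[OF this, of r] show ?thesis using r True by simp
        next
          case False
          then show ?thesis by (intro right_mults_mono[OF mult_in_right_mults]) simp
        qed
      qed
    qed
  qed
  then show ?thesis by blast
qed

text \<open>The bound is proved for all \<open>N\<close> at once because each letter passed turns a
  power of a on its left into a smaller one on its right; the losses add up over the word.\<close>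

lemma power_mult_word:
  assumes "0 < c a a"
  shows "\<exists>d. \<forall>N. free_gen a ^ (N + d) * word w \<in> right_mults a N"
proof (induction w rule: rev_induct)
  case Nil
  show ?case using mult_in_right_mults[of 1] by (intro exI[of _ 0]) (simp add: word_Nil)
next
  case (snoc b w)
  obtain d where d: "\<And>N. free_gen a ^ (N + d) * word w \<in> right_mults a N" using snoc by blast
  obtain e where e: "\<And>N. free_gen a ^ (N + e) * free_gen b \<in> right_mults a N"
    using power_mult_gen[OF assms] by blast
  have "free_gen a ^ (N + (e + d)) * word (w @ [b]) \<in> right_mults a N" for N
  proof -
    obtain y where "free_gen a ^ (N + e + d) * word w - y * free_gen a ^ (N + e) \<in> SS"
      using d[of "N + e"] by (auto simp: right_mults_def)
    from SS_mult_right[OF this, of "free_gen b"]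
    have "free_gen a ^ (N + (e + d)) * word (w @ [b]) - y * (free_gen a ^ (N + e) * free_gen b) \<in> SS"
      by (simp add: word_append left_diff_distrib mult.assoc add.assoc flip: free_gen_word)
    then show ?thesis by (rule right_mults_transfer) (intro right_mults_mult_left e)
  qed
  then show ?case by blast
qed

lemma power_mult_right_mults:
  assumes "0 < c a a"
  shows "\<exists>N. free_gen a ^ N * x \<in> right_mults a 1"
proof -
  have "x \<in> FA.span (range word)" by (simp add: span_words)
  then show ?thesis
  proof (induction rule: FA.span_induct_alt)
    case base
    show ?case by (simp add: SS_right_mults)
  next
    case (step t x y)
    obtain w where w: "x = word w" using step.hyps by blast
    obtain N where "free_gen a ^ N * x \<in> right_mults a 1"
      using power_mult_word[OF assms, of w] w by blast
    moreover obtain M where "free_gen a ^ M * y \<in> right_mults a 1" using step.IH by blast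
    ultimately have "free_gen a ^ M * (free_gen a ^ N * x) \<in> right_mults a 1"
      "free_gen a ^ N * (free_gen a ^ M * y) \<in> right_mults a 1"
      by (auto intro: right_mults_mult_left)
    then have "free_gen a ^ (N + M) * x \<in> right_mults a 1" "free_gen a ^ (N + M) * y \<in> right_mults a 1"
      by (simp_all add: mult.assoc[symmetric] add.commute flip: power_add)
    then have "free_gen a ^ (N + M) * (scl t x + y) \<in> right_mults a 1"
      by (simp add: distrib_left FA.subspace_add FA.subspace_scale subspace_right_mults)
    then show ?case by blast
  qed
qed

text \<open>Differentiating the final letter of y a gives y both in \<open>rder\<close> and in
  \<open>rbar\<close>, and these two terms cancel. What remains is again a multiple of a from the
  left.\<close>

lemma Eop_right_mults:
  assumes "x \<in> right_mults a 1"
  shows "Eop a x \<in> right_mults a 1"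
proof -
  obtain y where y: "x - y * free_gen a \<in> SS" using assms by (auto simp: right_mults_def)
  have "Eop a (y * free_gen a) = (scl (q powi (- c a a)) (rder a y) - scl (q powi c a a) (rbar a y)) * free_gen a"
    by (simp add: Eop_def rder_mult neg.rder_mult left_diff_distrib)
  moreover have "Eop a x - Eop a (y * free_gen a) \<in> SS"
    using SS_Eop[OF y, of a] by (simp add: flin_diff)
  ultimately show ?thesis
    by (intro right_multsI) simp
qed

text \<open>The scalar by which E_a F_a^n acts on a highest weight vector, up to F_a^(n-1):
  \<open>b\<close> is (\<alpha>_a, \<beta>) and \<open>d\<close> is (\<alpha>_a, \<alpha>_a). The
  summand s is the torus difference after s letters have been added.\<close>

definition sl2_coeff :: "int \<Rightarrow> int \<Rightarrow> nat \<Rightarrow> 'k" where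
  "sl2_coeff b d n = (\<Sum>s<n. q powi (- (int s * d + b)) - q powi (int s * d + b))"

lemma Eop_power_mult:
  assumes "x \<in> hom_part \<beta>"
  shows "Eop a (free_gen a ^ Suc n * x) =
    free_gen a ^ Suc n * Eop a x + scl (sl2_coeff (cw c a \<beta>) (c a a) (Suc n)) (free_gen a ^ n * x)"
proof (induction n)
  case 0
  show ?case
    by (simp add: Eop_gen_mult sl2_coeff_def tws_hom_part[OF assms] FA.scale_left_diff_distrib)
next
  case (Suc n)
  have *: "free_gen a ^ k * x \<in> hom_part (replicate_mset k a + \<beta>)" for k
    by (induction k) (auto simp: assms mult.assoc gen_mult_hom_part)
  have cw: "cw c a (replicate_mset k a + \<beta>) = int k * c a a + cw c a \<beta>" for k
    by (induction k) (auto simp: algebra_simps)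
  have "Eop a (free_gen a ^ Suc (Suc n) * x) = Eop a (free_gen a * (free_gen a ^ Suc n * x))"
    by (simp add: mult.assoc)
  also have "\<dots> = free_gen a * Eop a (free_gen a ^ Suc n * x)
      + scl (q powi (- (int (Suc n) * c a a + cw c a \<beta>)) - q powi (int (Suc n) * c a a + cw c a \<beta>)) (free_gen a ^ Suc n * x)"
    by (simp only: Eop_gen_mult tws_hom_part[OF *] cw cw_minus simp_thms if_True FA.scale_left_diff_distrib minus_minus)
  also have "\<dots> = free_gen a ^ Suc (Suc n) * Eop a x
      + scl (sl2_coeff (cw c a \<beta>) (c a a) (Suc (Suc n))) (free_gen a ^ Suc n * x)"
    unfolding Suc.IH by (simp add: sl2_coeff_def distrib_left mult.assoc FA.scale_left_distrib)
  finally show ?case .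
qed

text \<open>The product form makes visible that both factors are nonzero for positive
  \<open>b\<close> and \<open>d\<close>, since q is not a root of unity.\<close>

lemma sl2_coeff_closed: "sl2_coeff b d n * (1 - q powi (- d)) =
    (1 - q powi (- (int n * d))) * (q powi (- b) - q powi (b + (int n - 1) * d))"
  unfolding sl2_coeff_def
  by (induction n) (simp_all add: algebra_simps flip: q_add)

lemma sl2_coeff_nonzero:
  assumes "0 < b" "0 < d"
  shows "sl2_coeff b d (Suc n) \<noteq> 0"
proof -
  have "0 < int (Suc n) * d" "0 < 2 * b + (int (Suc n) - 1) * d" using assms by (auto intro: add_pos_nonneg)
  then have "q powi (- (int (Suc n) * d)) \<noteq> 1" "- b \<noteq> b + (int (Suc n) - 1) * d"
    by (auto simp del: of_nat_Suc intro!: not_root)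
  then have "1 - q powi (- (int (Suc n) * d)) \<noteq> 0" "q powi (- b) - q powi (b + (int (Suc n) - 1) * d) \<noteq> 0"
    using q_inj[of "- b" "b + (int (Suc n) - 1) * d"] by (auto simp del: of_nat_Suc)
  then show ?thesis using sl2_coeff_closed[of b d "Suc n"] by (metis mult_eq_0_iff)
qed

text \<open>In the left module of \<open>F\<close> modulo the Serre ideal and \<open>F a\<close>, the class of \<open>x\<close> is a highest
  weight vector for the \<open>sl\<^sub>2\<close> of a real letter \<open>a\<close>, which acts integrably; its weight is
  therefore nonnegative.\<close>

lemma real_dominant:
  assumes real: "0 < c a a" and x: "x \<in> hom_part \<beta>" "x \<notin> SS" "rder a x \<in> SS" "lder a x \<in> SS"
  shows "cw c a \<beta> \<le> 0"
proof (rule ccontr)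
  assume neg: "\<not> cw c a \<beta> \<le> 0"
  define N where "N = (LEAST N. free_gen a ^ N * x \<in> right_mults a 1)"
  have N: "free_gen a ^ N * x \<in> right_mults a 1"
    unfolding N_def using power_mult_right_mults[OF real] by (rule LeastI_ex)
  have "x \<notin> right_mults a 1" using right_mults_rder[OF real] x by blast
  then obtain n where n: "N = Suc n" using N by (cases N) auto
  have "free_gen a ^ n * x \<notin> right_mults a 1"
    using not_less_Least[of n "\<lambda>N. free_gen a ^ N * x \<in> right_mults a 1"] n by (simp add: N_def)
  \<comment> \<open>E_a preserves the left ideal and sends a^N x to a^N E_a x, which lies in
    \<open>SS\<close>, plus this multiple of a^(N-1) x. Minimality of N would force the coefficient
    to vanish.\<close>
  moreover have "scl (sl2_coeff (cw c a \<beta>) (c a a) N) (free_gen a ^ n * x) \<in> right_mults a 1"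
  proof -
    have "Eop a x \<in> SS" using x by (simp add: Eop_def rbar_lder SS_diff SS_twb)
    then have "free_gen a ^ N * Eop a x \<in> right_mults a 1"
      by (intro SS_right_mults SS_mult_left)
    from FA.subspace_diff[OF subspace_right_mults Eop_right_mults[OF N] this] show ?thesis
      using Eop_power_mult[OF x(1), of a n] n by simp
  qed
  moreover have k0: "sl2_coeff (cw c a \<beta>) (c a a) N \<noteq> 0"
    using sl2_coeff_nonzero[of "cw c a \<beta>" "c a a" n] neg real n by simp
  ultimately have "scl (1 / sl2_coeff (cw c a \<beta>) (c a a) N) (scl (sl2_coeff (cw c a \<beta>) (c a a) N) (free_gen a ^ n * x)) \<in> right_mults a 1"
    by (intro FA.subspace_scale[OF subspace_right_mults, of "scl _ _"])
  then show False using k0 \<open>free_gen a ^ n * x \<notin> right_mults a 1\<close> by simp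
qed

text \<open>Removing one copy of \<open>a\<close> is deliberate: \<open>c a a = 0\<close> is
  demanded only of letters that occur at least twice.\<close>

definition commuting :: "'g multiset \<Rightarrow> bool" where
  "commuting \<beta> \<longleftrightarrow> (\<forall>a\<in>#\<beta>. \<forall>b\<in>#\<beta> - {#a#}. c a b = 0)"

lemma commuting_add:
  assumes "commuting (add_mset a \<beta>)"
  shows "commuting \<beta>" "b \<in># \<beta> \<Longrightarrow> c a b = 0"
proof -
  have "d \<in># add_mset a \<beta> - {#b#}" if "d \<in># \<beta> - {#b#}" for d b
    using that by (simp add: in_diff_count split: if_splits)
  then show "commuting \<beta>" using assms by (auto simp: commuting_def)
  show "b \<in># \<beta> \<Longrightarrow> c a b = 0" using assms by (simp add: commuting_def)
qed

lemma move_front: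
  assumes "\<And>b. b \<in> set p \<Longrightarrow> c a b = 0"
  shows "word (p @ a # s) - word (a # p @ s) \<in> SS"
  using assms
proof (induction p)
  case (Cons b p)
  have "word (p @ a # s) - word (a # p @ s) \<in> SS" by (rule Cons.IH) (use Cons.prems in auto)
  from SS_mult_left[OF this, of "free_gen b"]
  have 1: "word (b # p @ a # s) - free_gen b * free_gen a * word (p @ s) \<in> SS"
    by (simp add: word_Cons right_diff_distrib mult.assoc)
  have "c b a = 0" using Cons.prems[of b] c_sym[of b a] by simp
  from SS_mult_right[OF commute[OF this], of "word (p @ s)"]
  have "free_gen b * free_gen a * word (p @ s) - word (a # b # p @ s) \<in> SS"
    by (simp add: word_Cons left_diff_distrib mult.assoc)
  from SS_add[OF 1 this] show ?case by simp
qed simp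

lemma commuting_words: "\<lbrakk>commuting (mset u); mset u = mset w\<rbrakk> \<Longrightarrow> word w - word u \<in> SS"
proof (induction u arbitrary: w)
  case (Cons a u)
  then have "a \<in> set w" by (metis list.set_intros(1) mset_eq_setD)
  then obtain p s where w: "w = p @ a # s" by (meson split_list)
  then have ps: "mset (p @ s) = mset u" using Cons.prems(2) by simp
  have "word (p @ s) - word u \<in> SS"
    using commuting_add(1)[of a "mset u"] Cons.prems(1) ps by (intro Cons.IH) simp_all
  from SS_mult_left[OF this, of "free_gen a"]
  have 1: "word (a # p @ s) - word (a # u) \<in> SS"
    by (simp add: word_Cons right_diff_distrib)
  have "word w - word (a # p @ s) \<in> SS"
    unfolding w
  proof (rule move_front)
    fix b assume "b \<in> set p"
    then have "b \<in># mset u" by (simp flip: ps)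
    then show "c a b = 0" using commuting_add(2)[of a "mset u" b] Cons.prems(1) by simp
  qed
  from SS_add[OF this 1] show ?case by simp
qed simp

text \<open>No power of q is picked up, so \<open>lder a\<close> is a partial derivative in
  commuting variables and this is Euler's identity for the degree in a.\<close>

lemma gen_mult_lder:
  assumes "\<And>b. b \<in> set u \<Longrightarrow> c a b = 0"
  shows "free_gen a * lder a (word u) - scl (of_nat (count (mset u) a)) (word u) \<in> SS"
  using assms
proof (induction u)
  case (Cons b u)
  have "free_gen a * lder a (word u) - scl (of_nat (count (mset u) a)) (word u) \<in> SS"
    by (rule Cons.IH) (use Cons.prems in auto)
  from SS_mult_left[OF this, of "free_gen b"]
  have 1: "free_gen b * free_gen a * lder a (word u) - scl (of_nat (count (mset u) a)) (word (b # u)) \<in> SS"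
    by (simp add: word_Cons right_diff_distrib mult.assoc)
  have "c a b = 0" using Cons.prems by simp
  from SS_mult_right[OF commute[OF this], of "lder a (word u)"]
  have "free_gen a * free_gen b * lder a (word u) - free_gen b * free_gen a * lder a (word u) \<in> SS"
    by (simp add: left_diff_distrib)
  from SS_add[OF this 1]
  have "free_gen a * free_gen b * lder a (word u) - scl (of_nat (count (mset u) a)) (word (b # u)) \<in> SS"
    by simp
  then show ?case
    using \<open>c a b = 0\<close> by (auto simp: word_Cons ldr_gen_mult distrib_left mult.assoc FA.scale_left_distrib algebra_simps)
qed (simp add: word_Nil)

text \<open>The value is a product of factorials of the multiplicities; prepending a multiplies it
  by the new multiplicity of a. Only its positivity is recorded.\<close>

lemma frm_commuting: "commuting (mset u) \<Longrightarrow> \<exists>n>0. frm u (word u) = of_nat n"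
proof (induction u)
  case (Cons a u)
  obtain n where n: "n > 0" "frm u (word u) = of_nat n"
    using Cons.IH commuting_add(1)[of a "mset u"] Cons.prems by auto
  have 0: "c a b = 0" if "b \<in> set u" for b
    using commuting_add(2)[of a "mset u" b] Cons.prems that by simp
  have "frm u (free_gen a * lder a (word u) - scl (of_nat (count (mset u) a)) (word u)) = 0"
    using SS_rad[OF gen_mult_lder[OF 0]] by (simp add: rad_def)
  then have *: "frm u (free_gen a * lder a (word u)) = of_nat (count (mset u) a) * of_nat n"
    by (simp add: frm_diff frm_scl n)
  have "frm (a # u) (word (a # u)) = of_nat (n + count (mset u) a * n)"
  proof (cases "a \<in> set u")
    case True
    then show ?thesis using 0[of a] by (simp add: frm_Cons word_Cons ldr_gen_mult frm_add frm_scl n *)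
  next
    case False
    then show ?thesis
      by (simp add: frm_Cons word_Cons ldr_gen_mult frm_add frm_scl n lder_word_notin not_in_iff[symmetric]
        count_eq_zero_iff[THEN iffD2])
  qed
  then show ?case using n by (intro exI[of _ "n + count (mset u) a * n"]) simp
qed (simp add: frm_Nil_word)

lemma hom_part_commuting:
  assumes "commuting \<beta>" "mset w = \<beta>" "x \<in> hom_part \<beta>"
  shows "\<exists>t. x - scl t (word w) \<in> SS"
  using assms(3) unfolding hom_part_def
proof (induction rule: FA.span_induct_alt)
  case base
  show ?case by (rule exI[of _ 0]) simp
next
  case (step d x y)
  obtain t where t: "y - scl t (word w) \<in> SS" using step.IH by blast
  obtain v where v: "x = word v" "mset v = \<beta>" using step.hyps by blast
  have "x - word w \<in> SS" using commuting_words[of w v] assms v by simp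
  from SS_add[OF SS_scl[OF this, of d] t] show ?case
    by (intro exI[of _ "d + t"]) (simp add: FA.scale_right_diff_distrib FA.scale_left_distrib algebra_simps)
qed

section \<open>The minimal radical element outside the Serre ideal\<close>

lemma sum_mset_nonpos: "(\<And>a. a \<in># M \<Longrightarrow> f a \<le> (0::int)) \<Longrightarrow> (\<Sum>a\<in>#M. f a) \<le> 0"
  by (induction M) (auto intro: add_nonpos_nonpos)

lemma sum_mset_eq_0: 
  assumes "\<And>a. a \<in># M \<Longrightarrow> f a \<le> (0::int)" "(\<Sum>a\<in>#M. f a) = 0" "b \<in># M"
  shows "f b = 0"
proof -
  obtain M' where M: "M = add_mset b M'" using assms(3) by (metis insert_DiffM)
  have "(\<Sum>a\<in>#M'. f a) \<le> 0" by (rule sum_mset_nonpos) (use assms(1) M in auto)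
  then show ?thesis using assms(1)[OF assms(3)] assms(2) M by auto
qed

theorem hom_rad_SS: "\<lbrakk>x \<in> hom_part \<beta>; x \<in> rad\<rbrakk> \<Longrightarrow> x \<in> SS"
proof (induction "size \<beta>" arbitrary: \<beta> x rule: less_induct)
  case less
  show ?case
  proof (rule ccontr)
    assume "x \<notin> SS"
    obtain w where w: "mset w = \<beta>" using ex_mset by blast
    have "commuting \<beta>"
    proof (cases "2 \<le> size \<beta>")
      case True
      interpret casimir q c gens \<beta>
        by unfold_locales (use less.hyps True in auto)
      have der: "rder a x \<in> SS" "lder a x \<in> SS" for a
      proof -
        have "rder a x \<in> SS \<and> lder a x \<in> SS"
        proof (cases "a \<in># \<beta>")
          case True
          then have "size (\<beta> - {#a#}) < size \<beta>" by (rule size_Diff1_less)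
          from less.hyps[OF this rder_hom_part[OF less.prems(1)] rad_rder[OF less.prems(2)]]
            less.hyps[OF this lder_hom_part[OF less.prems(1)] rad_lder[OF less.prems(2)]]
          show ?thesis by blast
        next
          case False
          then show ?thesis using lder_hom_part_notin rder_hom_part_notin less.prems by simp
        qed
        then show "rder a x \<in> SS" "lder a x \<in> SS" by auto
      qed
      have "ccw c \<beta> \<beta> - diag c \<beta> = 0"
        using casimir_constraint[OF less.prems \<open>x \<notin> SS\<close>] not_root by blast
      \<comment> \<open>(\<beta>, \<beta>) - 2(\<rho>, \<beta>) is distributed over the letters of
        \<beta>. For a real letter the summand is negative by \<open>real_dominant\<close>; for an
        imaginary one it is the pairing with the other letters, which is nonpositive. Hence all
        summands vanish.\<close>
      then have sum0: "(\<Sum>a\<in>#\<beta>. cw c a \<beta> - c a a) = 0"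
      proof -
        have "(\<Sum>a\<in>#M. cw c a \<beta> - c a a) = (\<Sum>a\<in>#M. cw c a \<beta>) - (\<Sum>a\<in>#M. c a a)" for M
          by (induction M) auto
        then show ?thesis using \<open>ccw c \<beta> \<beta> - diag c \<beta> = 0\<close> by (simp add: ccw_def diag_def)
      qed
      have le: "cw c a (\<beta> - {#a#}) \<le> 0" if "c a a \<le> 0" for a
        unfolding cw_def by (rule sum_mset_nonpos) (rule imaginary[OF that])
      have split: "cw c a \<beta> - c a a = cw c a (\<beta> - {#a#})" if "a \<in># \<beta>" for a
        using cw_simps(2)[of c a a "\<beta> - {#a#}"] insert_DiffM[OF that] by simp
      have nonpos: "cw c a \<beta> - c a a \<le> 0" if "a \<in># \<beta>" for a
      proof (cases "0 < c a a")
        case True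
        then show ?thesis using real_dominant[OF True less.prems(1) \<open>x \<notin> SS\<close> der] by simp
      qed (use split[OF that] le[of a] in simp)
      have zero: "cw c a \<beta> - c a a = 0" if "a \<in># \<beta>" for a
        by (rule sum_mset_eq_0[OF nonpos sum0 that])
      \<comment> \<open>A real letter would give 0 < (\<alpha>_a, \<alpha>_a) = (\<alpha>_a,
        \<beta>) \<le> 0.\<close>
      have imag: "c a a \<le> 0" if "a \<in># \<beta>" for a
        using zero[OF that] real_dominant[OF _ less.prems(1) \<open>x \<notin> SS\<close> der, of a] by force
      show ?thesis
        unfolding commuting_def
      proof (intro ballI)
        fix a b assume a: "a \<in># \<beta>" and b: "b \<in># \<beta> - {#a#}"
        show "c a b = 0"
          by (rule sum_mset_eq_0[where f="c a", OF _ _ b])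
            (use imaginary[OF imag[OF a]] zero[OF a] split[OF a] in \<open>auto simp: cw_def\<close>)
      qed
    next
      case False
      \<comment> \<open>In height at most one there are no two letters to compare, so the condition
        is vacuous and no Casimir operator is needed.\<close>
      then have "size (mset w) \<le> 1" using w by simp
      then show ?thesis
        unfolding w[symmetric] commuting_def by (cases w) auto
    qed
    then obtain t where t: "x - scl t (word w) \<in> SS"
      using hom_part_commuting[OF _ w less.prems(1)] by blast
    \<comment> \<open>All words of this weight are congruent, so x is t times one of them modulo
      \<open>SS\<close>; pairing with that word gives t times a positive integer equal to
      zero.\<close>
    have "frm w (x - scl t (word w)) = 0" using SS_rad[OF t] by (simp add: rad_def)
    moreover have "frm w x = 0" using less.prems(2) by (simp add: rad_def)
    moreover obtain n where "n > 0" "frm w (word w) = of_nat n"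
      using frm_commuting[of w] \<open>commuting \<beta>\<close> w by blast
    ultimately have "t = 0" by (simp add: frm_diff frm_scl)
    then show False using t \<open>x \<notin> SS\<close> by simp
  qed
qed

section \<open>Weight components of radical elements\<close>

definition wt_part :: "'g multiset \<Rightarrow> ('g free_mon \<Rightarrow>\<^sub>0 'k) \<Rightarrow> ('g free_mon \<Rightarrow>\<^sub>0 'k)" where
  "wt_part \<beta> = linext (\<lambda>w. if mset w = \<beta> then word w else 0)"

lemma wt_part_hom: "wt_part \<beta> x \<in> hom_part \<beta>"
  by (rule flin_in_subspace[where f="wt_part \<beta>" and B="range word"])
    (auto simp: wt_part_def flin_linext subspace_hom_part word_in_hom_part FA.subspace_0 span_words)

lemma frm_wt_part: "frm u (wt_part \<beta> x) = (if mset u = \<beta> then frm u x else 0)"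
proof (rule functional_ext[where W=UNIV and f="\<lambda>x. frm u (wt_part \<beta> x)"])
  fix w
  show "frm u (wt_part \<beta> (word w)) = (if mset u = \<beta> then frm u (word w) else 0)"
    using frm_outside[OF _ word_in_hom_part[of w "mset w"], of u] by (auto simp: wt_part_def)
qed (auto simp: wt_part_def flin_add[OF flin_linext] flin_scl[OF flin_linext] frm_add frm_scl span_words)

lemma wt_part_sum:
  assumes "finite B" "\<And>m. m \<in> Poly_Mapping.keys x \<Longrightarrow> mset (letters m) \<in> B"
  shows "x = (\<Sum>\<beta>\<in>B. wt_part \<beta> x)"
proof (rule flin_eq_on_span[where W="{w. mset w \<in> B}" and f="\<lambda>x. x"])
  show "flin (\<lambda>x. \<Sum>\<beta>\<in>B. wt_part \<beta> x)"
    by (rule flinI) (simp_all add: wt_part_def flin_add[OF flin_linext] flin_scl[OF flin_linext]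
        sum.distrib FA.scale_sum_right)
  show "word w = (\<Sum>\<beta>\<in>B. wt_part \<beta> (word w))" if "w \<in> {w. mset w \<in> B}" for w
    using that assms(1) by (simp add: wt_part_def sum.delta')
  show "x \<in> FA.span (word ` {w. mset w \<in> B})" by (rule in_span_words) (use assms(2) in auto)
qed (simp add: flin_id)

text \<open>A word pairs only with the component of its own weight, so the radical is graded and
  \<open>hom_rad_SS\<close> applies to each component.\<close>

theorem rad_eq_SS: "rad = SS"
proof
  show "SS \<subseteq> rad" using SS_rad by blast
  show "rad \<subseteq> SS"
  proof
    fix x assume x: "x \<in> rad"
    have "x = (\<Sum>\<beta>\<in>(\<lambda>m. mset (letters m)) ` Poly_Mapping.keys x. wt_part \<beta> x)"
      by (rule wt_part_sum) auto
    also have "\<dots> \<in> SS"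
      by (intro SS_sum hom_rad_SS[OF wt_part_hom]) (use x in \<open>simp add: rad_def frm_wt_part\<close>)
    finally show "x \<in> SS" .
  qed
qed

end

section \<open>Quantum Serre elements\<close>

lemma q_fact_Suc: "q_fact Q (Suc n) = q_fact Q n * q_int Q (Suc n)"
  by (simp add: q_fact_def prod.nat_ivl_Suc')

lemma q_fact_0 [simp]: "q_fact Q 0 = 1"
  by (simp add: q_fact_def)

lemma q_binom_sym: "r \<le> n \<Longrightarrow> q_binom Q n (n - r) = q_binom Q n r"
  by (simp add: q_binom_def mult.commute)

locale not_root_of_unity =
  fixes Q :: "'k::field"
  assumes Q0: "Q \<noteq> 0" and Q_pow: "n > 0 \<Longrightarrow> Q ^ n \<noteq> 1"
begin

lemma Q_diff: "Q - inverse Q \<noteq> 0"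
  using Q_pow[of 2] Q0 by (auto simp: field_simps power2_eq_square)

lemma q_int_eq: "q_int Q n * (Q - inverse Q) = Q powi int n - Q powi (- int n)"
  using Q_diff by (simp add: q_int_def power_int_minus power_inverse)

lemma q_int_nonzero: assumes "0 < n" shows "q_int Q n \<noteq> 0"
proof -
  have "Q ^ n - inverse Q ^ n \<noteq> 0"
  proof
    assume "Q ^ n - inverse Q ^ n = 0"
    then have "Q ^ n * Q ^ n = 1" using Q0 by (simp add: power_inverse field_simps)
    then show False using Q_pow[of "n + n"] assms by (simp add: power_add)
  qed
  then show ?thesis using Q_diff by (simp add: q_int_def)
qed

lemma q_fact_nonzero: "q_fact Q n \<noteq> 0"
  by (induction n) (simp_all add: q_fact_Suc q_int_nonzero)

lemma q_binom_0: "q_binom Q n 0 = 1"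
  by (simp add: q_binom_def q_fact_nonzero)

lemma q_binom_self: "q_binom Q n n = 1"
  by (simp add: q_binom_def q_fact_nonzero)

lemma q_binom_Suc:
  assumes "r < n"
  shows "q_binom Q n (Suc r) * q_int Q (Suc r) = q_binom Q n r * q_int Q (n - r)"
proof -
  have "q_fact Q (n - r) = q_fact Q (n - Suc r) * q_int Q (n - r)"
    using q_fact_Suc[of Q "n - Suc r"] assms by (simp add: Suc_diff_Suc)
  then show ?thesis
    using q_int_nonzero[of "Suc r"] q_int_nonzero[of "n - r"] assms
    by (simp add: q_binom_def q_fact_Suc q_fact_nonzero field_simps)
qed

lemma q_binom_Suc_Suc:
  "r \<le> n \<Longrightarrow> q_binom Q (Suc n) (Suc r) * q_int Q (Suc r) = q_binom Q n r * q_int Q (Suc n)"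
  using q_int_nonzero[of "Suc r"] by (simp add: q_binom_def q_fact_Suc q_fact_nonzero field_simps)

lemma Q_add: "Q powi (i + j) = Q powi i * Q powi j"
  using Q0 by (simp add: power_int_add)

text \<open>After multiplication by [k+1] this is Q^(n-k) [n+1] = [k+1] + Q^(n+1) [n-k], an identity
  of Laurent polynomials in Q.\<close>

lemma q_pascal:
  assumes "Suc k \<le> n"
  shows "Q powi (int n - int k) * q_binom Q (Suc n) (Suc k) =
    q_binom Q n k + Q powi int (Suc n) * q_binom Q n (Suc k)"
proof -
  let ?d = "Q - inverse Q"
  have "Q powi (int n - int k) * q_int Q (Suc n) * ?d = (q_int Q (Suc k) + Q powi int (Suc n) * q_int Q (n - k)) * ?d"
    using assms unfolding distrib_right mult.assoc q_int_eq
    by (simp only: right_diff_distrib Q_add[symmetric]) (simp add: of_nat_diff algebra_simps)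
  then have *: "Q powi (int n - int k) * q_int Q (Suc n) = q_int Q (Suc k) + Q powi int (Suc n) * q_int Q (n - k)"
    by (rule mult_right_cancel[OF Q_diff, THEN iffD1])
  have "(Q powi (int n - int k) * q_binom Q (Suc n) (Suc k)) * q_int Q (Suc k) =
      q_binom Q n k * (Q powi (int n - int k) * q_int Q (Suc n))"
    using q_binom_Suc_Suc[of k n] assms by (simp add: mult.commute mult.left_commute)
  also have "\<dots> = q_binom Q n k * q_int Q (Suc k) + Q powi int (Suc n) * (q_binom Q n (Suc k) * q_int Q (Suc k))"
    using q_binom_Suc[of k n] assms by (simp only: *) (simp add: algebra_simps)
  finally have "(Q powi (int n - int k) * q_binom Q (Suc n) (Suc k)) * q_int Q (Suc k) =
      (q_binom Q n k + Q powi int (Suc n) * q_binom Q n (Suc k)) * q_int Q (Suc k)"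
    by (simp add: algebra_simps)
  then show ?thesis using q_int_nonzero[of "Suc k"] by simp
qed

text \<open>The vanishing of the full alternating sum does not lend itself to induction, but its
  partial sums have a closed form, each step being \<open>q_pascal\<close>.\<close>

lemma q_binom_partial_sum:
  "k \<le> n \<Longrightarrow> (\<Sum>r\<le>k. (-1) ^ r * q_binom Q (Suc n) r * Q powi (int n * int r)) =
    (-1) ^ k * Q powi (int (Suc n) * int k) * q_binom Q n k"
proof (induction k)
  case (Suc k)
  have "int n * int (Suc k) = int (Suc n) * int k + (int n - int k)" by (simp add: algebra_simps)
  then have "q_binom Q (Suc n) (Suc k) * Q powi (int n * int (Suc k)) =
      Q powi (int (Suc n) * int k) * (q_binom Q n k + Q powi int (Suc n) * q_binom Q n (Suc k))"
    using q_pascal[of k n] Suc.prems by (simp add: Q_add mult_ac del: of_nat_Suc)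
  also have "\<dots> = Q powi (int (Suc n) * int k) * q_binom Q n k + Q powi (int (Suc n) * int (Suc k)) * q_binom Q n (Suc k)"
  proof -
    have "int (Suc n) * int (Suc k) = int (Suc n) * int k + int (Suc n)" by (simp add: algebra_simps)
    then show ?thesis by (simp add: Q_add distrib_left mult.assoc del: of_nat_Suc)
  qed
  finally show ?case using Suc by (simp add: algebra_simps del: of_nat_Suc)
qed (simp add: q_binom_0)

text \<open>The exponent is the charge of b for the letters a^(n-r) to its left in a summand of the
  Serre element. Reversing the summation brings the sum into the shape of the partial sums, whose
  last value cancels the remaining term.\<close>

lemma q_binom_alternating_sum:
  assumes "0 < n"
  shows "(\<Sum>r\<le>n. (-1) ^ r * q_binom Q n r * Q powi ((int n - 1) * (int n - int r))) = 0"
proof -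
  obtain n' where n: "n = Suc n'" using assms gr0_implies_Suc by blast
  have "(\<Sum>r\<le>n. (-1) ^ r * q_binom Q n r * Q powi ((int n - 1) * (int n - int r))) =
      (\<Sum>r\<le>n. (-1) ^ (n - r) * q_binom Q n (n - r) * Q powi ((int n - 1) * (int n - int (n - r))))"
    by (rule sum.reindex_bij_witness[of _ "\<lambda>r. n - r" "\<lambda>r. n - r"]) auto
  also have "\<dots> = (\<Sum>r\<le>n. (-1) ^ n * ((-1) ^ r * q_binom Q n r * Q powi (int n' * int r)))"
  proof (rule sum.cong[OF refl])
    fix r assume "r \<in> {..n}"
    then have r: "r \<le> n" by simp
    have "(-1 :: 'k) ^ (n - r) = (-1) ^ n * (-1) ^ r"
      using r by (metis (no_types, lifting) le_add_diff_inverse2 minus_one_power_iff mult.commute mult_1 mult_minus1 power_add even_add)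
    then show "(-1) ^ (n - r) * q_binom Q n (n - r) * Q powi ((int n - 1) * (int n - int (n - r))) =
        (-1) ^ n * ((-1) ^ r * q_binom Q n r * Q powi (int n' * int r))"
      using r by (simp add: q_binom_sym of_nat_diff n)
  qed
  also have "\<dots> = (-1) ^ n * (\<Sum>r\<le>n. (-1) ^ r * q_binom Q n r * Q powi (int n' * int r))"
    by (simp add: sum_distrib_left)
  also have "(\<Sum>r\<le>n. (-1) ^ r * q_binom Q n r * Q powi (int n' * int r)) = 0"
    using q_binom_partial_sum[of n' n'] by (simp add: n q_binom_self algebra_simps)
  finally show ?thesis by simp
qed

end

definition serre_el :: "'k::field \<Rightarrow> nat \<Rightarrow> ('g free_mon \<Rightarrow>\<^sub>0 'k) \<Rightarrow> ('g free_mon \<Rightarrow>\<^sub>0 'k)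
    \<Rightarrow> ('g free_mon \<Rightarrow>\<^sub>0 'k)" where
  "serre_el Q n x y = (\<Sum>r\<le>n. scl ((-1) ^ r * q_binom Q n r) (x ^ (n - r) * y * x ^ r))"

section \<open>Serre elements are killed by all derivations\<close>

context qwords
begin

text \<open>The unsymmetric q-integer by which \<open>lder a\<close> acts on a^n. For d = 2\<sigma>
  it is Q^(1-n) [n] with Q = q^\<sigma>, which links the derivations to the symmetric
  q-binomials.\<close>

definition nn :: "int \<Rightarrow> nat \<Rightarrow> 'k" where
  "nn d n = (\<Sum>t<n. q powi (- (int t * d)))"

lemma lder_power: "lder a (free_gen b ^ n) = (if a = b then scl (nn (c a a) n) (free_gen a ^ (n - 1)) else 0)"
proof (induction n)
  case (Suc n)
  have "lder a (free_gen a ^ Suc n) = scl (nn (c a a) (Suc n)) (free_gen a ^ n)" if "a = b"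
  proof -
    have "lder a (free_gen a ^ n * free_gen a) =
        scl (nn (c a a) n) (free_gen a ^ (n - 1)) * free_gen a + scl (q powi (- (int n * c a a))) (free_gen a ^ n)"
      using Suc that by (simp only: lder_mult tw_power) simp
    also have "scl (nn (c a a) n) (free_gen a ^ (n - 1)) * free_gen a = scl (nn (c a a) n) (free_gen a ^ n)"
      by (cases n) (simp_all add: nn_def power_commutes)
    finally show ?thesis by (simp add: nn_def power_commutes FA.scale_left_distrib)
  qed
  moreover have "lder a (free_gen b ^ Suc n) = 0" if "a \<noteq> b"
    using Suc that by (simp add: ldr_gen_mult)
  ultimately show ?case by auto
qed (simp add: nn_def)

lemma revp_power: "revp (free_gen a ^ n) = free_gen a ^ n"
  by (induction n) (simp_all add: revp_mult power_commutes)

lemma serre_el_hom_part: "serre_el Q n (free_gen a) (free_gen b) \<in> hom_part (replicate_mset n a + {#b#})"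
  unfolding serre_el_def
proof (intro FA.subspace_sum FA.subspace_scale subspace_hom_part)
  fix r assume "r \<in> {..n}"
  then have "mset (replicate (n - r) a @ b # replicate r a) = replicate_mset n a + {#b#}"
    by (intro multiset_eqI) auto
  from word_in_hom_part[OF this]
  show "free_gen a ^ (n - r) * free_gen b * free_gen a ^ r \<in> hom_part (replicate_mset n a + {#b#})"
    by (simp add: word_append word_Cons word_replicate mult.assoc)
qed

lemma serre_el_revp: "revp (serre_el (Q :: 'k) n (free_gen a) (free_gen b)) = scl ((-1) ^ n) (serre_el Q n (free_gen a) (free_gen b))"
proof -
  have "revp (serre_el Q n (free_gen a) (free_gen b)) =
      (\<Sum>r\<le>n. scl ((-1) ^ r * q_binom Q n r) (free_gen a ^ r * free_gen b * free_gen a ^ (n - r)))"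
    by (simp add: serre_el_def flin_sum[OF flin_ops(4)] revp_mult revp_power mult.assoc)
  also have "\<dots> = (\<Sum>r\<le>n. scl ((-1) ^ (n - r) * q_binom Q n (n - r))
      (free_gen a ^ (n - r) * free_gen b * free_gen a ^ r))"
    by (rule sum.reindex_bij_witness[of _ "\<lambda>r. n - r" "\<lambda>r. n - r"]) auto
  also have "\<dots> = (\<Sum>r\<le>n. scl ((-1) ^ n * ((-1) ^ r * q_binom Q n r))
      (free_gen a ^ (n - r) * free_gen b * free_gen a ^ r))"
  proof (rule sum.cong[OF refl])
    fix r assume "r \<in> {..n}"
    then have r: "r \<le> n" by simp
    have "(-1 :: 'k) ^ (n - r) = (-1) ^ n * (-1) ^ r"
      using r by (simp add: minus_one_power_iff)
    then show "scl ((-1) ^ (n - r) * q_binom Q n (n - r)) (free_gen a ^ (n - r) * free_gen b * free_gen a ^ r) =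
        scl ((-1) ^ n * ((-1) ^ r * q_binom Q n r)) (free_gen a ^ (n - r) * free_gen b * free_gen a ^ r)"
      using r by (simp add: q_binom_sym mult.assoc)
  qed
  finally show ?thesis by (simp add: serre_el_def FA.scale_sum_right)
qed

text \<open>In the application \<sigma> is s_i, \<open>Q\<close> is q_i and \<open>n\<close> is 1 -
  a_ij, so that \<open>caa\<close> and \<open>cab\<close> are the entries s_i a_ii = 2 s_i and s_i
  a_ij.\<close>

context
  fixes a b :: 'g and n :: nat and \<sigma> :: int and Q :: 'k
  assumes ab: "a \<noteq> b" and n: "0 < n" and Q: "Q = q powi \<sigma>"
    and caa: "c a a = 2 * \<sigma>" and cab: "c a b = \<sigma> * (1 - int n)"
    and Q_root: "\<And>k. k > 0 \<Longrightarrow> Q ^ k \<noteq> 1"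
begin

interpretation not_root_of_unity Q
  using Q_root by unfold_locales (simp_all add: Q q0)

lemma Q_powi: "q powi (\<sigma> * j) = Q powi j"
  by (simp add: Q power_int_mult)

lemma nn_eq: "nn (c a a) k = Q powi (1 - int k) * q_int Q k"
proof -
  have Qi: "inverse Q = Q powi (- 1)" by (simp add: power_int_minus)
  have "nn (c a a) k * (Q - inverse Q) = Q powi (1 - int k) * q_int Q k * (Q - inverse Q)"
  proof -
    have "nn (c a a) k * (Q - inverse Q) = Q powi 1 - Q powi (1 - 2 * int k)"
    proof (induction k)
      case 0
      then show ?case by (simp add: nn_def)
    next
      case (Suc k)
      have "q powi (- (int k * c a a)) = Q powi (- 2 * int k)"
        unfolding Q_powi[symmetric] caa by (simp add: algebra_simps)
      then have "q powi (- (int k * c a a)) * (Q - inverse Q) = Q powi (- 2 * int k) * Q powi 1 - Q powi (- 2 * int k) * Q powi (- 1)"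
        by (simp only: right_diff_distrib Qi power_int_1_right)
      also have "\<dots> = Q powi (1 - 2 * int k) - Q powi (1 - 2 * int (Suc k))"
        unfolding Q_add[symmetric] by (simp add: algebra_simps)
      finally show ?case using Suc by (simp add: nn_def distrib_right del: of_nat_Suc)
    qed
    also have "\<dots> = Q powi (1 - int k) * (Q powi int k - Q powi (- int k))"
      unfolding right_diff_distrib Q_add[symmetric] by simp
    finally show ?thesis by (simp add: mult.assoc q_int_eq)
  qed
  then show ?thesis by (rule mult_right_cancel[OF Q_diff, THEN iffD1])
qed

text \<open>The monomial a^(n-r-1) b a^r arises twice in \<open>lder a\<close>: from summand r by
  removing a letter left of b, and from summand r + 1 by removing one right of b. The two
  coefficients cancel.\<close>

lemma serre_coeff:
  assumes "r < n"
  shows "(-1) ^ r * q_binom Q n r * nn (c a a) (n - r) +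
    (-1) ^ Suc r * q_binom Q n (Suc r) * (q powi (- (int (n - Suc r) * c a a) - c a b) * nn (c a a) (Suc r)) = 0"
proof -
  have "- (int (n - Suc r) * c a a) - c a b = \<sigma> * (2 * int r + 1 - int n)"
    using assms by (simp add: caa cab of_nat_diff algebra_simps)
  then have "q powi (- (int (n - Suc r) * c a a) - c a b) = Q powi (2 * int r + 1 - int n)"
    by (simp only: Q_powi)
  then have "q powi (- (int (n - Suc r) * c a a) - c a b) * nn (c a a) (Suc r) =
      Q powi (2 * int r + 1 - int n + (1 - int (Suc r))) * q_int Q (Suc r)"
    by (simp only: nn_eq Q_add mult.assoc)
  also have "2 * int r + 1 - int n + (1 - int (Suc r)) = 1 - int (n - r)"
    using assms by (simp add: of_nat_diff)
  finally have "q_binom Q n (Suc r) * (q powi (- (int (n - Suc r) * c a a) - c a b) * nn (c a a) (Suc r)) =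
      Q powi (1 - int (n - r)) * (q_binom Q n r * q_int Q (n - r))"
    using q_binom_Suc[OF assms] by (simp add: mult.left_commute)
  then show ?thesis by (simp add: nn_eq mult.left_commute mult.assoc)
qed

text \<open>For a, neighbouring summands cancel by \<open>serre_coeff\<close>. For b, every summand
  becomes a multiple of a^n and the coefficients add up to
  \<open>q_binom_alternating_sum\<close>.\<close>

lemma serre_lder: "lder x (serre_el Q n (free_gen a) (free_gen b)) = 0"
proof (cases "x = a")
  case True
  define f where "f r = scl ((-1) ^ r * q_binom Q n r * nn (c a a) (n - r))
      (free_gen a ^ (n - Suc r) * free_gen b * free_gen a ^ r)" for r
  define g where "g r = scl ((-1) ^ r * q_binom Q n r * (q powi (- (int (n - r) * c a a) - c a b) * nn (c a a) r))
      (free_gen a ^ (n - r) * free_gen b * free_gen a ^ (r - 1))" for r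
  have "lder a (free_gen a ^ (n - r) * free_gen b * free_gen a ^ r) =
     scl (nn (c a a) (n - r)) (free_gen a ^ (n - Suc r) * free_gen b * free_gen a ^ r) +
     scl (q powi (- (int (n - r) * c a a) - c a b) * nn (c a a) r)
       (free_gen a ^ (n - r) * free_gen b * free_gen a ^ (r - 1))" for r
    using ab by (simp add: lder_mult tw_mult lder_power tw_power q_diff mult.assoc mult.commute mult.left_commute
        del: of_nat_diff)
  then have "lder a (serre_el Q n (free_gen a) (free_gen b)) = (\<Sum>r<Suc n. f r) + (\<Sum>r<Suc n. g r)"
    by (simp only: serre_el_def flin_sum[OF flin_ops(2)] op_linear FA.scale_right_distrib FA.scale_scale
        f_def g_def sum.distrib lessThan_Suc_atMost)
  also have "(\<Sum>r<Suc n. f r) = (\<Sum>r<n. f r)"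
    by (simp add: f_def nn_def)
  also have "(\<Sum>r<Suc n. g r) = (\<Sum>r<n. g (Suc r))"
    unfolding sum.lessThan_Suc_shift by (simp add: g_def nn_def)
  also have "(\<Sum>r<n. f r) + (\<Sum>r<n. g (Suc r)) = (\<Sum>r<n. f r + g (Suc r))"
    by (rule sum.distrib[symmetric])
  also have "\<dots> = (\<Sum>r<n. 0)"
  proof (rule sum.cong[OF refl])
    fix r assume "r \<in> {..<n}"
    then have "r < n" by simp
    from serre_coeff[OF this] show "f r + g (Suc r) = 0"
      by (simp only: f_def g_def diff_Suc_1 FA.scale_left_distrib[symmetric] FA.scale_zero_left)
  qed
  finally show ?thesis using True by simp
next
  case False
  show ?thesis
  proof (cases "x = b")
    case True
    have "lder b (free_gen a ^ (n - r) * free_gen b * free_gen a ^ r) =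
        scl (Q powi ((int n - 1) * (int n - int r))) (free_gen a ^ n)" if "r \<le> n" for r
    proof -
      have "- (int (n - r) * c b a) = \<sigma> * ((int n - 1) * (int n - int r))"
        using that by (simp add: c_sym[of b a] cab of_nat_diff algebra_simps)
      then have "q powi (- (int (n - r) * c b a)) = Q powi ((int n - 1) * (int n - int r))"
        by (simp only: Q_powi)
      then show ?thesis
        using ab that by (simp add: lder_mult lder_power tw_power of_nat_diff flip: power_add)
    qed
    then have "lder b (serre_el Q n (free_gen a) (free_gen b)) =
        (\<Sum>r\<le>n. scl ((-1) ^ r * q_binom Q n r * Q powi ((int n - 1) * (int n - int r))) (free_gen a ^ n))"
      by (simp add: serre_el_def flin_sum[OF flin_ops(2)])
    also have "\<dots> = 0"
      unfolding FA.scale_sum_left[symmetric] q_binom_alternating_sum[OF n] by simp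
    finally show ?thesis using True by simp
  next
    case xb: False
    then show ?thesis
      using False by (simp add: serre_el_def flin_sum[OF flin_ops(2)] lder_mult lder_power)
  qed
qed

lemma serre_rder: "rder x (serre_el Q n (free_gen a) (free_gen b)) = 0"
proof -
  have "revp (rder x (serre_el Q n (free_gen a) (free_gen b))) = 0"
    by (simp add: revp_rder serre_el_revp serre_lder)
  then show ?thesis by (metis op_linear(12) revp_revp)
qed

end

lemma serre_el_reduce:
  assumes "\<And>k. k > 0 \<Longrightarrow> Q ^ k \<noteq> 1" "Q \<noteq> 0"
  shows "serre_el Q n x y = x ^ n * y - (\<Sum>r=1..n. scl (- ((-1) ^ r * q_binom Q n r)) (x ^ (n - r) * y * x ^ r))"
proof -
  interpret not_root_of_unity Q using assms by unfold_locales
  have "{..n} = insert 0 {1..n}" by auto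
  then show ?thesis
    by (simp add: serre_el_def q_binom_0 sum_negf)
qed

end

section \<open>The generalized q-boson algebra\<close>

subsection \<open>Free algebras as rings\<close>

lemma carrier_free_algebra:
  fixes Y :: "'g set"
  shows "carrier (free_algebra Y :: ('g free_mon \<Rightarrow>\<^sub>0 'k::field) ring) = FA.span (word ` {w. set w \<subseteq> Y})"
proof
  show "carrier (free_algebra Y :: ('g free_mon \<Rightarrow>\<^sub>0 'k) ring) \<subseteq> FA.span (word ` {w. set w \<subseteq> Y})"
    by (auto simp: free_algebra_def intro!: in_span_words)
  show "FA.span (word ` {w. set w \<subseteq> Y}) \<subseteq> carrier (free_algebra Y :: ('g free_mon \<Rightarrow>\<^sub>0 'k) ring)"
  proof (rule FA.span_minimal)
    show "word ` {w. set w \<subseteq> Y} \<subseteq> carrier (free_algebra Y :: ('g free_mon \<Rightarrow>\<^sub>0 'k) ring)"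
      by (auto simp: free_algebra_def word_def)
    show "FA.subspace (carrier (free_algebra Y :: ('g free_mon \<Rightarrow>\<^sub>0 'k) ring))"
      unfolding FA.subspace_def
    proof (intro conjI ballI allI)
      fix x y :: "'g free_mon \<Rightarrow>\<^sub>0 'k"
      assume "x \<in> carrier (free_algebra Y)" "y \<in> carrier (free_algebra Y)"
      then show "x + y \<in> carrier (free_algebra Y)"
        using Poly_Mapping.keys_add[of x y] by (auto simp: free_algebra_def)
    next
      fix x :: "'g free_mon \<Rightarrow>\<^sub>0 'k" and d
      assume "x \<in> carrier (free_algebra Y)"
      moreover have "Poly_Mapping.keys (scl d x) \<subseteq> Poly_Mapping.keys x" by (auto simp: in_keys_iff)
      ultimately show "scl d x \<in> carrier (free_algebra Y)" by (auto simp: free_algebra_def)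
    qed (simp add: free_algebra_def)
  qed
qed

lemma subspace_free_algebra: "FA.subspace (carrier (free_algebra Y))"
  by (simp add: carrier_free_algebra)

lemma word_free_algebra: "set w \<subseteq> Y \<Longrightarrow> word w \<in> carrier (free_algebra Y)"
  by (auto simp: carrier_free_algebra intro: FA.span_base)

lemma one_free_algebra: "1 \<in> carrier (free_algebra Y)"
  using word_free_algebra[of "[]"] by (simp add: word_Nil)

lemma gen_free_algebra: "y \<in> Y \<Longrightarrow> free_gen y \<in> carrier (free_algebra Y)"
  by (simp add: free_gen_word word_free_algebra)

lemma free_scal_eq: "free_scal c = scl c 1"
  by (simp add: scl_def)

lemma free_scal_free_algebra: "free_scal c \<in> carrier (free_algebra Y)"
  by (simp add: free_scal_eq FA.subspace_scale[OF subspace_free_algebra] one_free_algebra)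

lemma mult_free_algebra:
  assumes "x \<in> carrier (free_algebra Y)" "y \<in> carrier (free_algebra Y)"
  shows "x * y \<in> carrier (free_algebra Y)"
proof -
  have "word w * y \<in> carrier (free_algebra Y)" if "set w \<subseteq> Y" for w
    by (rule flin_in_subspace[OF _ _ _ assms(2)[unfolded carrier_free_algebra]])
      (use that in \<open>auto simp: flin_intros subspace_free_algebra word_free_algebra simp flip: word_append\<close>)
  then show ?thesis
    by (intro flin_in_subspace[where f="\<lambda>x. x * y", OF _ _ _ assms(1)[unfolded carrier_free_algebra]])
      (auto simp: flin_intros subspace_free_algebra)
qed

lemma free_algebra_simps [simp]: "x \<otimes>\<^bsub>free_algebra Y\<^esub> y = x * y" "x \<oplus>\<^bsub>free_algebra Y\<^esub> y = x + y"
  "\<one>\<^bsub>free_algebra Y\<^esub> = 1" "\<zero>\<^bsub>free_algebra Y\<^esub> = 0"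
  by (simp_all add: free_algebra_def)

lemma ring_free_algebra: "ring (free_algebra Y)"
proof (rule ringI)
  show "abelian_group (free_algebra Y)"
  proof (rule abelian_groupI)
    fix x assume "x \<in> carrier (free_algebra Y)"
    then show "\<exists>y\<in>carrier (free_algebra Y). y \<oplus>\<^bsub>free_algebra Y\<^esub> x = \<zero>\<^bsub>free_algebra Y\<^esub>"
      by (intro bexI[of _ "- x"]) (simp_all add: FA.subspace_neg[OF subspace_free_algebra])
  qed (simp_all add: FA.subspace_add[OF subspace_free_algebra] FA.subspace_0[OF subspace_free_algebra] algebra_simps)
  show "Group.monoid (free_algebra Y)"
    by (rule Group.monoidI) (simp_all add: mult_free_algebra one_free_algebra mult.assoc)
qed (simp_all add: algebra_simps)

lemma a_minus_free_algebra:
  assumes "x \<in> carrier (free_algebra Y)" "y \<in> carrier (free_algebra Y)"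
  shows "x \<ominus>\<^bsub>free_algebra Y\<^esub> y = x - y"
proof -
  interpret ring "free_algebra Y :: ('a free_mon \<Rightarrow>\<^sub>0 'b) ring" by (rule ring_free_algebra)
  have "\<ominus>\<^bsub>free_algebra Y\<^esub> y = - y"
    by (rule minus_equality) (simp_all add: assms FA.subspace_neg[OF subspace_free_algebra])
  then show ?thesis by (simp add: a_minus_def)
qed

subsection \<open>The Serre ideal in the letters \<open>f'\<close>\<close>

locale boson_data = charged_borcherds_cartan I a s m
  for I :: "'i set" and a :: "'i \<Rightarrow> 'i \<Rightarrow> int" and s :: "'i \<Rightarrow> nat" and m :: "'i \<Rightarrow> nat" +
  fixes q :: "'k::field_char_0"
  assumes q_nonzero: "q \<noteq> 0" and q_transcendental: "\<not> algebraic q"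
begin

abbreviation "X \<equiv> boson_index I m"

lemma X_iff: "(i, k) \<in> X \<longleftrightarrow> i \<in> I \<and> 1 \<le> k \<and> k \<le> m i"
  by (auto simp: boson_index_def)

text \<open>Letters outside the index set are made to commute with everything.\<close>

definition cc :: "'i \<times> nat \<Rightarrow> 'i \<times> nat \<Rightarrow> int" where
  "cc x y = (if x \<in> X \<and> y \<in> X then int (s (fst x)) * a (fst x) (fst y) else 0)"

definition serre_gens :: "(('i \<times> nat) free_mon \<Rightarrow>\<^sub>0 'k) set" where
  "serre_gens =
    {serre_el (q ^ s i) (nat (1 - a i j)) (free_gen (i, k)) (free_gen (j, l))
      | i k j l. (i, k) \<in> X \<and> (j, l) \<in> X \<and> a i i = 2 \<and> i \<noteq> j} \<union>
    {free_gen x * free_gen y - free_gen y * free_gen x | x y. cc x y = 0}"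

lemma q_pow: assumes "0 < n" shows "q ^ n \<noteq> 1"
proof
  assume "q ^ n = 1"
  have "algebraic q"
    unfolding algebraic_def
  proof (intro exI[of _ "Polynomial.monom 1 n - 1"] conjI allI)
    show "poly.coeff (Polynomial.monom 1 n - 1) j \<in> (\<int> :: 'k set)" for j
      by (auto simp: coeff_1)
    show "Polynomial.monom 1 n - 1 \<noteq> (0 :: 'k Polynomial.poly)"
    proof
      assume "Polynomial.monom 1 n - 1 = (0 :: 'k Polynomial.poly)"
      then have "poly.coeff (Polynomial.monom 1 n - 1 :: 'k Polynomial.poly) n = 0" by simp
      then show False using assms by (simp add: coeff_1)
    qed
    show "Polynomial.poly (Polynomial.monom 1 n - 1) q = 0"
      by (simp add: poly_monom \<open>q ^ n = 1\<close>)
  qed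
  then show False using q_transcendental by simp
qed

lemma q_powi: assumes "n \<noteq> 0" shows "q powi n \<noteq> 1"
proof (cases "0 \<le> n")
  case True
  then show ?thesis using q_pow[of "nat n"] assms by (simp add: power_int_def)
next
  case False
  then have "inverse (q ^ nat (- n)) \<noteq> 1" using q_pow[of "nat (- n)"] by (metis inverse_1 inverse_inverse_eq zero_less_nat_eq neg_0_less_iff_less not_le)
  then show ?thesis using False by (simp add: power_int_def power_inverse)
qed

lemma cc_sym: "cc x y = cc y x"
  using symmetrizable[of "fst x" "fst y"] by (cases x; cases y) (auto simp: cc_def X_iff)

sublocale qwords q cc
  by unfold_locales (simp_all add: q_nonzero cc_sym)

text \<open>Brings the Serre generators into the parameters of the derivation lemmas, with \<sigma>
  = s_i.\<close>

lemma serre_gens_cases: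
  assumes "g \<in> serre_gens"
  obtains (serre) x y n \<sigma> where "g = serre_el (q powi \<sigma>) n (free_gen x) (free_gen y)" "x \<noteq> y" "0 < n"
      "cc x x = 2 * \<sigma>" "cc x y = \<sigma> * (1 - int n)" "0 < \<sigma>"
    | (comm) x y where "g = free_gen x * free_gen y - free_gen y * free_gen x" "cc x y = 0"
  using assms unfolding serre_gens_def
proof (elim UnE CollectE exE conjE)
  fix i k j l
  assume g: "g = serre_el (q ^ s i) (nat (1 - a i j)) (free_gen (i, k)) (free_gen (j, l))"
    and *: "(i, k) \<in> X" "(j, l) \<in> X" "a i i = 2" "i \<noteq> j"
  then have "a i j \<le> 0" "0 < s i" using off_diag s_pos by (auto simp: X_iff)
  then show thesis
    using * g by (intro serre[of "int (s i)" "nat (1 - a i j)" "(i, k)" "(j, l)"]) (auto simp: cc_def)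
qed (use comm in blast)

lemma q_powi_pow: "0 < \<sigma> \<Longrightarrow> 0 < k \<Longrightarrow> (q powi \<sigma>) ^ k \<noteq> 1"
  using q_powi[of "\<sigma> * int k"] by (simp add: power_int_mult)

sublocale qgens q cc serre_gens
proof
  fix g x assume g: "g \<in> serre_gens"
  show "lder x g = 0"
    using g
  proof (cases rule: serre_gens_cases)
    case (serre x' y n \<sigma>)
    then show ?thesis using serre_lder[of x' y n "q powi \<sigma>" \<sigma> x] q_powi_pow by blast
  next
    case (comm x' y)
    then show ?thesis using c_sym[of y x'] by (auto simp: ldr_gen_mult)
  qed
  show "rder x g = 0"
    using g
  proof (cases rule: serre_gens_cases)
    case (serre x' y n \<sigma>)
    then show ?thesis using serre_rder[of x' y n "q powi \<sigma>" \<sigma> x] q_powi_pow by blast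
  next
    case (comm x' y)
    then show ?thesis using c_sym[of y x'] by (auto simp: rdr_gen_mult)
  qed
  show "frm [] g = 0"
    using g
  proof (cases rule: serre_gens_cases)
    case (serre x' y n \<sigma>)
    then show ?thesis using frm_Nil_outside[OF _ serre_el_hom_part[of "q powi \<sigma>" n x' y]] by simp
  next
    case (comm x' y)
    then show ?thesis by (simp add: frm_diff frm_Nil_gen_mult)
  qed
  show "\<exists>t. tw x g = scl t g"
    using g
  proof (cases rule: serre_gens_cases)
    case (serre x' y n \<sigma>)
    then show ?thesis using tws_hom_part[OF serre_el_hom_part[of "q powi \<sigma>" n x' y]] by blast
  next
    case (comm x' y)
    then have "tw x g = scl (q powi (- cc x x') * q powi (- cc x y)) g"
      by (simp add: tw_mult FA.scale_right_diff_distrib mult.commute)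
    then show ?thesis by blast
  qed
qed

sublocale qserre q cc serre_gens
proof
  show "n \<noteq> 0 \<Longrightarrow> q powi n \<noteq> 1" for n by (rule q_powi)
  show "cc x y \<le> 0" if "cc x x \<le> 0" for x y
  proof (cases "x \<in> X \<and> y \<in> X")
    case True
    then have I: "fst x \<in> I" "fst y \<in> I" by (auto simp: boson_index_def)
    have "a (fst x) (fst x) \<le> 0"
      using that True s_pos[OF I(1)] by (simp add: cc_def mult_le_0_iff)
    then have "a (fst x) (fst y) \<le> 0" using off_diag[OF I] by (cases "fst x = fst y") auto
    then show ?thesis using True by (simp add: cc_def mult_nonneg_nonpos)
  qed (auto simp: cc_def)
  show comm: "free_gen x * free_gen y - free_gen y * free_gen x \<in> SS" if "cc x y = 0" for x y
    by (rule gens_SS) (use that in \<open>unfold serre_gens_def, blast\<close>)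
  show "\<exists>n f. free_gen x ^ n * free_gen y -
      (\<Sum>r=1..n. scl (f r) (free_gen x ^ (n - r) * free_gen y * free_gen x ^ r)) \<in> SS"
    if "0 < cc x x" "x \<noteq> y" for x y
  proof (cases "y \<in> X")
    case True
    obtain i k j l where xy: "x = (i, k)" "y = (j, l)" by fastforce
    have X: "(i, k) \<in> X" "(j, l) \<in> X" "0 < a i i"
      using that(1) True by (auto simp: cc_def xy zero_less_mult_iff split: if_splits)
    then have aii: "a i i = 2" using diag[of i] by (auto simp: X_iff)
    \<comment> \<open>A real index carries a single letter because its charge is 1, so distinct
      letters have distinct indices and a Serre relation is available.\<close>
    have "i \<noteq> j"
      using X m_real[OF _ aii] that(2) by (auto simp: xy X_iff)
    then have "serre_el (q ^ s i) (nat (1 - a i j)) (free_gen x) (free_gen y) \<in> SS"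
      using X aii by (intro gens_SS) (auto simp: serre_gens_def xy)
    moreover have "(q ^ s i) ^ k \<noteq> 1" if "0 < k" for k
      using q_pow[of "s i * k"] s_pos[of i] X that by (simp add: X_iff flip: power_mult)
    ultimately show ?thesis
      using serre_el_reduce[of "q ^ s i" "nat (1 - a i j)" "free_gen x" "free_gen y"] q_nonzero
      by (intro exI[of _ "nat (1 - a i j)"] exI[of _ "\<lambda>r. - ((-1) ^ r * q_binom (q ^ s i) (nat (1 - a i j)) r)"]) auto
  next
    case False
    \<comment> \<open>A letter outside the index set commutes with x, which is a Serre relation with
      n = 1 and coefficient 1.\<close>
    then have "cc x y = 0" by (simp add: cc_def)
    from comm[OF this] show ?thesis
      by (intro exI[of _ 1] exI[of _ "\<lambda>_. 1"]) simp
  qed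
qed

end

lemma linext_mult:
  assumes "\<And>u v. T (u @ v) = T u * T v"
  shows "linext T (x * y) = linext T x * linext T y"
  by (rule flin_ext2[where f="\<lambda>x y. linext T (x * y)"]) (simp_all add: flin_intros assms flip: word_append)

lemma serre_el_map:
  assumes "flin h" "\<And>x y. h (x * y) = h x * h y" "h 1 = 1"
  shows "h (serre_el Q n x y) = serre_el Q n (h x) (h y)"
proof -
  have "h (z ^ n) = h z ^ n" for z n by (induction n) (simp_all add: assms(2,3))
  then show ?thesis
    by (simp add: serre_el_def flin_sum[OF assms(1)] flin_scl[OF assms(1)] assms(2))
qed

lemma serre_eq_serre_el: "serre a s q i j x y = serre_el (q ^ s i) (nat (1 - a i j)) x y"
  by (simp add: serre_def Let_def serre_el_def scl_def mult.assoc atMost_atLeast0)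

section \<open>The boson algebra acting on words modulo the Serre ideal\<close>

context boson_data
begin

abbreviation "A \<equiv> free_boson I m :: ('i, 'k) free_boson ring"
abbreviation "B \<equiv> boson_alg I a s m q"
abbreviation "ID \<equiv> boson_ideal I a s m q"
abbreviation "RS \<equiv> boson_R I a s m q"
abbreviation "scal \<equiv> boson_scal I a s m q"
abbreviation "be \<equiv> boson_e I a s m q"
abbreviation "bf \<equiv> boson_f I a s m q"

definition phiF :: "(('i \<times> nat) free_mon \<Rightarrow>\<^sub>0 'k) \<Rightarrow> ('i, 'k) free_boson" where
  "phiF = linext (\<lambda>w. word (map (\<lambda>(i, k). GenF i k) w))"

definition phiE :: "(('i \<times> nat) free_mon \<Rightarrow>\<^sub>0 'k) \<Rightarrow> ('i, 'k) free_boson" where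
  "phiE = linext (\<lambda>w. word (map (\<lambda>(i, k). GenE i k) w))"

definition proj :: "(('i \<times> nat) free_mon \<Rightarrow>\<^sub>0 'k) \<Rightarrow> (('i \<times> nat) free_mon \<Rightarrow>\<^sub>0 'k)" where
  "proj = linext (\<lambda>w. if set w \<subseteq> X then word w else 0)"

text \<open>The derivations live on words over the whole type of letters. \<open>proj\<close> kills
  the words with a letter outside the index set, so that the image lies in the carrier of the free
  algebra defining \<B>.\<close>

definition phi :: "(('i \<times> nat) free_mon \<Rightarrow>\<^sub>0 'k) \<Rightarrow> ('i, 'k) free_boson" where
  "phi p = phiF (proj p)"

lemma flin_phi [simp]: "flin phiF" "flin phiE" "flin proj" "flin phi"
  by (simp_all add: phiF_def phiE_def proj_def phi_def[abs_def] flin_linext flin_compose)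

lemmas phi_linear [simp] =
  flin_add[OF flin_phi(3)] flin_scl[OF flin_phi(3)] flin_0[OF flin_phi(3)] flin_diff[OF flin_phi(3)]
  flin_add[OF flin_phi(4)] flin_scl[OF flin_phi(4)] flin_0[OF flin_phi(4)] flin_diff[OF flin_phi(4)]

lemma phiF_mult: "phiF (x * y) = phiF x * phiF y" and phiE_mult: "phiE (x * y) = phiE x * phiE y"
  and proj_mult: "proj (x * y) = proj x * proj y"
  unfolding phiF_def phiE_def proj_def by (rule linext_mult; simp add: word_append)+

lemma phi_mult: "phi (x * y) = phi x * phi y"
  by (simp add: phi_def proj_mult phiF_mult)

lemma phi_one [simp]: "phiF 1 = 1" "phiE 1 = 1" "proj 1 = 1" "phi 1 = 1"
  by (simp_all add: phiF_def phiE_def proj_def phi_def word_Nil)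

lemma phi_gen [simp]: "phiF (free_gen (i, k)) = free_gen (GenF i k)"
  "phiE (free_gen (i, k)) = free_gen (GenE i k)"
  "proj (free_gen x) = (if x \<in> X then free_gen x else 0)"
  by (simp_all add: phiF_def phiE_def proj_def free_gen_word)

lemma proj_word: "proj (word w) = (if set w \<subseteq> X then word w else 0)"
  by (simp add: proj_def)

lemma proj_proj [simp]: "proj (proj p) = proj p"
  by (rule flin_ext[where f="\<lambda>p. proj (proj p)"])
    (auto simp: flin_compose proj_word flin_0)

lemma phi_proj [simp]: "phi (proj p) = phi p"
  by (simp add: phi_def)

fun actl :: "'i boson_gen \<Rightarrow> (('i \<times> nat) free_mon \<Rightarrow>\<^sub>0 'k) \<Rightarrow> (('i \<times> nat) free_mon \<Rightarrow>\<^sub>0 'k)" where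
  "actl (GenE i k) p = lder (i, k) p"
| "actl (GenF i k) p = free_gen (i, k) * p"

lemma flin_actl: "flin (actl g)"
  by (cases g) (auto simp: flin_iff algebra_simps)

text \<open>The action of \<B> on R, lifted to free algebras on both sides. It respects the defining
  relations only modulo \<open>SS\<close>.\<close>

definition rho :: "('i, 'k) free_boson \<Rightarrow> (('i \<times> nat) free_mon \<Rightarrow>\<^sub>0 'k) \<Rightarrow> (('i \<times> nat) free_mon \<Rightarrow>\<^sub>0 'k)" where
  "rho b p = linext (\<lambda>w. foldr actl w p) b"

lemma flin_rho1: "flin (\<lambda>b. rho b p)"
  by (simp add: rho_def flin_intros)

lemma rho_word [simp]: "rho (word w) p = foldr actl w p"
  by (simp add: rho_def)

lemma flin_foldr_actl: "flin (foldr actl w)"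
  by (induction w) (auto simp: flin_id id_def comp_def flin_actl intro: flin_compose)

lemma flin_rho2: "flin (rho b)"
  by (rule flinI) (simp_all add: rho_def linext_def flin_add[OF flin_foldr_actl] flin_scl[OF flin_foldr_actl]
      FA.scale_right_distrib sum.distrib FA.scale_sum_right mult.commute)

lemma rho_one [simp]: "rho 1 p = p"
  using rho_word[of "[]" p] by (simp add: word_Nil)

lemma rho_gen [simp]: "rho (free_gen g) p = actl g p"
  by (simp add: free_gen_word)

lemma rho_mult: "rho (b * b') p = rho b (rho b' p)"
  by (rule flin_ext2[where f="\<lambda>b b'. rho (b * b') p"])
    (simp_all add: flin_intros flin_rho1 flin_rho2 flin_compose[OF flin_rho1] flin_compose[OF flin_rho2]
      flip: word_append)

lemma rho_scal [simp]: "rho (free_scal t) p = scl t p"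
  by (simp add: free_scal_eq flin_scl[OF flin_rho1])

lemma rho_SS:
  assumes "p \<in> SS" shows "rho b p \<in> SS"
proof -
  have actl: "actl g p \<in> SS" if "p \<in> SS" for g p
    using that by (cases g) (auto simp: SS_lder SS_mult_left)
  have word: "foldr actl w p \<in> SS" for w
    by (induction w) (auto simp: assms actl)
  show ?thesis
    by (rule flin_in_subspace[where f="\<lambda>b. rho b p" and B="range word"])
      (auto simp: flin_rho1 subspace_SS span_words word)
qed

lemma rho_phiE: "rho (phiE y) p = opx lder y p"
proof (rule flin_ext[where f="\<lambda>y. rho (phiE y) p"])
  show "rho (phiE (word w)) p = opx lder (word w) p" for w
    by (induction w) (auto simp: phiE_def)
qed (simp_all add: flin_opx1 flin_compose[OF flin_rho1])

lemma rho_phiF: "rho (phiF y) p = y * p"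
proof (rule flin_ext[where f="\<lambda>y. rho (phiF y) p"])
  have "foldr actl (map (\<lambda>(i, k). GenF i k) w) p = word w * p" for w
    by (induction w) (auto simp: word_Nil word_Cons mult.assoc)
  then show "rho (phiF (word w)) p = word w * p" for w
    by (simp add: phiF_def)
qed (simp_all add: flin_intros flin_compose[OF flin_rho1])

lemma rho_phi: "rho (phi y) p = proj y * p"
  by (simp add: phi_def rho_phiF)

subsection \<open>The defining ideal\<close>

lemma A_eq: "A = free_algebra ((\<lambda>(i, k). GenE i k) ` X \<union> (\<lambda>(i, k). GenF i k) ` X)"
  by (simp add: free_boson_def)

lemma gen_A: "(i, k) \<in> X \<Longrightarrow> free_gen (GenE i k) \<in> carrier A" "(i, k) \<in> X \<Longrightarrow> free_gen (GenF i k) \<in> carrier A"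
  unfolding A_eq by (rule gen_free_algebra; force)+

lemma A_closed: "x \<in> carrier A \<Longrightarrow> y \<in> carrier A \<Longrightarrow> x * y \<in> carrier A"
  "x \<in> carrier A \<Longrightarrow> y \<in> carrier A \<Longrightarrow> x + y \<in> carrier A"
  "x \<in> carrier A \<Longrightarrow> y \<in> carrier A \<Longrightarrow> x - y \<in> carrier A"
  "x \<in> carrier A \<Longrightarrow> scl t x \<in> carrier A" "1 \<in> carrier A" "0 \<in> carrier A" "free_scal t \<in> carrier A"
  unfolding A_eq by (simp_all add: mult_free_algebra one_free_algebra free_scal_free_algebra
      FA.subspace_add[OF subspace_free_algebra] FA.subspace_diff[OF subspace_free_algebra]
      FA.subspace_scale[OF subspace_free_algebra] FA.subspace_0[OF subspace_free_algebra])

lemma A_simps [simp]: "x \<otimes>\<^bsub>A\<^esub> y = x * y" "x \<oplus>\<^bsub>A\<^esub> y = x + y" "\<one>\<^bsub>A\<^esub> = 1" "\<zero>\<^bsub>A\<^esub> = 0"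
  unfolding A_eq by simp_all

lemma ring_A: "ring A"
  unfolding A_eq by (rule ring_free_algebra)

lemma A_minus: "x \<in> carrier A \<Longrightarrow> y \<in> carrier A \<Longrightarrow> x \<ominus>\<^bsub>A\<^esub> y = x - y"
  unfolding A_eq by (rule a_minus_free_algebra)

lemma power_A: "x \<in> carrier A \<Longrightarrow> x ^ n \<in> carrier A"
  by (induction n) (simp_all add: A_closed)

lemma subspace_A: "FA.subspace (carrier A)"
  unfolding A_eq by (rule subspace_free_algebra)

lemma serre_el_A: "x \<in> carrier A \<Longrightarrow> y \<in> carrier A \<Longrightarrow> serre_el Q n x y \<in> carrier A"
  unfolding serre_el_def
  by (intro FA.subspace_sum[OF subspace_A] FA.subspace_scale[OF subspace_A] A_closed(1) power_A)

lemma cc_eq: "(i, k) \<in> X \<Longrightarrow> (j, l) \<in> X \<Longrightarrow> cc (i, k) (j, l) = int (s i) * a i j"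
  by (simp add: cc_def)

lemma serre_gens_I:
  "(i, k) \<in> X \<Longrightarrow> (j, l) \<in> X \<Longrightarrow> a i i = 2 \<Longrightarrow> i \<noteq> j \<Longrightarrow>
    serre_el (q ^ s i) (nat (1 - a i j)) (free_gen (i, k)) (free_gen (j, l)) \<in> serre_gens"
  "cc x y = 0 \<Longrightarrow> free_gen x * free_gen y - free_gen y * free_gen x \<in> serre_gens"
  unfolding serre_gens_def by blast+

lemma boson_rels_cases:
  assumes "g \<in> boson_rels I a s m q"
  obtains (E) y where "y \<in> serre_gens" "g = phiE y"
    | (F) y where "y \<in> serre_gens" "g = phiF y"
    | (EF) i k j l where "(i, k) \<in> X" "(j, l) \<in> X" "g = free_gen (GenE i k) * free_gen (GenF j l)
        - free_scal (q_pair a s q i j) * free_gen (GenF j l) * free_gen (GenE i k)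
        - (if i = j \<and> k = l then 1 else 0)"
  using assms unfolding boson_rels_def
proof (elim UnE CollectE exE conjE)
  fix i k j l
  assume *: "(i, k) \<in> X" "(j, l) \<in> X" "a i i = 2" "i \<noteq> j"
    and g: "g = serre a s q i j (free_gen (GenE i k)) (free_gen (GenE j l))"
  show thesis
    by (rule E[OF serre_gens_I(1)[OF *]]) (simp add: g serre_eq_serre_el serre_el_map phiE_mult)
next
  fix i k j l
  assume *: "(i, k) \<in> X" "(j, l) \<in> X" "a i i = 2" "i \<noteq> j"
    and g: "g = serre a s q i j (free_gen (GenF i k)) (free_gen (GenF j l))"
  show thesis
    by (rule F[OF serre_gens_I(1)[OF *]]) (simp add: g serre_eq_serre_el serre_el_map phiF_mult)
next
  fix i k j l
  assume *: "(i, k) \<in> X" "(j, l) \<in> X" "a i j = 0"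
    and g: "g = free_gen (GenE i k) * free_gen (GenE j l) - free_gen (GenE j l) * free_gen (GenE i k)"
  have "cc (i, k) (j, l) = 0" using * by (simp add: cc_eq)
  then show thesis
    by (rule E[OF serre_gens_I(2)]) (simp add: g flin_diff phiE_mult)
next
  fix i k j l
  assume *: "(i, k) \<in> X" "(j, l) \<in> X" "a i j = 0"
    and g: "g = free_gen (GenF i k) * free_gen (GenF j l) - free_gen (GenF j l) * free_gen (GenF i k)"
  have "cc (i, k) (j, l) = 0" using * by (simp add: cc_eq)
  then show thesis
    by (rule F[OF serre_gens_I(2)]) (simp add: g flin_diff phiF_mult)
qed (use EF in blast)

text \<open>A Serre relation among the e acts by zero since its generator is in the radical
  (\<open>rad_opx_lder\<close>); one among the f' multiplies into \<open>SS\<close>; the mixed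
  relation is the recursion of \<open>lder\<close>.\<close>

lemma rho_rels: "g \<in> boson_rels I a s m q \<Longrightarrow> rho g p \<in> SS"
proof (elim boson_rels_cases)
  fix i k j l assume *: "(i, k) \<in> X" "(j, l) \<in> X" "g = free_gen (GenE i k) * free_gen (GenF j l)
        - free_scal (q_pair a s q i j) * free_gen (GenF j l) * free_gen (GenE i k)
        - (if i = j \<and> k = l then 1 else 0)"
  have "rho g p = lder (i, k) (free_gen (j, l) * p) - scl (q_pair a s q i j) (free_gen (j, l) * lder (i, k) p)
      - (if i = j \<and> k = l then p else 0)"
    by (simp add: *(3) flin_diff[OF flin_rho1] rho_mult flin_0[OF flin_rho1])
  also have "\<dots> = 0"
    using *(1,2) by (simp add: ldr_gen_mult q_pair_def cc_eq)
  finally show ?thesis by simp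
qed (auto simp: rho_phiE rho_phiF rad_opx_lder gens_rad intro: SS_mult_right gens_SS)

lemma boson_rels_A: "boson_rels I a s m q \<subseteq> carrier A"
  unfolding boson_rels_def
  by (auto simp: serre_eq_serre_el intro!: serre_el_A gen_A A_closed(1-3,5-7))

lemma ideal_ID: "ideal ID A"
  unfolding boson_ideal_def by (rule ring.genideal_ideal[OF ring_A boson_rels_A])

lemma rels_ID: "boson_rels I a s m q \<subseteq> ID"
  unfolding boson_ideal_def by (rule ring.genideal_self[OF ring_A boson_rels_A])

lemma ID_closed: "x \<in> ID \<Longrightarrow> y \<in> ID \<Longrightarrow> x + y \<in> ID" "x \<in> ID \<Longrightarrow> z \<in> carrier A \<Longrightarrow> z * x \<in> ID"
  "x \<in> ID \<Longrightarrow> z \<in> carrier A \<Longrightarrow> x * z \<in> ID" "0 \<in> ID"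
  using additive_subgroup.a_closed[OF ideal.axioms(1)[OF ideal_ID], of x y]
    ideal.I_l_closed[OF ideal_ID, of x z] ideal.I_r_closed[OF ideal_ID, of x z]
    additive_subgroup.zero_closed[OF ideal.axioms(1)[OF ideal_ID]]
  by simp_all

lemma subspace_ID: "FA.subspace ID"
  unfolding FA.subspace_def scl_def using ID_closed A_closed(7) by blast

text \<open>The elements sending everything into \<open>SS\<close> form a two-sided ideal, because
  \<open>SS\<close> is stable under \<open>rho\<close>, and this ideal contains the
  relations.\<close>

lemma rho_ID:
  assumes "b \<in> ID" shows "rho b p \<in> SS"
proof -
  let ?K = "{b \<in> carrier A. \<forall>p. rho b p \<in> SS}"
  have "ideal ?K A"
  proof (rule idealI[OF ring_A])
    interpret ring A by (rule ring_A)
    show "subgroup ?K (add_monoid A)"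
    proof (rule add.subgroupI)
      show "?K \<noteq> {}" using A_closed(6) flin_0[OF flin_rho1] by force
      fix x assume x: "x \<in> ?K"
      have "\<ominus>\<^bsub>A\<^esub> x = - x"
        using A_minus[OF A_closed(6), of x] x a_minus_def[of A 0 x] a_inv_closed[of x] by simp
      moreover have "- x \<in> carrier A" using A_closed(3)[OF A_closed(6), of x] x by simp
      moreover have "rho (- x) p \<in> SS" for p
        using x FA.subspace_neg[OF subspace_SS] by (simp add: flin_uminus[OF flin_rho1])
      ultimately show "\<ominus>\<^bsub>A\<^esub> x \<in> ?K" by simp
    qed (auto simp: A_closed flin_add[OF flin_rho1] SS_add)
  qed (auto simp: A_closed rho_mult rho_SS)
  moreover have "boson_rels I a s m q \<subseteq> ?K" using boson_rels_A rho_rels by blast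
  ultimately have "ID \<subseteq> ?K"
    unfolding boson_ideal_def by (rule ring.genideal_minimal[OF ring_A])
  then show ?thesis using assms by blast
qed

lemma phi_word: "phi (word w) = (if set w \<subseteq> X then word (map (\<lambda>(i, k). GenF i k) w) else 0)"
  by (simp add: phi_def proj_word flin_0) (simp add: phiF_def)

lemma phi_A: "phi p \<in> carrier A"
proof (rule flin_in_subspace[where f=phi and B="range word"])
  fix x :: "('i \<times> nat) free_mon \<Rightarrow>\<^sub>0 'k" assume "x \<in> range word"
  then obtain w where "x = word w" by blast
  then show "phi x \<in> carrier A"
    unfolding A_eq by (simp only: phi_word split: if_splits)
      (intro conjI impI word_free_algebra FA.subspace_0[OF subspace_free_algebra], simp only: set_map, blast)
qed (auto simp: subspace_A span_words)

lemma phi_serre_gens: "g \<in> serre_gens \<Longrightarrow> phi g \<in> ID"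
  unfolding serre_gens_def
proof (elim UnE CollectE exE conjE)
  fix i k j l
  assume *: "(i, k) \<in> X" "(j, l) \<in> X" "a i i = 2" "i \<noteq> j"
    and g: "g = serre_el (q ^ s i) (nat (1 - a i j)) (free_gen (i, k)) (free_gen (j, l))"
  have "phi g = serre a s q i j (free_gen (GenF i k)) (free_gen (GenF j l))"
    using * by (simp add: g serre_eq_serre_el serre_el_map phi_mult) (simp add: phi_def)
  moreover have "\<dots> \<in> boson_rels I a s m q"
    unfolding boson_rels_def using * by blast
  ultimately show ?thesis using rels_ID by auto
next
  fix x y assume xy: "cc x y = 0" and g: "g = free_gen x * free_gen y - free_gen y * free_gen x"
  show ?thesis
  proof (cases "x \<in> X \<and> y \<in> X")
    case True
    obtain i k j l where xy': "x = (i, k)" "y = (j, l)" by fastforce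
    have "a i j = 0"
      using xy True s_pos[of i] by (auto simp: xy' cc_def X_iff)
    have "phi g = free_gen (GenF i k) * free_gen (GenF j l) - free_gen (GenF j l) * free_gen (GenF i k)"
      using True by (simp add: g phi_mult flin_diff) (simp add: phi_def xy')
    moreover have "\<dots> \<in> boson_rels I a s m q"
      unfolding boson_rels_def using True \<open>a i j = 0\<close> xy' by blast
    ultimately show ?thesis using rels_ID by auto
  next
    case False
    then have "phi (free_gen x) = 0 \<or> phi (free_gen y) = 0"
      by (auto simp: phi_def flin_0)
    then show ?thesis using ID_closed(4) by (auto simp: g phi_mult flin_diff)
  qed
qed

lemma phi_SS: "p \<in> SS \<Longrightarrow> phi p \<in> ID"
  by (rule SS_flin[where f=phi])
    (simp_all add: subspace_ID phi_mult ID_closed(2) ID_closed(3)[OF ID_closed(2)] phi_A phi_serre_gens)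

text \<open>The relations of \<B> cause no collapse in R beyond the Serre relations: letting an
  element of the ideal act on 1 recovers it modulo \<open>SS\<close>.\<close>

lemma phi_ID_iff: "phi p \<in> ID \<longleftrightarrow> proj p \<in> SS"
proof
  assume "phi p \<in> ID"
  from rho_ID[OF this, of 1] show "proj p \<in> SS" by (simp add: rho_phi)
next
  assume "proj p \<in> SS"
  from phi_SS[OF this] show "phi p \<in> ID" by simp
qed

lemma proj_lder: "x \<in> X \<Longrightarrow> proj (lder x p) = lder x (proj p)"
proof (rule flin_ext[where f="\<lambda>p. proj (lder x p)"])
  assume x: "x \<in> X"
  show "proj (lder x (word w)) = lder x (proj (word w))" for w
  proof (induction w)
    case (Cons y w)
    show ?case
      using x Cons by (auto simp: word_Cons proj_mult ldr_gen_mult flin_add flin_scl)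
  qed (simp add: word_Nil flin_0)
qed (simp_all add: flin_compose)

lemma proj_rho: "b \<in> carrier A \<Longrightarrow> proj (rho b p) = rho b (proj p)"
proof (rule flin_eq_on_span[where f="\<lambda>b. proj (rho b p)" and g="\<lambda>b. rho b (proj p)"
      and W="{w. set w \<subseteq> (\<lambda>(i, k). GenE i k) ` X \<union> (\<lambda>(i, k). GenF i k) ` X}"])
  let ?Y = "(\<lambda>(i, k). GenE i k) ` X \<union> (\<lambda>(i, k). GenF i k) ` X"
  show "proj (rho (word w) p) = rho (word w) (proj p)" if "w \<in> {w. set w \<subseteq> ?Y}" for w
    using that by (induction w) (auto simp: proj_lder proj_mult)
  show "b \<in> carrier A \<Longrightarrow> b \<in> FA.span (word ` {w. set w \<subseteq> ?Y})"
    unfolding A_eq carrier_free_algebra .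
qed (simp_all add: flin_rho1 flin_compose[OF _ flin_rho1])

end

context boson_data
begin

subsection \<open>The subalgebra \<open>R\<close> and its module structure\<close>

definition cl :: "('i, 'k) free_boson \<Rightarrow> ('i, 'k) boson" where
  "cl b = ID +>\<^bsub>A\<^esub> b"

lemma B_eq: "B = A Quot ID"
  by (simp add: boson_alg_def)

lemma ring_B: "ring B"
  unfolding B_eq by (rule ideal.quotient_is_ring[OF ideal_ID])

lemma carrier_B: "carrier B = cl ` carrier A"
  by (auto simp: B_eq cl_def FactRing_def A_RCOSETS_def')

lemma cl_hom: "x \<in> carrier A \<Longrightarrow> y \<in> carrier A \<Longrightarrow> cl (x + y) = cl x \<oplus>\<^bsub>B\<^esub> cl y"
  "x \<in> carrier A \<Longrightarrow> y \<in> carrier A \<Longrightarrow> cl (x * y) = cl x \<otimes>\<^bsub>B\<^esub> cl y"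
  "cl 1 = \<one>\<^bsub>B\<^esub>" "cl 0 = \<zero>\<^bsub>B\<^esub>"
proof -
  have h: "cl \<in> ring_hom A B"
    using ideal.rcos_ring_hom[OF ideal_ID] by (simp add: B_eq cl_def[abs_def])
  show "x \<in> carrier A \<Longrightarrow> y \<in> carrier A \<Longrightarrow> cl (x + y) = cl x \<oplus>\<^bsub>B\<^esub> cl y"
    using ring_hom_add[OF h, of x y] by simp
  show "x \<in> carrier A \<Longrightarrow> y \<in> carrier A \<Longrightarrow> cl (x * y) = cl x \<otimes>\<^bsub>B\<^esub> cl y"
    using ring_hom_mult[OF h, of x y] by simp
  show "cl 1 = \<one>\<^bsub>B\<^esub>" using ring_hom_one[OF h] by simp
  show "cl 0 = \<zero>\<^bsub>B\<^esub>" using ring_hom_zero[OF h ring_A ring_B] by simp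
qed

lemma cl_eq_iff: "x \<in> carrier A \<Longrightarrow> y \<in> carrier A \<Longrightarrow> cl x = cl y \<longleftrightarrow> x - y \<in> ID"
  using ring.quotient_eq_iff_same_a_r_cos[OF ring_A ideal_ID, of x y] by (simp add: cl_def A_minus)

lemma scal_cl: "scal t = cl (free_scal t)" and be_cl: "be i k = cl (free_gen (GenE i k))"
  and bf_cl: "bf i k = cl (free_gen (GenF i k))"
  by (simp_all add: boson_scal_def boson_e_def boson_f_def cl_def)

lemma cl_B: "x \<in> carrier A \<Longrightarrow> cl x \<in> carrier B"
  by (simp add: carrier_B)

lemma scal_B [simp]: "scal t \<in> carrier B"
  by (simp add: scal_cl cl_B A_closed)

lemma cl_scl: "x \<in> carrier A \<Longrightarrow> cl (scl t x) = scal t \<otimes>\<^bsub>B\<^esub> cl x"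
  by (simp add: scl_def cl_hom A_closed scal_cl)

lemma scal_central: "x \<in> carrier B \<Longrightarrow> x \<otimes>\<^bsub>B\<^esub> scal t = scal t \<otimes>\<^bsub>B\<^esub> x"
  by (auto simp: carrier_B scal_cl mult_free_scal A_closed simp flip: cl_hom)

lemma scal_hom: "scal (t + u) = scal t \<oplus>\<^bsub>B\<^esub> scal u" "scal (t * u) = scal t \<otimes>\<^bsub>B\<^esub> scal u"
  "scal 1 = \<one>\<^bsub>B\<^esub>" "scal 0 = \<zero>\<^bsub>B\<^esub>"
  by (simp_all add: scal_cl free_scal_add free_scal_mult A_closed cl_hom)

text \<open>Parametrizes R by words: its range is R by \<open>RS_eq\<close>, and its kernel consists
  of the p with \<open>proj p\<close> in the Serre ideal.\<close>

definition RR :: "(('i \<times> nat) free_mon \<Rightarrow>\<^sub>0 'k) \<Rightarrow> ('i, 'k) boson" where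
  "RR p = cl (phi p)"

lemma RR_hom: "RR (p + r) = RR p \<oplus>\<^bsub>B\<^esub> RR r" "RR (p * r) = RR p \<otimes>\<^bsub>B\<^esub> RR r"
  "RR (scl t p) = scal t \<otimes>\<^bsub>B\<^esub> RR p" "RR 1 = \<one>\<^bsub>B\<^esub>" "RR 0 = \<zero>\<^bsub>B\<^esub>"
  by (simp_all add: RR_def phi_A phi_mult cl_hom cl_scl)

lemma RR_B [simp]: "RR p \<in> carrier B"
  by (simp add: RR_def cl_B phi_A)

lemma RR_proj [simp]: "RR (proj p) = RR p"
  by (simp add: RR_def)

lemma RR_eq_iff: "RR p = RR r \<longleftrightarrow> proj (p - r) \<in> SS"
  unfolding RR_def using phi_ID_iff[of "p - r"] by (simp add: cl_eq_iff phi_A)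

lemma RR_eq_0_iff: "RR p = \<zero>\<^bsub>B\<^esub> \<longleftrightarrow> proj p \<in> SS"
  using RR_eq_iff[of p 0] by (simp add: RR_hom)

lemma RR_gen: "(i, k) \<in> X \<Longrightarrow> RR (free_gen (i, k)) = bf i k"
  by (simp add: RR_def bf_cl phi_def)

lemma RR_scal: "scal t = RR (scl t 1)"
  by (simp add: RR_def scal_cl free_scal_eq)

lemma proj_span: "proj p \<in> FA.span (word ` lists X)"
proof (rule flin_in_subspace[where f=proj and B="range word"])
  fix x :: "('i \<times> nat) free_mon \<Rightarrow>\<^sub>0 'k" assume "x \<in> range word"
  then obtain w where "x = word w" by blast
  then show "proj x \<in> FA.span (word ` lists X)"
    by (auto simp: proj_word FA.span_zero intro!: FA.span_base)
qed (simp_all add: span_words)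

lemma RS_eq: "RS = range RR"
proof
  interpret ring B by (rule ring_B)
  show "RS \<subseteq> range RR"
  proof
    fix r assume "r \<in> RS"
    then show "r \<in> range RR"
      unfolding boson_R_def
    proof (induction rule: generate_ring.induct)
      case one
      show ?case by (metis RR_hom(4) rangeI)
    next
      case (incl h)
      then show ?case using RR_scal by (auto simp flip: RR_gen)
    next
      case (a_inv h)
      then obtain p where h: "h = RR p" by blast
      have "\<ominus>\<^bsub>B\<^esub> h = RR (- p)"
        by (rule minus_equality) (simp_all add: h RR_hom flip: RR_hom(1))
      then show ?case by blast
    next
      case (eng_add h1 h2)
      then show ?case by (auto simp flip: RR_hom)
    next
      case (eng_mult h1 h2)
      then show ?case by (auto simp flip: RR_hom)
    qed
  qed
  show "range RR \<subseteq> RS"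
  proof
    fix r assume "r \<in> range RR"
    then obtain p where p: "r = RR (proj p)" by auto
    have "RR y \<in> RS" if "y \<in> FA.span (word ` lists X)" for y
      using that
    proof (induction rule: FA.span_induct_alt)
      case base
      have "scal 0 \<in> RS" unfolding boson_R_def by (rule generate_ring.incl) simp
      then show ?case by (simp add: scal_hom RR_hom)
    next
      case (step t x y)
      obtain w where w: "x = word w" "w \<in> lists X" using step.hyps by blast
      have "RR (word w) \<in> RS"
        using w(2)
      proof (induction w)
        case Nil
        then show ?case by (simp add: word_Nil RR_hom boson_R_def generate_ring.one)
      next
        case (Cons z w)
        obtain i k where z: "z = (i, k)" by fastforce
        have "bf i k \<in> RS" unfolding boson_R_def using Cons.hyps(1) z by (intro generate_ring.incl) force
        then show ?case
          using Cons z unfolding boson_R_def by (simp add: word_Cons RR_hom RR_gen generate_ring.eng_mult)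
      qed
      moreover have "scal t \<in> RS" unfolding boson_R_def by (rule generate_ring.incl) simp
      ultimately show ?case
        using step.IH w unfolding boson_R_def
        by (simp add: RR_hom generate_ring.eng_add generate_ring.eng_mult)
    qed
    from this[OF proj_span] show "r \<in> RS" by (simp add: p)
  qed
qed

lemma RR_RS [simp]: "RR p \<in> RS"
  by (simp add: RS_eq)

lemma f_mon: "w \<in> lists X \<Longrightarrow> boson_f_mon I a s m q w = RR (word w)"
  by (induction w) (auto simp: boson_f_mon_def RR_hom word_Nil word_Cons RR_gen)

text \<open>The recursion unrolled into the shape of \<open>boson_e_on_mon\<close>: position p is
  charged for the letters before it.\<close>

lemma lder_word_sum: "lder x (word w) = (\<Sum>p<length w. if w ! p = x
    then scl (\<Prod>t<p. q powi (- cc x (w ! t))) (word (take p w @ drop (Suc p) w)) else 0)"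
proof (induction w)
  case (Cons y w)
  have "(\<Sum>p<length (y # w). if (y # w) ! p = x then scl (\<Prod>t<p. q powi (- cc x ((y # w) ! t)))
      (word (take p (y # w) @ drop (Suc p) (y # w))) else 0) =
    (if x = y then word w else 0) + (\<Sum>p<length w. if w ! p = x then
       scl (q powi (- cc x y) * (\<Prod>t<p. q powi (- cc x (w ! t)))) (free_gen y * word (take p w @ drop (Suc p) w)) else 0)"
    by (auto simp: sum.lessThan_Suc_shift prod.lessThan_Suc_shift word_Cons simp del: sum.lessThan_Suc prod.lessThan_Suc intro!: sum.cong)
  also have "\<dots> = (if x = y then word w else 0) + scl (q powi (- cc x y)) (free_gen y * lder x (word w))"
    unfolding Cons.IH by (simp add: sum_distrib_left FA.scale_sum_right if_distrib cong: if_cong)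
  finally show ?case by (simp add: word_Cons ldr_gen_mult)
qed (simp add: word_Nil)

lemma RR_sum: "finite P \<Longrightarrow> RR (\<Sum>p\<in>P. f p) = finsum B (\<lambda>p. RR (f p)) P"
proof (induction P rule: finite_induct)
  case (insert p P)
  interpret ring B by (rule ring_B)
  show ?case using insert by (simp add: RR_hom Pi_def)
next
  case empty
  interpret ring B by (rule ring_B)
  show ?case by (simp add: RR_hom)
qed

lemma e_on_mon:
  assumes "(i, k) \<in> X" "w \<in> lists X"
  shows "boson_e_on_mon I a s m q i k w = RR (lder (i, k) (word w))"
proof -
  interpret ring B by (rule ring_B)
  have "boson_e_on_mon I a s m q i k w = finsum B (\<lambda>p. RR (if w ! p = (i, k)
      then scl (\<Prod>t<p. q powi (- cc (i, k) (w ! t))) (word (take p w @ drop (Suc p) w)) else 0)) {..<length w}"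
    unfolding boson_e_on_mon_def
  proof (rule add.finprod_cong')
    fix p assume p: "p \<in> {..<length w}"
    have "set (take p w @ drop (Suc p) w) \<subseteq> X"
      using assms(2) by (auto dest: in_set_takeD in_set_dropD)
    then have "take p w @ drop (Suc p) w \<in> lists X" by auto
    moreover have "(\<Prod>t<p. q_pair a s q i (fst (w ! t))) = (\<Prod>t<p. q powi (- cc (i, k) (w ! t)))"
    proof (rule prod.cong[OF refl])
      fix t assume "t \<in> {..<p}"
      then have "w ! t \<in> set w" using p by simp
      then have "w ! t \<in> X" using assms(2) by auto
      then show "q_pair a s q i (fst (w ! t)) = q powi (- cc (i, k) (w ! t))"
        using assms(1) by (simp add: q_pair_def cc_def)
    qed
    ultimately show "(if w ! p = (i, k)
            then scal (\<Prod>t<p. q_pair a s q i (fst (w ! t)))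
                   \<otimes>\<^bsub>B\<^esub> boson_f_mon I a s m q (take p w @ drop (Suc p) w)
            else \<zero>\<^bsub>B\<^esub>) = RR (if w ! p = (i, k)
      then scl (\<Prod>t<p. q powi (- cc (i, k) (w ! t))) (word (take p w @ drop (Suc p) w)) else 0)"
      by (simp add: RR_hom f_mon del: set_append)
  qed auto
  then show ?thesis by (simp add: lder_word_sum RR_sum)
qed

abbreviation "RM act \<equiv> boson_R_module I a s m q act"

lemma RM_simps [simp]: "carrier (RM act) = RS" "zero (RM act) = zero B" "add (RM act) = add B"
  "smult (RM act) = act"
  by (simp_all add: boson_R_module_def)

text \<open>Independence of both representatives: changing p is absorbed by \<open>rho_SS\<close>,
  changing b by \<open>rho_ID\<close>. This justifies the choices made in
  \<open>act0\<close>.\<close>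

lemma RR_rho_congr:
  assumes "b \<in> carrier A" "b' \<in> carrier A" "cl b = cl b'" "RR p = RR p'"
  shows "RR (rho b p) = RR (rho b' p')"
proof -
  have "rho b (proj (p - p')) \<in> SS" using assms by (simp add: RR_eq_iff rho_SS)
  moreover have "rho (b - b') (proj p') \<in> SS" using assms by (simp add: cl_eq_iff rho_ID)
  ultimately have "rho b (proj (p - p')) + rho (b - b') (proj p') \<in> SS" by (rule SS_add)
  then have "rho b (proj p) - rho b' (proj p') \<in> SS"
    by (simp add: flin_diff[OF flin_rho1] flin_diff[OF flin_rho2])
  then show ?thesis using assms(1,2) by (simp add: RR_eq_iff proj_rho)
qed

definition act0 :: "('i, 'k) boson \<Rightarrow> ('i, 'k) boson \<Rightarrow> ('i, 'k) boson" where
  "act0 x r = RR (rho (SOME b. b \<in> carrier A \<and> cl b = x) (SOME p. RR p = r))"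

lemma act0: assumes "b \<in> carrier A" shows "act0 (cl b) (RR p) = RR (rho b p)"
proof -
  let ?b = "SOME b'. b' \<in> carrier A \<and> cl b' = cl b" and ?p = "SOME p'. RR p' = RR p"
  have "?b \<in> carrier A \<and> cl ?b = cl b" by (rule someI[of _ b]) (use assms in simp)
  moreover have "RR ?p = RR p" by (rule someI[of _ p]) simp
  ultimately show ?thesis unfolding act0_def using assms by (intro RR_rho_congr) auto
qed

lemma left_module_RM:
  assumes "\<And>b p. b \<in> carrier A \<Longrightarrow> act (cl b) (RR p) = RR (rho b p)"
  shows "left_module B (RM act)"
proof -
  interpret B: ring B by (rule ring_B)
  have "abelian_group (RM act)"
  proof (rule abelian_groupI)
    fix x assume "x \<in> carrier (RM act)"
    then obtain p where p: "x = RR p" by (auto simp: RS_eq)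
    have "RR (- p) \<oplus>\<^bsub>B\<^esub> RR p = \<zero>\<^bsub>B\<^esub>" by (simp add: RR_hom(5) flip: RR_hom(1))
    then show "\<exists>y\<in>carrier (RM act). y \<oplus>\<^bsub>RM act\<^esub> x = \<zero>\<^bsub>RM act\<^esub>"
      by (auto simp: p intro!: bexI[of _ "RR (- p)"])
  qed (auto simp: RS_eq add_ac simp flip: RR_hom(1,5))
  moreover have "left_module_axioms B (RM act)"
    by (rule left_module_axioms.intro)
      (auto simp: carrier_B RS_eq assms A_closed flin_add[OF flin_rho1] flin_add[OF flin_rho2] rho_mult
        simp flip: RR_hom(1) cl_hom(1,2,3))
  ultimately show ?thesis
    by (intro left_module.intro ring_B)
qed

lemma act_exists: "\<exists>act. is_boson_R_action I a s m q act"
proof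
  show "is_boson_R_action I a s m q act0"
    unfolding is_boson_R_action_def
  proof (intro conjI)
    show "left_module B (RM act0)" by (rule left_module_RM[OF act0])
    show "\<forall>t. \<forall>r\<in>RS. act0 (scal t) r = scal t \<otimes>\<^bsub>B\<^esub> r"
      by (auto simp: RS_eq scal_cl act0 A_closed RR_hom)
    show "\<forall>(i, k)\<in>X. \<forall>r\<in>RS. act0 (bf i k) r = bf i k \<otimes>\<^bsub>B\<^esub> r"
      by (auto simp: RS_eq bf_cl act0 gen_A RR_hom RR_gen)
    show "\<forall>(i, k)\<in>X. \<forall>w\<in>lists X. act0 (be i k) (boson_f_mon I a s m q w) = boson_e_on_mon I a s m q i k w"
    proof (rule ballI)
      fix z assume z: "z \<in> X"
      obtain i k where ik: "z = (i, k)" by fastforce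
      have "act0 (be i k) (boson_f_mon I a s m q w) = boson_e_on_mon I a s m q i k w" if "w \<in> lists X" for w
        using that z unfolding ik by (simp only: e_on_mon f_mon be_cl act0 gen_A rho_gen actl.simps)
      then show "case z of (i, k) \<Rightarrow> \<forall>w\<in>lists X.
          act0 (be i k) (boson_f_mon I a s m q w) = boson_e_on_mon I a s m q i k w"
        unfolding ik prod.case by blast
    qed
  qed
qed

text \<open>Generators are attached on the left, which fits \<open>rho_mult\<close> and the
  associativity law of modules.\<close>

lemma carrier_A_induct [consumes 1, case_names zero add one gen]:
  assumes "b \<in> carrier A" "P 0" "\<And>t x y. \<lbrakk>x \<in> carrier A; y \<in> carrier A; P x; P y\<rbrakk> \<Longrightarrow> P (scl t x + y)"
    and "P 1" "\<And>g x. \<lbrakk>g \<in> (\<lambda>(i, k). GenE i k) ` X \<union> (\<lambda>(i, k). GenF i k) ` X; x \<in> carrier A; P x\<rbrakk>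
      \<Longrightarrow> P (free_gen g * x)"
  shows "P b"
proof -
  let ?Y = "(\<lambda>(i, k). GenE i k) ` X \<union> (\<lambda>(i, k). GenF i k) ` X"
  have "P b \<and> b \<in> carrier A"
    using assms(1)[unfolded A_eq carrier_free_algebra]
  proof (induction rule: FA.span_induct_alt)
    case base
    show ?case by (simp add: assms(2) A_closed)
  next
    case (step t x y)
    obtain w where w: "x = word w" "set w \<subseteq> ?Y" using step.hyps by blast
    have "P (word w) \<and> word w \<in> carrier A"
      using w(2)
    proof (induction w)
      case (Cons g w)
      then have "free_gen g \<in> carrier A" by (auto intro: gen_A)
      then show ?case using Cons by (auto simp: word_Cons A_closed intro: assms(5))
    qed (simp add: word_Nil assms(4) A_closed)
    then show ?case using step.IH w(1) by (auto intro!: assms(3) A_closed)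
  qed
  then show ?thesis ..
qed

section \<open>Every admissible action is the representation on words\<close>

context
  fixes act
  assumes action: "is_boson_R_action I a s m q act"
begin

interpretation B: ring B by (rule ring_B)

interpretation LM: left_module B "RM act"
  using action by (simp add: is_boson_R_action_def)

lemma act_simps: "\<lbrakk>x \<in> carrier B; y \<in> carrier B\<rbrakk> \<Longrightarrow> act (x \<oplus>\<^bsub>B\<^esub> y) (RR p) = act x (RR p) \<oplus>\<^bsub>B\<^esub> act y (RR p)"
  "\<lbrakk>x \<in> carrier B; y \<in> carrier B\<rbrakk> \<Longrightarrow> act (x \<otimes>\<^bsub>B\<^esub> y) (RR p) = act x (act y (RR p))"
  "x \<in> carrier B \<Longrightarrow> act x (RR p \<oplus>\<^bsub>B\<^esub> RR r) = act x (RR p) \<oplus>\<^bsub>B\<^esub> act x (RR r)"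
  "act \<one>\<^bsub>B\<^esub> (RR p) = RR p" "act (scal t) (RR p) = scal t \<otimes>\<^bsub>B\<^esub> RR p"
  "z \<in> X \<Longrightarrow> act (bf (fst z) (snd z)) (RR p) = bf (fst z) (snd z) \<otimes>\<^bsub>B\<^esub> RR p"
  "\<lbrakk>z \<in> X; w \<in> lists X\<rbrakk> \<Longrightarrow> act (be (fst z) (snd z)) (RR (word w)) = RR (lder z (word w))"
proof -
  show "\<lbrakk>x \<in> carrier B; y \<in> carrier B\<rbrakk> \<Longrightarrow> act (x \<oplus>\<^bsub>B\<^esub> y) (RR p) = act x (RR p) \<oplus>\<^bsub>B\<^esub> act y (RR p)"
    using LM.left_smult_l_distr[of x y "RR p"] by simp
  show "\<lbrakk>x \<in> carrier B; y \<in> carrier B\<rbrakk> \<Longrightarrow> act (x \<otimes>\<^bsub>B\<^esub> y) (RR p) = act x (act y (RR p))"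
    using LM.left_smult_assoc[of x y "RR p"] by simp
  show "x \<in> carrier B \<Longrightarrow> act x (RR p \<oplus>\<^bsub>B\<^esub> RR r) = act x (RR p) \<oplus>\<^bsub>B\<^esub> act x (RR r)"
    using LM.left_smult_r_distr[of x "RR p" "RR r"] by simp
  show "act \<one>\<^bsub>B\<^esub> (RR p) = RR p"
    using LM.left_smult_one[of "RR p"] by simp
  show "act (scal t) (RR p) = scal t \<otimes>\<^bsub>B\<^esub> RR p"
    using action by (simp add: is_boson_R_action_def)
  show "z \<in> X \<Longrightarrow> act (bf (fst z) (snd z)) (RR p) = bf (fst z) (snd z) \<otimes>\<^bsub>B\<^esub> RR p"
    using action unfolding is_boson_R_action_def by (cases z) auto
  assume z: "z \<in> X" "w \<in> lists X"
  have "act (be (fst z) (snd z)) (boson_f_mon I a s m q w) = boson_e_on_mon I a s m q (fst z) (snd z) w"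
  proof -
    have "\<forall>(i, k)\<in>X. \<forall>w\<in>lists X. act (be i k) (boson_f_mon I a s m q w) = boson_e_on_mon I a s m q i k w"
      using action unfolding is_boson_R_action_def by (elim conjE)
    from bspec[OF this z(1)] show ?thesis using z(2) unfolding case_prod_beta by blast
  qed
  then show "act (be (fst z) (snd z)) (RR (word w)) = RR (lder z (word w))"
    using z by (simp add: e_on_mon f_mon del: in_lists_conv_set)
qed

text \<open>The conditions on \<open>act\<close> fix e only on monomials. Linearity over k follows
  because scalars are central in \<B> and act by multiplication.\<close>

lemma act_be:
  assumes "x \<in> X"
  shows "act (be (fst x) (snd x)) (RR p) = RR (lder x p)"
proof -
  let ?e = "be (fst x) (snd x)"
  have e: "?e \<in> carrier B" using assms by (cases x) (simp add: be_cl cl_B gen_A)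
  have scal: "act ?e (RR (scl t y)) = scal t \<otimes>\<^bsub>B\<^esub> act ?e (RR y)" if "act ?e (RR y) = RR z" for t y z
  proof -
    have "act ?e (RR (scl t y)) = act ?e (act (scal t) (RR y))" by (simp add: RR_hom act_simps)
    also have "\<dots> = act (?e \<otimes>\<^bsub>B\<^esub> scal t) (RR y)" by (simp add: act_simps(2) e)
    also have "\<dots> = act (scal t) (act ?e (RR y))" by (simp add: scal_central[OF e] act_simps(2) e)
    finally show ?thesis by (simp add: that act_simps)
  qed
  have "act ?e (RR y) = RR (lder x y)" if "y \<in> FA.span (word ` lists X)" for y
    using that
  proof (induction rule: FA.span_induct_alt)
    case base
    have "act ?e (RR (scl 0 1)) = scal 0 \<otimes>\<^bsub>B\<^esub> act ?e (RR 1)"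
      by (rule scal) (use act_simps(7)[OF assms, of "[]"] in \<open>simp add: word_Nil\<close>)
    also have "act ?e (RR 1) = RR (lder x 1)" using act_simps(7)[OF assms, of "[]"] by (simp add: word_Nil)
    finally show ?case by (simp add: scal_hom RR_hom)
  next
    case (step t y z)
    obtain w where w: "y = word w" "w \<in> lists X" using step.hyps by blast
    have "act ?e (RR y) = RR (lder x y)" using act_simps(7)[OF assms w(2)] w(1) by simp
    from scal[OF this, of t] this have "act ?e (RR (scl t y)) = RR (scl t (lder x y))" by (simp add: RR_hom)
    then show ?case using step.IH act_simps(3)[OF e, of "scl t y" z] by (simp add: RR_hom(1))
  qed
  from this[OF proj_span, of p] show ?thesis
    by (simp flip: proj_lder[OF assms])
qed

lemma act_cl: "b \<in> carrier A \<Longrightarrow> act (cl b) (RR p) = RR (rho b p)"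
proof (induction b rule: carrier_A_induct)
  case zero
  show ?case using act_simps(5)[of 0 p] by (simp add: cl_hom scal_hom flin_0[OF flin_rho1] RR_hom)
next
  case (add t x y)
  have "act (cl (scl t x + y)) (RR p) = act (scal t) (act (cl x) (RR p)) \<oplus>\<^bsub>B\<^esub> act (cl y) (RR p)"
    using add.hyps by (simp add: cl_hom cl_scl A_closed act_simps(1,2) cl_B)
  also have "\<dots> = scal t \<otimes>\<^bsub>B\<^esub> RR (rho x p) \<oplus>\<^bsub>B\<^esub> RR (rho y p)"
    using add.IH by (simp add: act_simps)
  finally show ?case by (simp add: RR_hom flin_add[OF flin_rho1] flin_scl[OF flin_rho1])
next
  case one
  show ?case by (simp add: cl_hom act_simps)
next
  case (gen g x)
  then have g: "free_gen g \<in> carrier A" by (auto intro: gen_A)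
  have "act (cl (free_gen g)) (RR r) = RR (actl g r)" for r
    using gen.hyps(1)
  proof (elim UnE imageE)
    fix y assume y: "y \<in> X" "g = (case y of (i, k) \<Rightarrow> GenE i k)"
    then show ?thesis using act_be[OF y(1), of r] by (cases y) (simp add: be_cl)
  next
    fix y assume y: "y \<in> X" "g = (case y of (i, k) \<Rightarrow> GenF i k)"
    then show ?thesis using act_simps(6)[OF y(1), of r] by (cases y) (simp add: bf_cl RR_hom RR_gen)
  qed
  then show ?case
    using gen.IH gen.hyps(2) g by (simp add: cl_hom act_simps(2) cl_B rho_mult)
qed

end

end

section \<open>Scalars, invariants and simplicity\<close>

context qwords
begin

lemma frm_bounded: "\<exists>N. \<forall>u. N < length u \<longrightarrow> frm u p = 0"
proof -
  have "p \<in> FA.span (range word)" by (simp add: span_words)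
  then show ?thesis
  proof (induction rule: FA.span_induct_alt)
    case (step t x y)
    obtain N where N: "\<And>u. N < length u \<Longrightarrow> frm u y = 0" using step.IH by blast
    obtain w where w: "x = word w" using step.hyps by blast
    have "frm u x = 0" if "length w < length u" for u
      unfolding w by (rule frm_outside[OF _ word_in_hom_part[OF refl]]) (metis less_irrefl size_mset that)
    then have "frm u (scl t x + y) = 0" if "max N (length w) < length u" for u
      using that N by (simp add: frm_add frm_scl)
    then show ?case by blast
  qed simp
qed

lemma frm_append: "frm (u @ v) p = frm v (fold lder u p)"
  by (simp add: frm_def)

lemma frm_const: "frm v (scl t 1) = (if v = [] then t else 0)"
  using frm_outside[OF _ word_in_hom_part[of "[]"], of v] by (auto simp: frm_scl frm_Nil_word simp flip: word_Nil)

lemma minus_const_rad: "(\<And>v. v \<noteq> [] \<Longrightarrow> frm v y = 0) \<Longrightarrow> y - scl (frm [] y) 1 \<in> rad"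
  unfolding rad_def by (auto simp: frm_diff frm_const)

end

context boson_data
begin

lemma lder_proj_outside: "x \<notin> X \<Longrightarrow> lder x (proj p) = 0"
proof -
  assume x: "x \<notin> X"
  have "lder x (proj p) = (\<lambda>p. 0) p"
  proof (rule flin_ext[where f="\<lambda>p. lder x (proj p)"])
    show "lder x (proj (word w)) = 0" for w
      using x lder_word_notin[of x w] by (auto simp: proj_word)
  qed (simp_all add: flin_zero)
  then show ?thesis by simp
qed

lemma proj_lder_fixed: "proj p = p \<Longrightarrow> proj (lder x p) = lder x p"
  using proj_lder[of x p] lder_proj_outside[of x p] by (cases "x \<in> X") auto

lemma proj_fold_lder: "proj p = p \<Longrightarrow> proj (fold lder u p) = fold lder u p"
  by (induction u arbitrary: p) (auto simp: proj_lder_fixed)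

text \<open>Subtracting its constant term puts \<open>y\<close> into the radical. That this
  difference vanishes in R is the use made of \<open>rad_eq_SS\<close>.\<close>

lemma RR_minus_const:
  assumes "proj y = y" "\<And>v. v \<noteq> [] \<Longrightarrow> frm v y = 0"
  shows "RR y = scal (frm [] y)"
  using minus_const_rad[OF assms(2)] unfolding RR_scal RR_eq_iff by (simp add: assms(1) rad_eq_SS)

context
  fixes act
  assumes action: "is_boson_R_action I a s m q act"
begin

lemma left_module_act: "left_module B (RM act)"
  using action by (simp add: is_boson_R_action_def)

text \<open>For an invariant, every first derivative lies in the radical (it is zero for letters
  outside the index set), so the element pairs to zero with all nonempty words and is a
  scalar.\<close>

lemma RM_invariants: "boson_invariants I a s m q (RM act) = range scal"
proof
  show "boson_invariants I a s m q (RM act) \<subseteq> range scal"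
  proof
    fix r assume r: "r \<in> boson_invariants I a s m q (RM act)"
    then obtain p where p: "r = RR p" by (auto simp: boson_invariants_def RS_eq)
    have "lder x (proj p) \<in> rad" for x
    proof (cases "x \<in> X")
      case True
      have "act (be (fst x) (snd x)) r = \<zero>\<^bsub>B\<^esub>"
        using r True unfolding boson_invariants_def by (cases x) auto
      then have "RR (lder x p) = \<zero>\<^bsub>B\<^esub>" using act_be[OF action True] p by simp
      then show ?thesis using True by (simp add: RR_eq_0_iff proj_lder rad_eq_SS)
    next
      case False
      then show ?thesis by (simp add: lder_proj_outside FA.subspace_0[OF subspace_rad])
    qed
    then have "frm v (proj p) = 0" if "v \<noteq> []" for v
      using that by (cases v) (auto simp: frm_Cons rad_def)
    from RR_minus_const[OF proj_proj this] show "r \<in> range scal" by (simp add: p)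
  qed
  show "range scal \<subseteq> boson_invariants I a s m q (RM act)"
  proof
    fix r assume "r \<in> range scal"
    then obtain t where t: "r = scal t" by blast
    have "act (be i k) r = \<zero>\<^bsub>B\<^esub>" if "(i, k) \<in> X" for i k
      using act_be[OF action that, of "scl t 1"] by (simp add: t RR_scal RR_hom(5))
    then show "r \<in> boson_invariants I a s m q (RM act)"
      by (auto simp: boson_invariants_def t RR_scal)
  qed
qed

text \<open>A longest word in the e not annihilating a nonzero element under the form maps it to a
  nonzero scalar, and a nonzero scalar generates R.\<close>

lemma RM_simple: "simple_left_module B (RM act)"
  unfolding simple_left_module_def
proof (intro conjI allI impI left_module_act)
  have "proj (1 :: ('i \<times> nat) free_mon \<Rightarrow>\<^sub>0 'k) \<notin> SS"
    using frm_const[of "[]" 1] by (auto simp: rad_def simp flip: rad_eq_SS intro!: exI[of _ "[]"])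
  then have "RR 1 \<noteq> \<zero>\<^bsub>B\<^esub>" using RR_eq_0_iff by blast
  then show "carrier (RM act) \<noteq> {\<zero>\<^bsub>RM act\<^esub>}" using RR_RS[of 1] by auto
next
  fix H assume H: "submodule H B (RM act)"
  then have sub: "subgroup H (add_monoid (RM act))"
    and smult: "\<And>b x. b \<in> carrier B \<Longrightarrow> x \<in> H \<Longrightarrow> act b x \<in> H"
    by (auto simp: submodule_def submodule_axioms_def)
  have zero: "\<zero>\<^bsub>B\<^esub> \<in> H" using subgroup.one_closed[OF sub] by simp
  have HR: "H \<subseteq> RS" using subgroup.subset[OF sub] by simp
  show "H = {\<zero>\<^bsub>RM act\<^esub>} \<or> H = carrier (RM act)"
  proof (rule disjCI)
    assume "H \<noteq> carrier (RM act)"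
    show "H = {\<zero>\<^bsub>RM act\<^esub>}"
    proof (rule ccontr)
      assume "H \<noteq> {\<zero>\<^bsub>RM act\<^esub>}"
      then obtain r where r: "r \<in> H" "r \<noteq> \<zero>\<^bsub>B\<^esub>" using zero by auto
      then obtain p0 where p0: "r = RR p0" using HR by (auto simp: RS_eq)
      define p where "p = proj p0"
      have p: "r = RR p" "proj p = p" by (simp_all add: p0 p_def)
      have "p \<notin> rad" using r p RR_eq_0_iff[of p] by (simp add: rad_eq_SS)
      then obtain u0 where u0: "frm u0 p \<noteq> 0" by (auto simp: rad_def)
      obtain N where N: "\<And>u. N < length u \<Longrightarrow> frm u p = 0" using frm_bounded by blast
      have "\<forall>u. frm u p \<noteq> 0 \<longrightarrow> length u < Suc N" using N by (metis linorder_neqE_nat not_less_eq)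
      \<comment> \<open>A longest such word exists because the form vanishes on words longer than
        all those occurring in \<open>p\<close>.\<close>
      then obtain u where u: "frm u p \<noteq> 0" "\<And>v. frm v p \<noteq> 0 \<Longrightarrow> length v \<le> length u"
        using ex_has_greatest_nat[of "\<lambda>u. frm u p \<noteq> 0" u0 length "Suc N"] u0 by blast
      define y where "y = fold lder u p"
      have "RR (fold lder v p) \<in> H" for v
      proof (induction v rule: rev_induct)
        case (snoc x v)
        show ?case
        proof (cases "x \<in> X")
          case True
          then have "be (fst x) (snd x) \<in> carrier B" by (cases x) (simp add: be_cl cl_B gen_A)
          from smult[OF this snoc] show ?thesis by (simp add: act_be[OF action True])
        next
          case False
          then have "lder x (fold lder v p) = 0"
            using lder_proj_outside[OF False, of "fold lder v p"] by (simp add: proj_fold_lder p(2))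
          then show ?thesis using zero by (simp add: RR_hom)
        qed
      qed (use r p in simp)
      then have "RR y \<in> H" by (simp add: y_def)
      have "frm v y = 0" if "v \<noteq> []" for v
        using u(2)[of "u @ v"] that by (auto simp: y_def simp flip: frm_append)
      then have "RR y = scal (frm [] y)"
        by (intro RR_minus_const) (simp_all add: y_def proj_fold_lder p(2))
      moreover have t: "frm [] y = frm u p" using frm_append[of u "[]" p] by (simp add: y_def)
      ultimately have "RR (scl (frm u p) 1) \<in> H" using \<open>RR y \<in> H\<close> by (simp add: RR_scal)
      have "RR z \<in> H" for z
      proof -
        \<comment> \<open>Multiplication by this element of R, divided by the scalar found, turns
          the scalar into an arbitrary z.\<close>
        let ?b = "scl (1 / frm u p) (phi z)"
        have "?b \<in> carrier A" by (intro A_closed phi_A)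
        then have "act (cl ?b) (RR (scl (frm u p) 1)) = RR z"
          using u(1) by (simp add: act_cl[OF action] flin_scl[OF flin_rho1] rho_phi)
        then show ?thesis
          using smult[OF cl_B[OF \<open>?b \<in> carrier A\<close>] \<open>RR (scl (frm u p) 1) \<in> H\<close>] by simp
      qed
      then have "H = carrier (RM act)" using HR by (auto simp: RS_eq)
      then show False using \<open>H \<noteq> carrier (RM act)\<close> by blast
    qed
  qed
qed

end

subsection \<open>Invariants of a module over the q-boson algebra\<close>

lemma be_bf:
  assumes "x \<in> X" "y \<in> X"
  shows "be (fst x) (snd x) \<otimes>\<^bsub>B\<^esub> bf (fst y) (snd y) =
    scal (q powi (- cc x y)) \<otimes>\<^bsub>B\<^esub> (bf (fst y) (snd y) \<otimes>\<^bsub>B\<^esub> be (fst x) (snd x)) \<oplus>\<^bsub>B\<^esub> scal (if x = y then 1 else 0)"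
proof -
  obtain i k j l where xy: "x = (i, k)" "y = (j, l)" by fastforce
  let ?e = "free_gen (GenE i k)" and ?f = "free_gen (GenF j l)" and ?d = "if x = y then 1 else 0 :: 'k"
  have A: "?e \<in> carrier A" "?f \<in> carrier A" using assms by (simp_all add: xy gen_A)
  have "?e * ?f - (scl (q powi (- cc x y)) (?f * ?e) + free_scal ?d) =
      ?e * ?f - free_scal (q_pair a s q i j) * ?f * ?e - (if i = j \<and> k = l then 1 else 0)"
    using assms by (simp add: xy scl_def mult.assoc q_pair_def cc_eq)
  also have "\<dots> \<in> boson_rels I a s m q"
    unfolding boson_rels_def using assms xy by blast
  finally have "cl (?e * ?f) = cl (scl (q powi (- cc x y)) (?f * ?e) + free_scal ?d)"
    using rels_ID A by (subst cl_eq_iff) (auto intro!: A_closed)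
  then show ?thesis
    using A by (simp add: xy be_cl bf_cl cl_hom cl_scl A_closed scal_cl)
qed

context
  fixes M :: "(('i, 'k) boson, 'v) module"
  assumes M: "left_module B M"
begin

interpretation B: ring B by (rule ring_B)

interpretation left_module B M by (rule M)

lemma smult_zero_left [simp]: "x \<in> carrier M \<Longrightarrow> \<zero>\<^bsub>B\<^esub> \<odot>\<^bsub>M\<^esub> x = \<zero>\<^bsub>M\<^esub>"
  using left_smult_l_distr[of "\<zero>\<^bsub>B\<^esub>" "\<zero>\<^bsub>B\<^esub>" x] left_smult_closed[of "\<zero>\<^bsub>B\<^esub>" x]
  by (simp add: M.add.l_cancel_one')

lemma smult_zero_right [simp]: "b \<in> carrier B \<Longrightarrow> b \<odot>\<^bsub>M\<^esub> \<zero>\<^bsub>M\<^esub> = \<zero>\<^bsub>M\<^esub>"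
  using left_smult_r_distr[of b "\<zero>\<^bsub>M\<^esub>" "\<zero>\<^bsub>M\<^esub>"] left_smult_closed[of b "\<zero>\<^bsub>M\<^esub>"]
  by (simp add: M.add.l_cancel_one')

lemma scal_smult_comm: "\<lbrakk>b \<in> carrier B; x \<in> carrier M\<rbrakk> \<Longrightarrow> b \<odot>\<^bsub>M\<^esub> (scal t \<odot>\<^bsub>M\<^esub> x) = scal t \<odot>\<^bsub>M\<^esub> (b \<odot>\<^bsub>M\<^esub> x)"
  by (simp add: scal_central flip: left_smult_assoc)

abbreviation "M0 \<equiv> boson_invariants I a s m q M"

lemma M0_carrier: "x \<in> M0 \<Longrightarrow> x \<in> carrier M"
  by (simp add: boson_invariants_def)

lemma be_M0: "x \<in> M0 \<Longrightarrow> z \<in> X \<Longrightarrow> be (fst z) (snd z) \<odot>\<^bsub>M\<^esub> x = \<zero>\<^bsub>M\<^esub>"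
  unfolding boson_invariants_def by (cases z) auto

lemma be_B: "z \<in> X \<Longrightarrow> be (fst z) (snd z) \<in> carrier B" and bf_B: "z \<in> X \<Longrightarrow> bf (fst z) (snd z) \<in> carrier B"
  by (cases z; simp add: be_cl bf_cl cl_B gen_A)+

lemma M0_closed: "x \<in> M0 \<Longrightarrow> y \<in> M0 \<Longrightarrow> x \<oplus>\<^bsub>M\<^esub> y \<in> M0" "x \<in> M0 \<Longrightarrow> scal t \<odot>\<^bsub>M\<^esub> x \<in> M0" "\<zero>\<^bsub>M\<^esub> \<in> M0"
proof -
  have be: "be i k \<in> carrier B" if "(i, k) \<in> X" for i k using be_B[OF that] by simp
  show "x \<in> M0 \<Longrightarrow> y \<in> M0 \<Longrightarrow> x \<oplus>\<^bsub>M\<^esub> y \<in> M0"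
    using be by (auto simp: boson_invariants_def left_smult_r_distr split: prod.splits)
  show "x \<in> M0 \<Longrightarrow> scal t \<odot>\<^bsub>M\<^esub> x \<in> M0"
    using be by (auto simp: boson_invariants_def scal_smult_comm left_smult_closed split: prod.splits)
  show "\<zero>\<^bsub>M\<^esub> \<in> M0"
    using be by (auto simp: boson_invariants_def split: prod.splits)
qed

lemma RR_smult_hom: "x \<in> carrier M \<Longrightarrow> RR (p + r) \<odot>\<^bsub>M\<^esub> x = RR p \<odot>\<^bsub>M\<^esub> x \<oplus>\<^bsub>M\<^esub> RR r \<odot>\<^bsub>M\<^esub> x"
  "x \<in> carrier M \<Longrightarrow> RR (scl t p) \<odot>\<^bsub>M\<^esub> x = scal t \<odot>\<^bsub>M\<^esub> (RR p \<odot>\<^bsub>M\<^esub> x)"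
  "x \<in> carrier M \<Longrightarrow> RR (p * r) \<odot>\<^bsub>M\<^esub> x = RR p \<odot>\<^bsub>M\<^esub> (RR r \<odot>\<^bsub>M\<^esub> x)"
  by (simp_all add: RR_hom left_smult_l_distr left_smult_assoc)

text \<open>Only the relation between e and f' and the annihilation of x enter, so e acts on R x by
  the same recursion as on R.\<close>

lemma be_smult_M0:
  assumes "z \<in> X" "x \<in> M0"
  shows "be (fst z) (snd z) \<odot>\<^bsub>M\<^esub> (RR p \<odot>\<^bsub>M\<^esub> x) = RR (lder z p) \<odot>\<^bsub>M\<^esub> x"
proof -
  let ?e = "be (fst z) (snd z)"
  note e = be_B[OF assms(1)] and x = M0_carrier[OF assms(2)]
  have word: "?e \<odot>\<^bsub>M\<^esub> (RR (word w) \<odot>\<^bsub>M\<^esub> x) = RR (lder z (word w)) \<odot>\<^bsub>M\<^esub> x" if "w \<in> lists X" for w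
    using that
  proof (induction w)
    case Nil
    show ?case using be_M0[OF assms(2,1)] x by (simp add: word_Nil RR_hom left_smult_one)
  next
    case (Cons y w)
    let ?f = "bf (fst y) (snd y)"
    note f = bf_B[OF Cons.hyps(1)]
    have f': "RR (free_gen y) = ?f" using Cons.hyps(1) RR_gen[of "fst y" "snd y"] by simp
    have m: "RR r \<odot>\<^bsub>M\<^esub> x \<in> carrier M" for r by (simp add: left_smult_closed x)
    have "?e \<odot>\<^bsub>M\<^esub> (RR (word (y # w)) \<odot>\<^bsub>M\<^esub> x) = (?e \<otimes>\<^bsub>B\<^esub> ?f) \<odot>\<^bsub>M\<^esub> (RR (word w) \<odot>\<^bsub>M\<^esub> x)"
      by (simp add: word_Cons RR_smult_hom(3)[OF x] f' left_smult_assoc e f m)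
    also have "\<dots> = scal (q powi (- cc z y)) \<odot>\<^bsub>M\<^esub> (?f \<odot>\<^bsub>M\<^esub> (?e \<odot>\<^bsub>M\<^esub> (RR (word w) \<odot>\<^bsub>M\<^esub> x)))
        \<oplus>\<^bsub>M\<^esub> scal (if z = y then 1 else 0) \<odot>\<^bsub>M\<^esub> (RR (word w) \<odot>\<^bsub>M\<^esub> x)"
      unfolding be_bf[OF assms(1) Cons.hyps(1)]
      by (simp only: left_smult_l_distr left_smult_assoc B.m_closed scal_B e f m left_smult_closed)
    also have "?e \<odot>\<^bsub>M\<^esub> (RR (word w) \<odot>\<^bsub>M\<^esub> x) = RR (lder z (word w)) \<odot>\<^bsub>M\<^esub> x"
      by (rule Cons.IH)
    also have "scal (q powi (- cc z y)) \<odot>\<^bsub>M\<^esub> (?f \<odot>\<^bsub>M\<^esub> (RR (lder z (word w)) \<odot>\<^bsub>M\<^esub> x))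
        \<oplus>\<^bsub>M\<^esub> scal (if z = y then 1 else 0) \<odot>\<^bsub>M\<^esub> (RR (word w) \<odot>\<^bsub>M\<^esub> x) =
      RR (scl (q powi (- cc z y)) (free_gen y * lder z (word w)) + scl (if z = y then 1 else 0) (word w)) \<odot>\<^bsub>M\<^esub> x"
      by (simp only: RR_smult_hom[OF x] f')
    also have "scl (q powi (- cc z y)) (free_gen y * lder z (word w)) + scl (if z = y then 1 else 0) (word w) =
        lder z (word (y # w))"
      by (simp add: word_Cons ldr_gen_mult)
    finally show ?case .
  qed
  have "?e \<odot>\<^bsub>M\<^esub> (RR y \<odot>\<^bsub>M\<^esub> x) = RR (lder z y) \<odot>\<^bsub>M\<^esub> x" if "y \<in> FA.span (word ` lists X)" for y
    using that
  proof (induction rule: FA.span_induct_alt)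
    case base
    show ?case by (simp add: RR_hom x e)
  next
    case (step t y r)
    obtain w where w: "y = word w" "w \<in> lists X" using step.hyps by blast
    have m: "RR r \<odot>\<^bsub>M\<^esub> x \<in> carrier M" for r by (simp add: left_smult_closed x)
    show ?case
      using step.IH word[OF w(2)]
      by (simp add: w(1) RR_smult_hom[OF x] left_smult_r_distr scal_smult_comm e m left_smult_closed del: in_lists_conv_set)
  qed
  from this[OF proj_span, of p] show ?thesis by (simp flip: proj_lder[OF assms(1)])
qed

text \<open>For invariant x, sending r to r x is \<B>-linear from R to M. This is the source of the
  linearity of \<kappa>.\<close>

lemma smult_M0:
  assumes "b \<in> carrier A" "x \<in> M0"
  shows "RR (rho b p) \<odot>\<^bsub>M\<^esub> x = cl b \<odot>\<^bsub>M\<^esub> (RR p \<odot>\<^bsub>M\<^esub> x)"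
  using assms(1)
proof (induction b arbitrary: p rule: carrier_A_induct)
  case zero
  show ?case using M0_carrier[OF assms(2)]
    by (simp add: cl_hom flin_0[OF flin_rho1] RR_hom left_smult_closed)
next
  case (add t y z)
  have m: "RR r \<odot>\<^bsub>M\<^esub> x \<in> carrier M" for r by (simp add: left_smult_closed M0_carrier[OF assms(2)])
  show ?case
    using add by (simp add: cl_hom cl_scl A_closed cl_B flin_add[OF flin_rho1] flin_scl[OF flin_rho1]
        RR_smult_hom M0_carrier[OF assms(2)] left_smult_l_distr left_smult_assoc m left_smult_closed)
next
  case one
  show ?case using M0_carrier[OF assms(2)] by (simp add: cl_hom left_smult_one left_smult_closed)
next
  case (gen g y)
  then have g: "free_gen g \<in> carrier A" by (auto intro: gen_A)
  note x = M0_carrier[OF assms(2)]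
  have "RR (actl g r) \<odot>\<^bsub>M\<^esub> x = cl (free_gen g) \<odot>\<^bsub>M\<^esub> (RR r \<odot>\<^bsub>M\<^esub> x)" for r
    using gen.hyps(1)
  proof (elim UnE imageE)
    fix z assume z: "z \<in> X" "g = (case z of (i, k) \<Rightarrow> GenE i k)"
    then show ?thesis using be_smult_M0[OF z(1) assms(2), of r] by (cases z) (simp add: be_cl)
  next
    fix z assume z: "z \<in> X" "g = (case z of (i, k) \<Rightarrow> GenF i k)"
    then show ?thesis by (cases z) (simp add: RR_smult_hom x RR_gen bf_cl)
  qed
  then show ?case
    using gen.IH gen.hyps(2) g
    by (simp add: rho_mult cl_hom left_smult_assoc cl_B x left_smult_closed)
qed

end

end

section \<open>Tensor products\<close>

abbreviation sg :: "'v \<Rightarrow> 'w \<Rightarrow> 'k::field \<Rightarrow> ('v \<times> 'w) \<Rightarrow>\<^sub>0 'k" where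
  "sg v w d \<equiv> Poly_Mapping.single (v, w) d"

text \<open>The action on the first tensor factor at the level of representatives, before passing to
  the quotient.\<close>

definition actz :: "('v \<Rightarrow> 'v) \<Rightarrow> (('v \<times> 'w) \<Rightarrow>\<^sub>0 'k::field) \<Rightarrow> (('v \<times> 'w) \<Rightarrow>\<^sub>0 'k)" where
  "actz g z = (\<Sum>(v, w)\<in>Poly_Mapping.keys z. sg (g v) w (Poly_Mapping.lookup z (v, w)))"

lemma actz_add: "actz g (y + z) = actz g y + actz g z"
proof -
  have "(\<Sum>k\<in>Poly_Mapping.keys (y + z). sg (g (fst k)) (snd k) (Poly_Mapping.lookup (y + z) k)) =
    (\<Sum>k\<in>Poly_Mapping.keys y. sg (g (fst k)) (snd k) (Poly_Mapping.lookup y k)) +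
    (\<Sum>k\<in>Poly_Mapping.keys z. sg (g (fst k)) (snd k) (Poly_Mapping.lookup z k))"
    by (rule Poly_Mapping.setsum_keys_plus_distrib) (simp_all add: single_add)
  then show ?thesis by (simp add: actz_def case_prod_beta)
qed

lemma actz_0 [simp]: "actz g 0 = 0"
  by (simp add: actz_def)

lemma actz_uminus: "actz g (- z) = - actz g z"
  using actz_add[of g z "- z"] by (simp add: eq_neg_iff_add_eq_0 add.commute)

lemma actz_diff: "actz g (y - z) = actz g y - actz g z"
  using actz_add[of g y "- z"] by (simp add: actz_uminus)

lemma actz_single [simp]: "actz g (sg v w d) = sg (g v) w d"
  by (cases "d = 0") (simp_all add: actz_def)

lemma actz_sum: "actz g (\<Sum>t\<in>T. f t) = (\<Sum>t\<in>T. actz g (f t))"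
  by (induction T rule: infinite_finite_induct) (simp_all add: actz_add)

lemma single_expansion: "z = (\<Sum>k\<in>Poly_Mapping.keys z. Poly_Mapping.single k (Poly_Mapping.lookup z k))"
  by (rule poly_mapping_eqI)
    (auto simp: lookup_sum lookup_single when_def in_keys_iff sum.delta')

locale tensor_pair =
  fixes V :: "('k::field, 'v) module" and W :: "('k, 'w) module"
  assumes V_add: "\<lbrakk>v \<in> carrier V; v' \<in> carrier V\<rbrakk> \<Longrightarrow> v \<oplus>\<^bsub>V\<^esub> v' \<in> carrier V"
    and V_smult: "v \<in> carrier V \<Longrightarrow> d \<odot>\<^bsub>V\<^esub> v \<in> carrier V"
    and W_add: "\<lbrakk>w \<in> carrier W; w' \<in> carrier W\<rbrakk> \<Longrightarrow> w \<oplus>\<^bsub>W\<^esub> w' \<in> carrier W"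
    and W_smult: "w \<in> carrier W \<Longrightarrow> d \<odot>\<^bsub>W\<^esub> w \<in> carrier W"
begin

abbreviation "TF \<equiv> tensor_free V W"
abbreviation "N \<equiv> tensor_null V W"

definition tcl :: "(('v \<times> 'w) \<Rightarrow>\<^sub>0 'k) \<Rightarrow> (('v \<times> 'w) \<Rightarrow>\<^sub>0 'k) set" where
  "tcl z = N #>\<^bsub>TF\<^esub> z"

lemma TF_simps [simp]: "x \<otimes>\<^bsub>TF\<^esub> y = x + y" "\<one>\<^bsub>TF\<^esub> = 0"
  by (simp_all add: tensor_free_def)

lemma TF_0 [simp]: "0 \<in> carrier TF"
  by (simp add: tensor_free_def)

lemma TF_add: "x \<in> carrier TF \<Longrightarrow> y \<in> carrier TF \<Longrightarrow> x + y \<in> carrier TF"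
  using Poly_Mapping.keys_add[of x y] by (auto simp: tensor_free_def)

lemma TF_uminus: "x \<in> carrier TF \<Longrightarrow> - x \<in> carrier TF"
  by (simp add: tensor_free_def)

lemma TF_diff: "x \<in> carrier TF \<Longrightarrow> y \<in> carrier TF \<Longrightarrow> x - y \<in> carrier TF"
  using TF_add[OF _ TF_uminus, of x y] by simp

lemma TF_single: "v \<in> carrier V \<Longrightarrow> w \<in> carrier W \<Longrightarrow> sg v w d \<in> carrier TF"
  by (auto simp: tensor_free_def)

lemma TF_sum: "(\<And>t. t \<in> T \<Longrightarrow> f t \<in> carrier TF) \<Longrightarrow> (\<Sum>t\<in>T. f t) \<in> carrier TF"
  by (induction T rule: infinite_finite_induct) (simp_all add: TF_add)

lemma TF_induct [consumes 1, case_names zero add]: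
  assumes "z \<in> carrier TF" "P 0"
    and "\<And>v w d z. \<lbrakk>v \<in> carrier V; w \<in> carrier W; z \<in> carrier TF; P z\<rbrakk> \<Longrightarrow> P (sg v w d + z)"
  shows "P z"
proof -
  have "K \<subseteq> carrier V \<times> carrier W \<Longrightarrow> (\<Sum>k\<in>K. Poly_Mapping.single k (f k)) \<in> carrier TF \<and>
      P (\<Sum>k\<in>K. Poly_Mapping.single k (f k))" if "finite K" for K f
    using that
  proof (induction K rule: finite_induct)
    case (insert k K)
    obtain v w where k: "k = (v, w)" by fastforce
    show ?case using insert assms(3)[of v w "\<Sum>k\<in>K. Poly_Mapping.single k (f k)" "f k"]
      by (simp add: k TF_add TF_single)
  qed (simp add: assms(2))
  from this[of "Poly_Mapping.keys z" "Poly_Mapping.lookup z"] assms(1) show ?thesis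
    by (simp add: tensor_free_def flip: single_expansion)
qed

lemma comm_group_TF: "comm_group TF"
proof (rule comm_groupI)
  fix x assume "x \<in> carrier TF"
  then show "\<exists>y\<in>carrier TF. y \<otimes>\<^bsub>TF\<^esub> x = \<one>\<^bsub>TF\<^esub>"
    by (intro bexI[of _ "- x"]) (simp_all add: TF_uminus)
qed (simp_all add: TF_add add_ac)

lemma group_TF: "Group.group TF"
  using comm_group_TF comm_group.axioms(2) by blast

lemma inv_TF: "x \<in> carrier TF \<Longrightarrow> inv\<^bsub>TF\<^esub> x = - x"
  by (rule group.inv_equality[OF group_TF]) (simp_all add: TF_uminus)

lemma rels_TF: "tensor_rels V W \<subseteq> carrier TF"
  unfolding tensor_rels_def
  by (auto intro!: TF_diff TF_single V_add V_smult W_add W_smult)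

lemma subgroup_N: "subgroup N TF"
  unfolding tensor_null_def by (rule group.generate_is_subgroup[OF group_TF rels_TF])

lemma N_TF: "z \<in> N \<Longrightarrow> z \<in> carrier TF"
  using subgroup.mem_carrier[OF subgroup_N] .

lemma N_0 [simp]: "0 \<in> N"
  using subgroup.one_closed[OF subgroup_N] by simp

lemma N_add: "x \<in> N \<Longrightarrow> y \<in> N \<Longrightarrow> x + y \<in> N"
  using subgroup.m_closed[OF subgroup_N, of x y] by simp

lemma N_uminus: "x \<in> N \<Longrightarrow> - x \<in> N"
  using subgroup.m_inv_closed[OF subgroup_N, of x] by (simp add: inv_TF N_TF)

lemma N_diff: "x \<in> N \<Longrightarrow> y \<in> N \<Longrightarrow> x - y \<in> N"
  using N_add[OF _ N_uminus, of x y] by simp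

lemma N_sum: "(\<And>t. t \<in> T \<Longrightarrow> f t \<in> N) \<Longrightarrow> (\<Sum>t\<in>T. f t) \<in> N"
  by (induction T rule: infinite_finite_induct) (simp_all add: N_add)

lemma N_rel: "z \<in> tensor_rels V W \<Longrightarrow> z \<in> N"
  unfolding tensor_null_def by (rule generate.incl)

lemma N_rels:
  "\<lbrakk>v \<in> carrier V; v' \<in> carrier V; w \<in> carrier W\<rbrakk> \<Longrightarrow> sg (v \<oplus>\<^bsub>V\<^esub> v') w d - sg v w d - sg v' w d \<in> N"
  "\<lbrakk>v \<in> carrier V; w \<in> carrier W; w' \<in> carrier W\<rbrakk> \<Longrightarrow> sg v (w \<oplus>\<^bsub>W\<^esub> w') d - sg v w d - sg v w' d \<in> N"
  "\<lbrakk>v \<in> carrier V; w \<in> carrier W\<rbrakk> \<Longrightarrow> sg (e \<odot>\<^bsub>V\<^esub> v) w d - sg v w (e * d) \<in> N"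
  "\<lbrakk>v \<in> carrier V; w \<in> carrier W\<rbrakk> \<Longrightarrow> sg v (e \<odot>\<^bsub>W\<^esub> w) d - sg v w (e * d) \<in> N"
  by (rule N_rel, unfold tensor_rels_def, blast)+

lemma N_induct [consumes 1, case_names zero add uminus rel]:
  assumes "z \<in> N" "P 0" "\<And>x y. \<lbrakk>x \<in> N; y \<in> N; P x; P y\<rbrakk> \<Longrightarrow> P (x + y)" "\<And>x. x \<in> N \<Longrightarrow> P x \<Longrightarrow> P (- x)"
    and "\<And>x. x \<in> tensor_rels V W \<Longrightarrow> P x"
  shows "P z"
  using assms(1) unfolding tensor_null_def
proof (induction rule: generate.induct)
  case one
  show ?case using assms(2) by simp
next
  case (incl h)
  then show ?case by (rule assms(5))
next
  case (inv h)
  then show ?case using rels_TF assms(4)[OF N_rel[OF inv] assms(5)[OF inv]] by (auto simp: inv_TF)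
next
  case (eng h1 h2)
  then show ?case using assms(3)[of h1 h2] by (simp add: tensor_null_def)
qed

lemma tcl_eq: "tcl z = {n + z | n. n \<in> N}"
  by (auto simp: tcl_def r_coset_def)

lemma tcl_eq_iff: "tcl z = tcl z' \<longleftrightarrow> z - z' \<in> N"
proof
  assume "tcl z = tcl z'"
  moreover have "z \<in> tcl z" unfolding tcl_eq using N_0 by force
  ultimately show "z - z' \<in> N" unfolding tcl_eq by auto
next
  assume *: "z - z' \<in> N"
  have "n + z \<in> tcl z'" if "n \<in> N" for n
    unfolding tcl_eq using N_add[OF that *] by (intro CollectI exI[of _ "n + (z - z')"]) simp
  moreover have "n + z' \<in> tcl z" if "n \<in> N" for n
    unfolding tcl_eq using N_diff[OF that *] by (intro CollectI exI[of _ "n - (z - z')"]) simp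
  ultimately show "tcl z = tcl z'" by (auto simp: tcl_eq[of z] tcl_eq[of z'])
qed

lemma tcl_mult: "tcl y <#>\<^bsub>TF\<^esub> tcl z = tcl (y + z)"
proof
  show "tcl y <#>\<^bsub>TF\<^esub> tcl z \<subseteq> tcl (y + z)"
  proof
    fix x assume "x \<in> tcl y <#>\<^bsub>TF\<^esub> tcl z"
    then obtain n n' where n: "n \<in> N" "n' \<in> N" "x = (n + y) + (n' + z)"
      by (auto simp: set_mult_def tcl_eq)
    then show "x \<in> tcl (y + z)"
      unfolding tcl_eq using N_add[OF n(1,2)] by (intro CollectI exI[of _ "n + n'"]) (simp add: add_ac)
  qed
  show "tcl (y + z) \<subseteq> tcl y <#>\<^bsub>TF\<^esub> tcl z"
  proof
    fix x assume "x \<in> tcl (y + z)"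
    then obtain n where n: "n \<in> N" "x = (n + y) + (0 + z)" by (auto simp: tcl_eq add.assoc)
    then show "x \<in> tcl y <#>\<^bsub>TF\<^esub> tcl z"
      unfolding set_mult_def tcl_eq using N_0 by (simp only: TF_simps) blast
  qed
qed

lemma tensor_simps: "carrier (tensor V W) = tcl ` carrier TF" "monoid.mult (tensor V W) = (\<lambda>X Y. X <#>\<^bsub>TF\<^esub> Y)"
  "one (tensor V W) = tcl 0"
proof -
  show "carrier (tensor V W) = tcl ` carrier TF"
    by (auto simp: tensor_def FactGroup_def RCOSETS_def tcl_def)
  show "monoid.mult (tensor V W) = (\<lambda>X Y. X <#>\<^bsub>TF\<^esub> Y)"
    by (simp add: tensor_def FactGroup_def)
  show "one (tensor V W) = tcl 0"
    by (simp add: tensor_def FactGroup_def tcl_eq)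
qed

lemma the_elem_tcl:
  assumes "\<And>n. n \<in> N \<Longrightarrow> f (n + z) = f z"
  shows "the_elem (f ` tcl z) = f z"
proof -
  have "f ` tcl z = {f z}"
  proof
    show "f ` tcl z \<subseteq> {f z}" using assms by (auto simp: tcl_eq)
    have "f z = f (0 + z)" by simp
    then show "{f z} \<subseteq> f ` tcl z" using N_0 unfolding tcl_eq by blast
  qed
  then show ?thesis by simp
qed

lemma actz_TF:
  assumes "\<And>v. v \<in> carrier V \<Longrightarrow> g v \<in> carrier V" "z \<in> carrier TF"
  shows "actz g z \<in> carrier TF"
  using assms(2) by (induction z rule: TF_induct) (simp_all add: actz_add TF_add TF_single assms(1))

lemma actz_N:
  assumes "\<And>v. v \<in> carrier V \<Longrightarrow> g v \<in> carrier V"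
    and "\<And>v v'. \<lbrakk>v \<in> carrier V; v' \<in> carrier V\<rbrakk> \<Longrightarrow> g (v \<oplus>\<^bsub>V\<^esub> v') = g v \<oplus>\<^bsub>V\<^esub> g v'"
    and "\<And>v d. v \<in> carrier V \<Longrightarrow> g (d \<odot>\<^bsub>V\<^esub> v) = d \<odot>\<^bsub>V\<^esub> g v"
    and "z \<in> N"
  shows "actz g z \<in> N"
  using assms(4)
proof (induction rule: N_induct)
  case (rel x)
  then show ?case
    unfolding tensor_rels_def by (auto simp: actz_diff assms(1-3) intro!: N_rels)
qed (simp_all add: actz_add actz_uminus N_add N_uminus)

end

section \<open>The module structure on the tensor product\<close>

context boson_data
begin

context
  fixes act and M :: "(('i, 'k) boson, 'v) module"
  assumes action: "is_boson_R_action I a s m q act" and M: "left_module B M"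
begin

interpretation B: ring B by (rule ring_B)

interpretation left_module B M by (rule M)

abbreviation "VR \<equiv> boson_k_space I a s m q (RM act) RS"
abbreviation "VM \<equiv> boson_k_space I a s m q M (boson_invariants I a s m q M)"
abbreviation "TT \<equiv> boson_R_tensor I a s m q act M"

lemma k_space_simps [simp]: "carrier VR = RS" "v \<oplus>\<^bsub>VR\<^esub> v' = v \<oplus>\<^bsub>B\<^esub> v'" "d \<odot>\<^bsub>VR\<^esub> v = act (scal d) v"
  "carrier VM = boson_invariants I a s m q M" "w \<oplus>\<^bsub>VM\<^esub> w' = w \<oplus>\<^bsub>M\<^esub> w'" "d \<odot>\<^bsub>VM\<^esub> w = scal d \<odot>\<^bsub>M\<^esub> w"
  by (simp_all add: boson_k_space_def)

lemma act_scal: "act (scal t) (RR p) = RR (scl t p)"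
  by (simp add: act_simps(5)[OF action] RR_hom(3))

lemma act_RR: "b \<in> carrier B \<Longrightarrow> \<exists>b'\<in>carrier A. b = cl b' \<and> (\<forall>p. act b (RR p) = RR (rho b' p))"
  using act_cl[OF action] by (auto simp: carrier_B)

interpretation tensor_pair VR VM
proof
  show "v \<oplus>\<^bsub>VR\<^esub> v' \<in> carrier VR" if "v \<in> carrier VR" "v' \<in> carrier VR" for v v'
    using that unfolding k_space_simps by (auto simp: RS_eq simp flip: RR_hom(1))
  show "d \<odot>\<^bsub>VR\<^esub> v \<in> carrier VR" if "v \<in> carrier VR" for v d
    using that unfolding k_space_simps by (auto simp: RS_eq act_scal)
qed (simp_all add: M0_closed[OF M])

lemma act_lin: assumes "b \<in> carrier B"
  shows "v \<in> RS \<Longrightarrow> act b v \<in> RS" "v \<in> RS \<Longrightarrow> v' \<in> RS \<Longrightarrow> act b (v \<oplus>\<^bsub>B\<^esub> v') = act b v \<oplus>\<^bsub>B\<^esub> act b v'"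
    "v \<in> RS \<Longrightarrow> act b (act (scal d) v) = act (scal d) (act b v)"
proof -
  obtain b' where b': "b' \<in> carrier A" "b = cl b'" "\<And>p. act b (RR p) = RR (rho b' p)"
    using act_RR[OF assms] by blast
  show "v \<in> RS \<Longrightarrow> act b v \<in> RS" by (auto simp: RS_eq b'(3))
  show "v \<in> RS \<Longrightarrow> v' \<in> RS \<Longrightarrow> act b (v \<oplus>\<^bsub>B\<^esub> v') = act b v \<oplus>\<^bsub>B\<^esub> act b v'"
    by (auto simp: RS_eq b'(3) flin_add[OF flin_rho2] simp flip: RR_hom(1))
  show "v \<in> RS \<Longrightarrow> act b (act (scal d) v) = act (scal d) (act b v)"
    by (auto simp: RS_eq b'(3) act_scal flin_scl[OF flin_rho2])
qed

lemma TT_simps: "carrier TT = tcl ` carrier TF" "P \<oplus>\<^bsub>TT\<^esub> Y = P <#>\<^bsub>TF\<^esub> Y" "\<zero>\<^bsub>TT\<^esub> = tcl 0"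
  by (simp_all add: boson_R_tensor_def tensor_left_module_def tensor_simps)

lemma TT_smult:
  assumes "b \<in> carrier B"
  shows "b \<odot>\<^bsub>TT\<^esub> tcl z = tcl (actz (act b) z)"
proof -
  have "b \<odot>\<^bsub>TT\<^esub> tcl z = the_elem ((\<lambda>z. tcl (actz (act b) z)) ` tcl z)"
    by (simp add: boson_R_tensor_def tensor_left_module_def actz_def tcl_def)
  also have "\<dots> = tcl (actz (act b) z)"
  proof (rule the_elem_tcl)
    fix n assume "n \<in> N"
    then have "actz (act b) n \<in> N"
      by (rule actz_N[rotated 3]) (simp_all add: act_lin[OF assms])
    then show "tcl (actz (act b) (n + z)) = tcl (actz (act b) z)"
      by (simp add: tcl_eq_iff actz_add)
  qed
  finally show ?thesis .
qed

lemma left_module_TT: "left_module B TT"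
proof (intro left_module.intro ring_B left_module_axioms.intro)
  show "abelian_group TT"
  proof (rule abelian_groupI)
    fix x assume "x \<in> carrier TT"
    then obtain z where z: "x = tcl z" "z \<in> carrier TF" by (auto simp: TT_simps)
    then show "\<exists>y\<in>carrier TT. y \<oplus>\<^bsub>TT\<^esub> x = \<zero>\<^bsub>TT\<^esub>"
      by (intro bexI[of _ "tcl (- z)"]) (simp_all add: TT_simps tcl_mult TF_uminus)
  qed (auto simp: TT_simps tcl_mult TF_add add_ac)
next
  fix b x assume b: "b \<in> carrier B" and "x \<in> carrier TT"
  then obtain z where z: "x = tcl z" "z \<in> carrier TF" by (auto simp: TT_simps)
  have "actz (act b) z \<in> carrier TF" by (rule actz_TF) (use z act_lin[OF b] in simp_all)
  then show "b \<odot>\<^bsub>TT\<^esub> x \<in> carrier TT" by (simp add: z TT_smult b TT_simps)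
next
  fix b b' x assume b: "b \<in> carrier B" "b' \<in> carrier B" and "x \<in> carrier TT"
  then obtain z where z: "x = tcl z" "z \<in> carrier TF" by (auto simp: TT_simps)
  \<comment> \<open>On representatives this holds only up to relations, since the free space does
    not identify (v + v', w) with the sum of (v, w) and (v', w).\<close>
  have "actz (act (b \<oplus>\<^bsub>B\<^esub> b')) z - (actz (act b) z + actz (act b') z) \<in> N"
    using z(2)
  proof (induction z rule: TF_induct)
    case (add v w d z)
    obtain p where p: "v = RR p" using add(1) unfolding k_space_simps unfolding RS_eq by blast
    have "sg (act b v \<oplus>\<^bsub>VR\<^esub> act b' v) w d - sg (act b v) w d - sg (act b' v) w d \<in> N"
      using add.hyps act_lin b by (intro N_rels) simp_all
    from N_add[OF this add.IH] show ?case
      by (simp add: actz_add act_simps(1)[OF action b] p algebra_simps)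
  qed simp
  then show "(b \<oplus>\<^bsub>B\<^esub> b') \<odot>\<^bsub>TT\<^esub> x = b \<odot>\<^bsub>TT\<^esub> x \<oplus>\<^bsub>TT\<^esub> b' \<odot>\<^bsub>TT\<^esub> x"
    by (simp add: z TT_smult b TT_simps tcl_mult tcl_eq_iff)
next
  fix b x y assume b: "b \<in> carrier B" and "x \<in> carrier TT" "y \<in> carrier TT"
  then obtain z z' where "x = tcl z" "y = tcl z'" by (auto simp: TT_simps)
  then show "b \<odot>\<^bsub>TT\<^esub> (x \<oplus>\<^bsub>TT\<^esub> y) = b \<odot>\<^bsub>TT\<^esub> x \<oplus>\<^bsub>TT\<^esub> b \<odot>\<^bsub>TT\<^esub> y"
    by (simp add: TT_smult b TT_simps tcl_mult actz_add)
next
  fix b b' x assume b: "b \<in> carrier B" "b' \<in> carrier B" and "x \<in> carrier TT"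
  then obtain z where z: "x = tcl z" "z \<in> carrier TF" by (auto simp: TT_simps)
  \<comment> \<open>Associativity, unlike additivity in b, is already exact on
    representatives.\<close>
  have "actz (act (b \<otimes>\<^bsub>B\<^esub> b')) z = actz (act b) (actz (act b') z)"
    using z(2)
  proof (induction z rule: TF_induct)
    case (add v w d z)
    obtain p where "v = RR p" using add(1) unfolding k_space_simps unfolding RS_eq by blast
    then show ?case using add by (simp add: actz_add act_simps(2)[OF action b])
  qed simp
  then show "(b \<otimes>\<^bsub>B\<^esub> b') \<odot>\<^bsub>TT\<^esub> x = b \<odot>\<^bsub>TT\<^esub> (b' \<odot>\<^bsub>TT\<^esub> x)"
    by (simp add: z TT_smult b)
next
  fix x assume "x \<in> carrier TT"
  then obtain z where z: "x = tcl z" "z \<in> carrier TF" by (auto simp: TT_simps)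
  have "actz (act \<one>\<^bsub>B\<^esub>) z = z"
    using z(2)
  proof (induction z rule: TF_induct)
    case (add v w d z)
    obtain p where "v = RR p" using add(1) unfolding k_space_simps unfolding RS_eq by blast
    then show ?case using add by (simp add: actz_add act_simps(4)[OF action])
  qed simp
  then show "\<one>\<^bsub>B\<^esub> \<odot>\<^bsub>TT\<^esub> x = x"
    by (simp add: z TT_smult)
qed

subsection \<open>The map \<open>\<kappa>\<close>\<close>

text \<open>The map \<kappa> on representatives. It also serves to write linear combinations in M as
  images of formal sums.\<close>

definition kap :: "(('i, 'k) boson \<times> 'v \<Rightarrow>\<^sub>0 'k) \<Rightarrow> 'v" where
  "kap z = finsum M (\<lambda>(r, x). scal (Poly_Mapping.lookup z (r, x)) \<odot>\<^bsub>M\<^esub> (r \<odot>\<^bsub>M\<^esub> x)) (Poly_Mapping.keys z)"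

lemma term_carrier: "k \<in> RS \<times> boson_invariants I a s m q M \<Longrightarrow>
    (case k of (r, x) \<Rightarrow> scal (Poly_Mapping.lookup z (r, x)) \<odot>\<^bsub>M\<^esub> (r \<odot>\<^bsub>M\<^esub> x)) \<in> carrier M"
  by (auto simp: RS_eq M0_carrier[OF M] left_smult_closed)

lemma kap_superset:
  assumes "finite K" "Poly_Mapping.keys z \<subseteq> K" "K \<subseteq> RS \<times> boson_invariants I a s m q M"
  shows "kap z = finsum M (\<lambda>(r, x). scal (Poly_Mapping.lookup z (r, x)) \<odot>\<^bsub>M\<^esub> (r \<odot>\<^bsub>M\<^esub> x)) K"
  unfolding kap_def
proof (rule M.add.finprod_mono_neutral_cong_left[OF assms(1,2)])
  fix k assume k: "k \<in> K - Poly_Mapping.keys z"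
  then obtain r x where "k = (r, x)" "r \<in> RS" "x \<in> boson_invariants I a s m q M" using assms(3) by blast
  then show "(case k of (r, x) \<Rightarrow> scal (Poly_Mapping.lookup z (r, x)) \<odot>\<^bsub>M\<^esub> (r \<odot>\<^bsub>M\<^esub> x)) = \<zero>\<^bsub>M\<^esub>"
    using k by (auto simp: in_keys_iff scal_hom RS_eq M0_carrier[OF M] left_smult_closed smult_zero_left[OF M])
qed (use assms(3) term_carrier in \<open>auto simp: Pi_def\<close>)

lemma TF_keys: "z \<in> carrier TF \<Longrightarrow> Poly_Mapping.keys z \<subseteq> RS \<times> boson_invariants I a s m q M"
  by (simp add: tensor_free_def)

lemma kap_closed: "z \<in> carrier TF \<Longrightarrow> kap z \<in> carrier M"
  unfolding kap_def using TF_keys[of z] term_carrier by (intro finsum_closed) blast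

lemma kap_add:
  assumes "y \<in> carrier TF" "z \<in> carrier TF"
  shows "kap (y + z) = kap y \<oplus>\<^bsub>M\<^esub> kap z"
proof -
  let ?K = "Poly_Mapping.keys y \<union> Poly_Mapping.keys z"
  have K: "?K \<subseteq> RS \<times> boson_invariants I a s m q M" using TF_keys assms by blast
  have "kap (y + z) = finsum M (\<lambda>(r, x). scal (Poly_Mapping.lookup (y + z) (r, x)) \<odot>\<^bsub>M\<^esub> (r \<odot>\<^bsub>M\<^esub> x)) ?K"
    by (rule kap_superset) (use K Poly_Mapping.keys_add[of y z] in auto)
  also have "\<dots> = finsum M (\<lambda>k. (case k of (r, x) \<Rightarrow> scal (Poly_Mapping.lookup y (r, x)) \<odot>\<^bsub>M\<^esub> (r \<odot>\<^bsub>M\<^esub> x)) \<oplus>\<^bsub>M\<^esub>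
      (case k of (r, x) \<Rightarrow> scal (Poly_Mapping.lookup z (r, x)) \<odot>\<^bsub>M\<^esub> (r \<odot>\<^bsub>M\<^esub> x))) ?K"
  proof (rule M.add.finprod_cong'[OF refl])
    fix k assume "k \<in> ?K"
    then obtain r x where k: "k = (r, x)" "r \<in> RS" "x \<in> boson_invariants I a s m q M" using K by blast
    then have "r \<odot>\<^bsub>M\<^esub> x \<in> carrier M" by (auto simp: RS_eq M0_carrier[OF M] left_smult_closed)
    then show "(case k of (r, x) \<Rightarrow> scal (Poly_Mapping.lookup (y + z) (r, x)) \<odot>\<^bsub>M\<^esub> (r \<odot>\<^bsub>M\<^esub> x)) =
      (case k of (r, x) \<Rightarrow> scal (Poly_Mapping.lookup y (r, x)) \<odot>\<^bsub>M\<^esub> (r \<odot>\<^bsub>M\<^esub> x)) \<oplus>\<^bsub>M\<^esub>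
      (case k of (r, x) \<Rightarrow> scal (Poly_Mapping.lookup z (r, x)) \<odot>\<^bsub>M\<^esub> (r \<odot>\<^bsub>M\<^esub> x))"
      by (simp add: k lookup_add scal_hom left_smult_l_distr)
  qed (use K term_carrier in \<open>auto simp: Pi_def\<close>)
  also have "\<dots> = finsum M (\<lambda>(r, x). scal (Poly_Mapping.lookup y (r, x)) \<odot>\<^bsub>M\<^esub> (r \<odot>\<^bsub>M\<^esub> x)) ?K \<oplus>\<^bsub>M\<^esub>
      finsum M (\<lambda>(r, x). scal (Poly_Mapping.lookup z (r, x)) \<odot>\<^bsub>M\<^esub> (r \<odot>\<^bsub>M\<^esub> x)) ?K"
    using K term_carrier by (intro M.add.finprod_multf) blast+
  also have "\<dots> = kap y \<oplus>\<^bsub>M\<^esub> kap z"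
  proof -
    have "kap y = finsum M (\<lambda>(r, x). scal (Poly_Mapping.lookup y (r, x)) \<odot>\<^bsub>M\<^esub> (r \<odot>\<^bsub>M\<^esub> x)) ?K"
      by (rule kap_superset) (use K in auto)
    moreover have "kap z = finsum M (\<lambda>(r, x). scal (Poly_Mapping.lookup z (r, x)) \<odot>\<^bsub>M\<^esub> (r \<odot>\<^bsub>M\<^esub> x)) ?K"
      by (rule kap_superset) (use K in auto)
    ultimately show ?thesis by simp
  qed
  finally show ?thesis .
qed

lemma kap_0 [simp]: "kap 0 = \<zero>\<^bsub>M\<^esub>"
  by (simp add: kap_def)

lemma kap_single:
  assumes "r \<in> RS" "x \<in> boson_invariants I a s m q M"
  shows "kap (sg r x d) = scal d \<odot>\<^bsub>M\<^esub> (r \<odot>\<^bsub>M\<^esub> x)"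
proof -
  have "kap (sg r x d) = finsum M (\<lambda>(r', x'). scal (Poly_Mapping.lookup (sg r x d) (r', x')) \<odot>\<^bsub>M\<^esub> (r' \<odot>\<^bsub>M\<^esub> x')) {(r, x)}"
    by (rule kap_superset) (use assms in auto)
  also have "\<dots> = scal d \<odot>\<^bsub>M\<^esub> (r \<odot>\<^bsub>M\<^esub> x)"
    using term_carrier[of "(r, x)" "sg r x d"] assms by simp
  finally show ?thesis .
qed

lemma RS_smult_closed: "r \<in> RS \<Longrightarrow> x \<in> carrier M \<Longrightarrow> r \<odot>\<^bsub>M\<^esub> x \<in> carrier M"
  by (auto simp: RS_eq left_smult_closed)

lemma kap_uminus: "z \<in> carrier TF \<Longrightarrow> kap (- z) = \<ominus>\<^bsub>M\<^esub> kap z"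
  using kap_add[of "- z" z] by (intro M.minus_equality[symmetric]) (simp_all add: TF_uminus kap_closed)

lemma kap_diff_eq:
  assumes "y \<in> carrier TF" "z \<in> carrier TF" "kap y = kap z"
  shows "kap (y - z) = \<zero>\<^bsub>M\<^esub>"
  using kap_add[OF assms(1) TF_uminus[OF assms(2)]] assms
  by (simp add: kap_uminus kap_closed M.r_neg)

lemma kap_N: "z \<in> N \<Longrightarrow> kap z = \<zero>\<^bsub>M\<^esub>"
proof (induction rule: N_induct)
  case (rel x)
  have RS: "v \<oplus>\<^bsub>B\<^esub> v' \<in> RS" if "v \<in> RS" "v' \<in> RS" for v v'
    using that by (auto simp: RS_eq simp flip: RR_hom)
  have act: "act (scal d) v = scal d \<otimes>\<^bsub>B\<^esub> v \<and> act (scal d) v \<in> RS \<and> v \<in> carrier B" if "v \<in> RS" for v d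
  proof -
    obtain p where "v = RR p" using \<open>v \<in> RS\<close> unfolding RS_eq by blast
    then show ?thesis using RR_RS[of "scl d p"] by (simp add: act_scal RR_hom(3))
  qed
  note x = M0_carrier[OF M]
  from rel show ?case
    unfolding tensor_rels_def
  proof (elim UnE CollectE exE conjE)
    fix v v' w d assume *: "x = sg (v \<oplus>\<^bsub>VR\<^esub> v') w d - sg v w d - sg v' w d" "v \<in> carrier VR" "v' \<in> carrier VR" "w \<in> carrier VM"
    have "kap (sg (v \<oplus>\<^bsub>B\<^esub> v') w d) = kap (sg v w d + sg v' w d)"
      using * act x by (simp add: kap_add kap_single TF_single RS left_smult_l_distr left_smult_r_distr left_smult_closed)
    from kap_diff_eq[OF _ _ this] show ?thesis using * by (simp add: TF_single TF_add RS diff_diff_eq)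
  next
    fix v w w' d assume *: "x = sg v (w \<oplus>\<^bsub>VM\<^esub> w') d - sg v w d - sg v w' d" "v \<in> carrier VR" "w \<in> carrier VM" "w' \<in> carrier VM"
    have "kap (sg v (w \<oplus>\<^bsub>M\<^esub> w') d) = kap (sg v w d + sg v w' d)"
      using * act x by (simp add: kap_add kap_single TF_single M0_closed[OF M] left_smult_l_distr left_smult_r_distr left_smult_closed)
    from kap_diff_eq[OF _ _ this] show ?thesis using * by (simp add: TF_single TF_add M0_closed[OF M] diff_diff_eq)
  next
    fix e v w d assume *: "x = sg (e \<odot>\<^bsub>VR\<^esub> v) w d - sg v w (e * d)" "v \<in> carrier VR" "w \<in> carrier VM"
    have m: "scal e \<otimes>\<^bsub>B\<^esub> v \<in> RS" using *(2) act[of v e] by (metis k_space_simps(1))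
    have "kap (sg (act (scal e) v) w d) = kap (sg v w (e * d))"
      using m * act[of v] x by (simp add: kap_single left_smult_assoc left_smult_closed mult.commute[of e d] scal_hom)
    from kap_diff_eq[OF _ _ this] show ?thesis using m * act[of v e] by (simp add: TF_single)
  next
    fix e v w d assume *: "x = sg v (e \<odot>\<^bsub>VM\<^esub> w) d - sg v w (e * d)" "v \<in> carrier VR" "w \<in> carrier VM"
    have "kap (sg v (scal e \<odot>\<^bsub>M\<^esub> w) d) = kap (sg v w (e * d))"
      using * act[of v] x scal_smult_comm[OF M, of v w e]
      by (simp add: kap_single left_smult_assoc left_smult_closed mult.commute[of e d] scal_hom M0_closed[OF M])
    from kap_diff_eq[OF _ _ this] show ?thesis using * by (simp add: TF_single M0_closed[OF M])
  qed
qed (simp_all add: kap_add kap_uminus N_TF)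

lemma kappa_tcl:
  assumes "z \<in> carrier TF"
  shows "boson_kappa I a s m q M (tcl z) = kap z"
proof -
  have "boson_kappa I a s m q M (tcl z) = the_elem (kap ` tcl z)"
    by (simp add: boson_kappa_def kap_def[abs_def])
  also have "\<dots> = kap z"
    by (rule the_elem_tcl) (simp add: kap_add kap_N N_TF kap_closed assms)
  finally show ?thesis .
qed

lemma kap_actz:
  assumes "b \<in> carrier B" "z \<in> carrier TF"
  shows "kap (actz (act b) z) = b \<odot>\<^bsub>M\<^esub> kap z"
  using assms(2)
proof (induction z rule: TF_induct)
  case zero
  show ?case by (simp add: smult_zero_right[OF M] assms(1))
next
  case (add v w d z)
  obtain b' where b': "b' \<in> carrier A" "b = cl b'" "\<And>p. act b (RR p) = RR (rho b' p)"
    using act_RR[OF assms(1)] by blast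
  obtain p where p: "v = RR p" using add(1) unfolding k_space_simps unfolding RS_eq by blast
  have TF: "actz (act b) z \<in> carrier TF" by (rule actz_TF) (use add act_lin[OF assms(1)] in simp_all)
  have w: "w \<in> carrier M" using add(2) M0_carrier[OF M] by simp
  have "kap (sg (act b v) w d) = b \<odot>\<^bsub>M\<^esub> kap (sg v w d)"
    using add(1,2) smult_M0[OF M b'(1), of w p]
      scal_smult_comm[OF M assms(1), of "RR p \<odot>\<^bsub>M\<^esub> w" d]
    by (simp add: kap_single p b'(3) left_smult_closed w b'(2)[symmetric])
  then show ?case
    using add TF assms(1) act_lin(1)[OF assms(1)]
    by (simp add: actz_add kap_add TF_single left_smult_r_distr kap_closed)
qed

lemma kappa_hom: "boson_kappa I a s m q M \<in> left_module_hom B TT M"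
  unfolding left_module_hom_def
proof (intro CollectI conjI ballI left_module_TT M funcsetI)
  fix x assume "x \<in> carrier TT"
  then show "boson_kappa I a s m q M x \<in> carrier M"
    by (auto simp: TT_simps kappa_tcl kap_closed)
next
  fix x y assume "x \<in> carrier TT" "y \<in> carrier TT"
  then show "boson_kappa I a s m q M (x \<oplus>\<^bsub>TT\<^esub> y) = boson_kappa I a s m q M x \<oplus>\<^bsub>M\<^esub> boson_kappa I a s m q M y"
    by (auto simp: TT_simps tcl_mult kappa_tcl TF_add kap_add)
next
  fix b x assume b: "b \<in> carrier B" and "x \<in> carrier TT"
  then obtain z where z: "x = tcl z" "z \<in> carrier TF" by (auto simp: TT_simps)
  have "actz (act b) z \<in> carrier TF" by (rule actz_TF) (use z act_lin[OF b] in simp_all)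
  then show "boson_kappa I a s m q M (b \<odot>\<^bsub>TT\<^esub> x) = b \<odot>\<^bsub>M\<^esub> boson_kappa I a s m q M x"
    by (simp add: z b TT_smult kappa_tcl kap_actz)
qed

section \<open>Injectivity of kappa\<close>

lemma one_RS: "\<one>\<^bsub>B\<^esub> \<in> RS"
  using RR_RS[of 1] by (simp add: RR_hom(4))

lemma kap_sum_cong:
  assumes "finite T" "\<And>t. t \<in> T \<Longrightarrow> f t \<in> carrier TF" "\<And>t. t \<in> T \<Longrightarrow> g t \<in> carrier TF"
    and "\<And>t. t \<in> T \<Longrightarrow> kap (f t) = kap (g t)"
  shows "kap (\<Sum>t\<in>T. f t) = kap (\<Sum>t\<in>T. g t)"
  using assms by (induction T rule: finite_induct) (simp_all add: kap_add TF_sum)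

lemma sg_zero: "x \<in> boson_invariants I a s m q M \<Longrightarrow> sg \<zero>\<^bsub>B\<^esub> x d \<in> N"
  using N_rels(3)[of "\<zero>\<^bsub>B\<^esub>" x 0 d] RR_RS[of 0] act_scal[of 0 0] by (simp add: RR_hom(5))

lemma sg_scl: "x \<in> boson_invariants I a s m q M \<Longrightarrow> sg (RR (scl d p)) x e - sg (RR p) x (d * e) \<in> N"
  using N_rels(3)[of "RR p" x d e] by (simp add: act_scal)

lemma sg_RR_add: "x \<in> boson_invariants I a s m q M \<Longrightarrow> sg (RR (p + p')) x d - (sg (RR p) x d + sg (RR p') x d) \<in> N"
  using N_rels(1)[of "RR p" "RR p'" x d] by (simp add: RR_hom(1) diff_diff_eq)

text \<open>The combination \<Sigma> d_t x_t is written as the image of \<Sigma> d_t (1 \<otimes>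
  x_t). It is again invariant, so p \<otimes> \<Sigma> d_t x_t makes sense and may be
  expanded.\<close>

lemma kap_in_M0:
  assumes "finite T" "\<And>t. t \<in> T \<Longrightarrow> x t \<in> boson_invariants I a s m q M"
  shows "kap (\<Sum>t\<in>T. sg (RR 1) (x t) (d t)) \<in> boson_invariants I a s m q M \<and>
    sg (RR p) (kap (\<Sum>t\<in>T. sg (RR 1) (x t) (d t))) 1 - (\<Sum>t\<in>T. sg (RR p) (x t) (d t)) \<in> N"
  using assms
proof (induction T rule: finite_induct)
  case empty
  have "sg (RR p) \<zero>\<^bsub>M\<^esub> 1 \<in> N"
    using N_rels(4)[of "RR p" "\<zero>\<^bsub>M\<^esub>" 0 1] M0_closed(3)[OF M] by (simp add: smult_zero_right[OF M])
  then show ?case using M0_closed(3)[OF M] by simp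
next
  case (insert t T)
  let ?y = "\<Sum>t\<in>T. sg (RR 1) (x t) (d t)"
  have x: "x t \<in> boson_invariants I a s m q M" using insert.prems by simp
  have IH: "kap ?y \<in> boson_invariants I a s m q M"
    "sg (RR p) (kap ?y) 1 - (\<Sum>t\<in>T. sg (RR p) (x t) (d t)) \<in> N"
    using insert.IH insert.prems by auto
  have y: "?y \<in> carrier TF" using insert.prems by (intro TF_sum TF_single) simp_all
  have kap: "kap (sg (RR 1) (x t) (d t) + ?y) = scal (d t) \<odot>\<^bsub>M\<^esub> x t \<oplus>\<^bsub>M\<^esub> kap ?y"
    using x y M0_carrier[OF M x] by (simp add: kap_add TF_single kap_single RR_hom(4) one_RS left_smult_one)
  have sx: "scal (d t) \<odot>\<^bsub>M\<^esub> x t \<in> boson_invariants I a s m q M" by (rule M0_closed(2)[OF M x])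
  have "sg (RR p) (scal (d t) \<odot>\<^bsub>M\<^esub> x t \<oplus>\<^bsub>M\<^esub> kap ?y) 1 - sg (RR p) (scal (d t) \<odot>\<^bsub>M\<^esub> x t) 1 - sg (RR p) (kap ?y) 1 \<in> N"
    using N_rels(2)[of "RR p" "scal (d t) \<odot>\<^bsub>M\<^esub> x t" "kap ?y" 1] sx IH(1) by simp
  moreover have "sg (RR p) (scal (d t) \<odot>\<^bsub>M\<^esub> x t) 1 - sg (RR p) (x t) (d t) \<in> N"
    using N_rels(4)[of "RR p" "x t" "d t" 1] x by simp
  ultimately have "(sg (RR p) (scal (d t) \<odot>\<^bsub>M\<^esub> x t \<oplus>\<^bsub>M\<^esub> kap ?y) 1 - sg (RR p) (scal (d t) \<odot>\<^bsub>M\<^esub> x t) 1 - sg (RR p) (kap ?y) 1)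
     + (sg (RR p) (scal (d t) \<odot>\<^bsub>M\<^esub> x t) 1 - sg (RR p) (x t) (d t))
     + (sg (RR p) (kap ?y) 1 - (\<Sum>t\<in>T. sg (RR p) (x t) (d t))) \<in> N"
    using IH(2) by (intro N_add)
  then show ?case
    using insert.hyps by (simp add: kap M0_closed(1)[OF M sx IH(1)] algebra_simps)
qed

lemma kap_scale:
  assumes "finite T" "\<And>t. t \<in> T \<Longrightarrow> x t \<in> boson_invariants I a s m q M"
  shows "kap (\<Sum>t\<in>T. sg (RR 1) (x t) (e * d t)) = scal e \<odot>\<^bsub>M\<^esub> kap (\<Sum>t\<in>T. sg (RR 1) (x t) (d t))"
  using assms
proof (induction T rule: finite_induct)
  case empty
  show ?case by (simp add: smult_zero_right[OF M])
next
  case (insert t T)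
  have x: "x t \<in> boson_invariants I a s m q M" "RR 1 \<odot>\<^bsub>M\<^esub> x t \<in> carrier M"
    using insert.prems M0_carrier[OF M] by (simp_all add: left_smult_closed)
  have y: "(\<Sum>t\<in>T. sg (RR 1) (x t) (d t)) \<in> carrier TF" "(\<Sum>t\<in>T. sg (RR 1) (x t) (e * d t)) \<in> carrier TF"
    using insert.prems by (intro TF_sum TF_single; simp)+
  show ?case
    using insert x y by (simp add: kap_add TF_single kap_single left_smult_r_distr kap_closed left_smult_closed
        scal_hom left_smult_assoc)
qed

text \<open>If the vectors \<open>x t\<close> are linearly independent, applying words in the \<open>e\<close> from the longest
  downwards shows that every \<open>p t\<close> lies in the radical of the form.\<close>

lemma independent_case:
  assumes "finite T" "\<And>t. t \<in> T \<Longrightarrow> x t \<in> boson_invariants I a s m q M"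
    and indep: "\<And>d t. \<lbrakk>kap (\<Sum>t\<in>T. sg (RR 1) (x t) (d t)) = \<zero>\<^bsub>M\<^esub>; t \<in> T\<rbrakk> \<Longrightarrow> d t = 0"
    and p: "\<And>t. proj (p t) = p t" and kap: "kap (\<Sum>t\<in>T. sg (RR (p t)) (x t) 1) = \<zero>\<^bsub>M\<^esub>"
    and t: "t \<in> T"
  shows "RR (p t) = \<zero>\<^bsub>B\<^esub>"
proof -
  have TF: "(\<Sum>t\<in>T. sg (RR (f t)) (x t) 1) \<in> carrier TF" for f
    using assms(2) by (intro TF_sum TF_single) simp_all
  have fold: "kap (\<Sum>t\<in>T. sg (RR (fold lder u (p t))) (x t) 1) = \<zero>\<^bsub>M\<^esub>" for u
  proof (induction u rule: rev_induct)
    case Nil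
    show ?case using kap by simp
  next
    case (snoc z u)
    show ?case
    proof (cases "z \<in> X")
      case True
      let ?s = "\<Sum>t\<in>T. sg (RR (fold lder u (p t))) (x t) 1"
      have s: "(\<Sum>t\<in>T. sg (RR (fold lder (u @ [z]) (p t))) (x t) 1) = actz (act (be (fst z) (snd z))) ?s"
        by (simp add: actz_sum act_be[OF action True])
      have "kap (\<Sum>t\<in>T. sg (RR (fold lder (u @ [z]) (p t))) (x t) 1) = be (fst z) (snd z) \<odot>\<^bsub>M\<^esub> kap ?s"
        unfolding s by (rule kap_actz[OF be_B[OF M True] TF])
      also have "\<dots> = \<zero>\<^bsub>M\<^esub>"
        unfolding snoc by (rule smult_zero_right[OF M be_B[OF M True]])
      finally show ?thesis .
    next
      case False
      then have "lder z (fold lder u (p t)) = 0" for t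
        using lder_proj_outside[OF False, of "fold lder u (p t)"] by (simp add: proj_fold_lder p)
      moreover have "(\<Sum>t\<in>T. sg (RR 0) (x t) 1) \<in> N"
        by (rule N_sum) (simp add: RR_hom(5) sg_zero assms(2))
      ultimately show ?thesis using kap_N by simp
    qed
  qed
  obtain K where K: "\<And>t u. t \<in> T \<Longrightarrow> K < length u \<Longrightarrow> frm u (p t) = 0"
  proof -
    have "\<exists>K. \<forall>u. K < length u \<longrightarrow> frm u (p t) = 0" for t by (rule frm_bounded)
    then obtain k where k: "\<And>t u. k t < length u \<Longrightarrow> frm u (p t) = 0" by metis
    have "k t \<le> (\<Sum>t\<in>T. k t)" if "t \<in> T" for t
      using member_le_sum[OF that, of k] assms(1) by simp
    then show ?thesis using k by (intro that[of "\<Sum>t\<in>T. k t"]) (meson le_less_trans)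
  qed
  \<comment> \<open>At stage n all words of length greater than K - n are covered. For the next
    length, applying the word to each \<open>p t\<close> gives a scalar, so a vanishing image
    becomes a linear relation among the x_t.\<close>
  have descend: "\<forall>u. K < length u + n \<longrightarrow> (\<forall>t\<in>T. frm u (p t) = 0)" for n
  proof (induction n)
    case 0
    then show ?case using K by simp
  next
    case (Suc n)
    show ?case
    proof (intro allI impI)
      fix u :: "('i \<times> nat) list" assume u: "K < length u + Suc n"
      have const: "RR (fold lder u (p t)) = scal (frm u (p t))" if "t \<in> T" for t
      proof -
        have "frm v (fold lder u (p t)) = 0" if "v \<noteq> []" for v
        proof -
          have "K < length (u @ v) + n" using u that by (cases v) auto
          then show ?thesis using Suc \<open>t \<in> T\<close> by (simp flip: frm_append)
        qed
        then have "RR (fold lder u (p t)) = scal (frm [] (fold lder u (p t)))"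
          by (intro RR_minus_const) (simp_all add: proj_fold_lder p)
        then show ?thesis using frm_append[of u "[]" "p t"] by simp
      qed
      have "kap (\<Sum>t\<in>T. sg (RR 1) (x t) (frm u (p t))) = kap (\<Sum>t\<in>T. sg (RR (fold lder u (p t))) (x t) 1)"
      proof (rule kap_sum_cong[OF assms(1)])
        fix t assume t: "t \<in> T"
        have s: "scal (frm u (p t)) \<in> RS" unfolding RR_scal by simp
        show "sg (RR 1) (x t) (frm u (p t)) \<in> carrier TF" "sg (RR (fold lder u (p t))) (x t) 1 \<in> carrier TF"
          using assms(2)[OF t] by (simp_all add: TF_single)
        show "kap (sg (RR 1) (x t) (frm u (p t))) = kap (sg (RR (fold lder u (p t))) (x t) 1)"
          using assms(2)[OF t] M0_carrier[OF M assms(2)[OF t]] s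
          by (simp add: const[OF t] kap_single RR_hom(4) one_RS scal_hom(3) left_smult_one left_smult_closed)
      qed
      then show "\<forall>t\<in>T. frm u (p t) = 0" using indep fold by auto
    qed
  qed
  have "frm u (p t) = 0" for u using descend[of "Suc K"] t by simp
  then have "p t \<in> SS" by (simp add: rad_def flip: rad_eq_SS)
  then show ?thesis by (simp add: RR_eq_0_iff p)
qed

text \<open>Induction on the number of pure tensors replaces the choice of a basis: if the x_t are
  independent, \<open>independent_case\<close> applies; otherwise one of them is eliminated.\<close>

lemma kap_kernel:
  "\<lbrakk>finite T; \<And>t. t \<in> T \<Longrightarrow> x t \<in> boson_invariants I a s m q M;
    kap (\<Sum>t\<in>T. sg (RR (p t)) (x t) 1) = \<zero>\<^bsub>M\<^esub>\<rbrakk> \<Longrightarrow> (\<Sum>t\<in>T. sg (RR (p t)) (x t) 1) \<in> N"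
proof (induction "card T" arbitrary: T p)
  case 0
  then show ?case by simp
next
  case (Suc n)
  show ?case
  proof (cases "\<exists>d. kap (\<Sum>t\<in>T. sg (RR 1) (x t) (d t)) = \<zero>\<^bsub>M\<^esub> \<and> (\<exists>t\<in>T. d t \<noteq> 0)")
    case False
    have "RR (proj (p t)) = \<zero>\<^bsub>B\<^esub>" if "t \<in> T" for t
      by (rule independent_case[where x=x and T=T and p="\<lambda>t. proj (p t)"])
        (use Suc.prems False that in auto)
    then show ?thesis using Suc.prems by (intro N_sum) (simp add: sg_zero)
  next
    case True
    then obtain d i where d: "kap (\<Sum>t\<in>T. sg (RR 1) (x t) (d t)) = \<zero>\<^bsub>M\<^esub>" "i \<in> T" "d i \<noteq> 0" by blast
    define T' where "T' = T - {i}"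
    \<comment> \<open>Normalized so that the coefficient at i is -1; the relation then expresses x_i
      through the other x_t with coefficients e_t.\<close>
    define e where "e t = - (1 / d i) * d t" for t
    have T: "finite T'" "i \<notin> T'" "T = insert i T'" "card T' = n"
      using Suc.prems(1) Suc.hyps(2) d(2) by (auto simp: T'_def)
    have x: "x i \<in> boson_invariants I a s m q M" "\<And>t. t \<in> T' \<Longrightarrow> x t \<in> boson_invariants I a s m q M"
      using Suc.prems(2) T(3) by auto
    let ?y = "\<Sum>t\<in>T'. sg (RR 1) (x t) (e t)"
    have y: "?y \<in> carrier TF" using x by (intro TF_sum TF_single) simp_all
    have "kap (\<Sum>t\<in>T. sg (RR 1) (x t) (e t)) = \<zero>\<^bsub>M\<^esub>"
      using kap_scale[OF Suc.prems(1,2), where e="- (1 / d i)" and d=d] d(1)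
      by (simp add: e_def smult_zero_right[OF M])
    then have 0: "kap (sg (RR 1) (x i) (- 1) + ?y) = \<zero>\<^bsub>M\<^esub>"
      using T d(3) by (simp add: e_def)
    have "kap ?y = kap (sg (RR 1) (x i) 1 + (sg (RR 1) (x i) (- 1) + ?y))"
      by (simp add: add.assoc[symmetric] flip: single_add)
    also have "\<dots> = kap (sg (RR 1) (x i) 1) \<oplus>\<^bsub>M\<^esub> kap (sg (RR 1) (x i) (- 1) + ?y)"
      by (rule kap_add) (use x y in \<open>simp_all add: TF_single TF_add\<close>)
    also have "\<dots> = x i"
      unfolding 0 using x M0_carrier[OF M x(1)]
      by (simp add: kap_single RR_hom(4) one_RS scal_hom(3) left_smult_one)
    finally have xi: "kap ?y = x i" .
    \<comment> \<open>Substituting for x_i distributes p_i \<otimes> x_i over the remaining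
      tensors.\<close>
    define p' where "p' t = p t + scl (e t) (p i)" for t
    have 1: "sg (RR (p i)) (x i) 1 - (\<Sum>t\<in>T'. sg (RR (p i)) (x t) (e t)) \<in> N"
      using kap_in_M0[where T=T' and x=x and d=e and p="p i"] T(1) x(2) xi by simp
    have "(\<Sum>t\<in>T'. sg (RR (p' t)) (x t) 1 - (sg (RR (p t)) (x t) 1 + sg (RR (p i)) (x t) (e t))) \<in> N"
    proof (rule N_sum)
      fix t assume "t \<in> T'"
      note xt = x(2)[OF this]
      from N_add[OF sg_RR_add[OF xt, of "p t" "scl (e t) (p i)" 1] sg_scl[OF xt, of "e t" "p i" 1]]
      show "sg (RR (p' t)) (x t) 1 - (sg (RR (p t)) (x t) 1 + sg (RR (p i)) (x t) (e t)) \<in> N"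
        by (simp add: p'_def algebra_simps)
    qed
    then have 2: "(\<Sum>t\<in>T'. sg (RR (p' t)) (x t) 1) -
        ((\<Sum>t\<in>T'. sg (RR (p t)) (x t) 1) + (\<Sum>t\<in>T'. sg (RR (p i)) (x t) (e t))) \<in> N"
      by (simp add: sum_subtractf sum.distrib)
    let ?z = "\<Sum>t\<in>T. sg (RR (p t)) (x t) 1" and ?z' = "\<Sum>t\<in>T'. sg (RR (p' t)) (x t) 1"
    have diff: "?z - ?z' \<in> N"
      using N_diff[OF 1 2] T by (simp add: algebra_simps)
    have "?z \<in> carrier TF" "?z' \<in> carrier TF" using Suc.prems(2) x by (intro TF_sum TF_single; simp)+
    then have "kap ?z' = kap (?z + - (?z - ?z'))" by simp
    also have "\<dots> = \<zero>\<^bsub>M\<^esub>"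
      using kap_add[OF \<open>?z \<in> carrier TF\<close> N_TF[OF N_uminus[OF diff]]] kap_N[OF N_uminus[OF diff]] Suc.prems(3)
      by simp
    finally have kap': "kap ?z' = \<zero>\<^bsub>M\<^esub>" .
    have "?z' \<in> N"
      by (rule Suc.hyps(1)[OF _ _ _ kap']) (use T x in simp_all)
    from N_add[OF diff this] show ?thesis by simp
  qed
qed

lemma kap_inj:
  assumes "z \<in> carrier TF" "kap z = \<zero>\<^bsub>M\<^esub>"
  shows "z \<in> N"
proof -
  let ?T = "Poly_Mapping.keys z"
  have keys: "fst k \<in> RS" "snd k \<in> boson_invariants I a s m q M" if "k \<in> ?T" for k
    using TF_keys[OF assms(1)] that by auto
  have "\<forall>r\<in>RS. \<exists>p. r = RR p" by (auto simp: RS_eq)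
  then obtain f where f: "\<And>r. r \<in> RS \<Longrightarrow> r = RR (f r)" by metis
  \<comment> \<open>Coefficients are moved into the first factor, giving the normal form with scalar
    1 that \<open>kap_kernel\<close> expects.\<close>
  define p where "p k = scl (Poly_Mapping.lookup z k) (f (fst k))" for k
  let ?z = "\<Sum>k\<in>?T. sg (RR (p k)) (snd k) 1"
  have diff: "?z - z \<in> N"
  proof -
    have "?z - z = (\<Sum>k\<in>?T. sg (RR (p k)) (snd k) 1 - Poly_Mapping.single k (Poly_Mapping.lookup z k))"
      unfolding sum_subtractf using single_expansion[of z] by simp
    also have "\<dots> \<in> N"
    proof (rule N_sum)
      fix k assume k: "k \<in> ?T"
      have "Poly_Mapping.single k (Poly_Mapping.lookup z k) = sg (RR (f (fst k))) (snd k) (Poly_Mapping.lookup z k * 1)"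
        using f[OF keys(1)[OF k]] by (simp add: surjective_pairing[symmetric])
      then show "sg (RR (p k)) (snd k) 1 - Poly_Mapping.single k (Poly_Mapping.lookup z k) \<in> N"
        unfolding p_def using sg_scl[OF keys(2)[OF k]] by metis
    qed
    finally show ?thesis .
  qed
  have "kap ?z = kap (z + (?z - z))" by simp
  also have "\<dots> = \<zero>\<^bsub>M\<^esub>"
    using kap_add[OF assms(1) N_TF[OF diff]] kap_N[OF diff] assms(2) by simp
  finally have "?z \<in> N" by (intro kap_kernel) (simp_all add: keys)
  from N_diff[OF this diff] show ?thesis by simp
qed

lemma kappa_inj: "inj_on (boson_kappa I a s m q M) (carrier TT)"
proof (rule inj_onI)
  fix x y assume "x \<in> carrier TT" "y \<in> carrier TT"
    and eq: "boson_kappa I a s m q M x = boson_kappa I a s m q M y"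
  then obtain z z' where z: "x = tcl z" "z \<in> carrier TF" "y = tcl z'" "z' \<in> carrier TF"
    by (auto simp: TT_simps)
  then have "kap (z - z') = \<zero>\<^bsub>M\<^esub>" using eq by (intro kap_diff_eq) (simp_all add: kappa_tcl)
  from kap_inj[OF TF_diff[OF z(2,4)] this] show "x = y" by (simp add: z tcl_eq_iff)
qed

lemma kappa_pure:
  assumes "r \<in> RS" "x \<in> boson_invariants I a s m q M"
  shows "boson_kappa I a s m q M (boson_R_pure I a s m q act M r x) = r \<odot>\<^bsub>M\<^esub> x"
proof -
  have "boson_R_pure I a s m q act M r x = tcl (sg r x 1)"
    by (simp add: boson_R_pure_def pure_tensor_def tcl_def)
  then show ?thesis
    using assms M0_carrier[OF M assms(2)]
    by (simp add: kappa_tcl TF_single kap_single scal_hom left_smult_one RS_smult_closed)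
qed

end

end

text \<open>The assertions are quantified over \<open>act\<close>; \<open>act_exists\<close> shows
  that this is not vacuous, and \<open>act_cl\<close> that all such \<open>act\<close> agree on
  R.\<close>

theorem theorem4p1:
  fixes I :: "'i set" and a :: "'i \<Rightarrow> 'i \<Rightarrow> int" and s m :: "'i \<Rightarrow> nat"
    and q :: "'k::field_char_0"
  assumes "charged_borcherds_cartan I a s m"
    and "q \<noteq> 0" and "\<not> algebraic q"
  shows "(\<exists>act. is_boson_R_action I a s m q act) \<and>
    (\<forall>act. is_boson_R_action I a s m q act \<longrightarrow>
       simple_left_module (boson_alg I a s m q) (boson_R_module I a s m q act) \<and>
       (\<forall>M :: (('i, 'k) boson, 'v) module. left_module (boson_alg I a s m q) M \<longrightarrow>
          boson_kappa I a s m q M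
            \<in> left_module_hom (boson_alg I a s m q) (boson_R_tensor I a s m q act M) M \<and>
          (\<forall>r\<in>boson_R I a s m q. \<forall>x\<in>boson_invariants I a s m q M.
             boson_kappa I a s m q M (boson_R_pure I a s m q act M r x) = r \<odot>\<^bsub>M\<^esub> x) \<and>
          inj_on (boson_kappa I a s m q M) (carrier (boson_R_tensor I a s m q act M))) \<and>
       boson_invariants I a s m q (boson_R_module I a s m q act) = range (boson_scal I a s m q))"
proof -
  interpret boson_data I a s m q
    using assms by (intro boson_data.intro boson_data_axioms.intro)
  show ?thesis
  proof (intro conjI allI impI ballI)
    show "\<exists>act. is_boson_R_action I a s m q act" by (rule act_exists)
  next
    fix act assume act: "is_boson_R_action I a s m q act"
    show "simple_left_module B (RM act)" by (rule RM_simple[OF act])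
    show "boson_invariants I a s m q (RM act) = range scal" by (rule RM_invariants[OF act])
    fix M :: "(('i, 'k) boson, 'v) module" assume M: "left_module B M"
    show "boson_kappa I a s m q M \<in> left_module_hom B (boson_R_tensor I a s m q act M) M"
      by (rule kappa_hom[OF act M])
    show "inj_on (boson_kappa I a s m q M) (carrier (boson_R_tensor I a s m q act M))"
      by (rule kappa_inj[OF act M])
    fix r x assume "r \<in> RS" "x \<in> boson_invariants I a s m q M"
    then show "boson_kappa I a s m q M (boson_R_pure I a s m q act M r x) = r \<odot>\<^bsub>M\<^esub> x"
      by (rule kappa_pure[OF act M])
  qed
qed

end
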